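(* Let $P$ be a simple (not necessarily convex) hexagon with corners labeled $0,1,\dots,5$ cyclically, $[i]$ the angle at corner $i$, and $|\bar{i}|$ the length of the side $\bar i$ joining corners $i$ and $i+1$ (indices mod $6$). Suppose $[0]+[1]+[2]=[3]+[4]+[5]=2\pi$, $|\bar{2}|=|\bar{5}|$, each of $|\bar{0}|$, $|\bar{1}|$ differs from the lengths of all the other five sides, and $|\bar{3}|=|\bar{4}|$. Then every side-to-side tiling of the Euclidean plane by congruent copies of $P$ in which every vertex has degree $3$ is obtained by gluing, along their boundaries, a bi-infinite sequence of strips, each congruent to the strip $S$ described below and placed in one of two directions (as $S$ or as its mirror image in a line perpendicular to the strip), where the directions of the different strips can be chosen independently. Depending on the choice of directions, the resulting tiling may or may not be periodic, and the periodic ones cover infinitely many minimal torus tilings.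
   Context: The strip $S$: let $v$ be the vector from corner $0$ to corner $2$ of $P$ (under the hypotheses, the sides $\bar 2$ and $\bar 5$ are parallel of equal length, so $P+v$ meets $P$ along the side $\bar2$ of $P$ = side $\bar5$ of $P+v$), and let $R$ be the rotation by $\pi$ about the midpoint of the side $\bar 1$ of $P$. Then $S$ is the collection of tiles $\{P+kv,\ R(P)+kv : k\in\mathbb{Z}\}$; it tiles an infinite band whose two boundary lines consist of sides $\bar3$ and $\bar4$ of its tiles. Tiles are congruent copies of $P$ under isometries of the plane. A tiling is side-to-side if its vertices and edges coincide with corners and sides of tiles; the degree of a vertex is the number of tiles meeting there. Periodic: invariant under two linearly independent translations. A plane tiling invariant under a lattice $\Lambda$ of translations induces a tiling of the flat torus $\mathbb{C}/\Lambda$, and for a sublattice $\Lambda'\subset\Lambda$ the induced tiling of $\mathbb{C}/\Lambda'$ covers that of $\mathbb{C}/\Lambda$; the plane tiling covers each such torus tiling. A torus tiling $\mathcal{T}$ is minimal if whenever $\mathcal{T}$ covers a torus tiling $\mathcal{T}'$, then $\mathcal{T}=\mathcal{T}'$. *)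

theory Defs
  imports "HOL-Complex_Analysis.Complex_Analysis" "HOL-Library.Numeral_Type"
begin

section \<open>Hexagons\<close>

text \<open>
  The plane is \<^typ>\<open>complex\<close>.  A hexagon is the cyclic sequence of its corners, indexed by the
  type \<open>6\<close> of integers mod 6, so that \<open>p (i + 1)\<close> and \<open>p (i - 1)\<close> are always the neighbours of
  \<open>p i\<close>.  Keeping the corners, and not only the region, as data matters because a corner whose
  angle is \<open>\<pi>\<close> is not excluded and would not be recoverable from the region.
\<close>

type_synonym hexagon = "6 \<Rightarrow> complex"

definition side :: "hexagon \<Rightarrow> 6 \<Rightarrow> complex set" where
  "side p i = closed_segment (p i) (p (i + 1))"

definition side_length :: "hexagon \<Rightarrow> 6 \<Rightarrow> real" where
  "side_length p i = dist (p i) (p (i + 1))"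

definition boundary_path :: "hexagon \<Rightarrow> real \<Rightarrow> complex" where
  "boundary_path p = linepath (p 0) (p 1) +++ linepath (p 1) (p 2) +++ linepath (p 2) (p 3) +++
                     linepath (p 3) (p 4) +++ linepath (p 4) (p 5) +++ linepath (p 5) (p 0)"

definition simple_hexagon :: "hexagon \<Rightarrow> bool" where
  "simple_hexagon p \<longleftrightarrow> simple_path (boundary_path p)"

definition region :: "hexagon \<Rightarrow> complex set" where
  "region p = path_image (boundary_path p) \<union> inside (path_image (boundary_path p))"

definition counterclockwise :: "hexagon \<Rightarrow> bool" where
  "counterclockwise p \<longleftrightarrow>
     (\<forall>z\<in>inside (path_image (boundary_path p)). winding_number (boundary_path p) z = 1)"

text \<open>
  The interior angle at a corner of a simple hexagon, with values in \<open>(0, 2\<pi>)\<close>.  If the corners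
  run counterclockwise, the interior is swept by turning the side towards the next corner
  counterclockwise until it reaches the side towards the previous one; if they run clockwise,
  the two sides exchange roles.
\<close>

definition angle_at :: "hexagon \<Rightarrow> 6 \<Rightarrow> real" where
  "angle_at p i =
     (if counterclockwise p then Arg2pi ((p (i - 1) - p i) / (p (i + 1) - p i))
      else Arg2pi ((p (i + 1) - p i) / (p (i - 1) - p i)))"

section \<open>Tilings of the plane\<close>

definition plane_isometry :: "(complex \<Rightarrow> complex) \<Rightarrow> bool" where
  "plane_isometry f \<longleftrightarrow> (\<forall>x y. dist (f x) (f y) = dist x y)"

definition move :: "(complex \<Rightarrow> complex) \<Rightarrow> hexagon set \<Rightarrow> hexagon set" where
  "move f T = (\<lambda>q. f \<circ> q) ` T"

definition congruent_copy :: "hexagon \<Rightarrow> hexagon \<Rightarrow> bool" where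
  "congruent_copy p q \<longleftrightarrow> (\<exists>f. plane_isometry f \<and> q = f \<circ> p)"

definition covered :: "hexagon set \<Rightarrow> complex set" where
  "covered T = (\<Union>q\<in>T. region q)"

definition tiling_by :: "hexagon \<Rightarrow> hexagon set \<Rightarrow> bool" where
  "tiling_by p T \<longleftrightarrow>
     (\<forall>q\<in>T. congruent_copy p q) \<and> covered T = UNIV \<and>
     (\<forall>q\<in>T. \<forall>q'\<in>T. q \<noteq> q' \<longrightarrow> interior (region q) \<inter> interior (region q') = {})"

definition side_to_side :: "hexagon set \<Rightarrow> bool" where
  "side_to_side T \<longleftrightarrow>
     (\<forall>q\<in>T. \<forall>q'\<in>T. \<forall>i j. side q i = side q' j \<or> side q i \<inter> side q' j \<subseteq> range q \<inter> range q')"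

definition degree_at :: "hexagon set \<Rightarrow> complex \<Rightarrow> nat" where
  "degree_at T x = card {q\<in>T. x \<in> region q}"

text \<open>In a side-to-side tiling the vertices are exactly the corners of the tiles.\<close>

definition degree3_tiling :: "hexagon \<Rightarrow> hexagon set \<Rightarrow> bool" where
  "degree3_tiling p T \<longleftrightarrow>
     tiling_by p T \<and> side_to_side T \<and> (\<forall>q\<in>T. \<forall>i. degree_at T (q i) = 3)"

definition periodic :: "hexagon set \<Rightarrow> bool" where
  "periodic T \<longleftrightarrow>
     (\<exists>a b. a \<noteq> b \<and> independent {a, b} \<and> move ((+) a) T = T \<and> move ((+) b) T = T)"

section \<open>The strip and its gluings\<close>

definition shift :: "hexagon \<Rightarrow> complex" where
  "shift p = p 2 - p 0"

definition half_turn :: "hexagon \<Rightarrow> complex \<Rightarrow> complex" where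
  "half_turn p z = 2 * midpoint (p 1) (p 2) - z"

definition strip :: "hexagon \<Rightarrow> hexagon set" where
  "strip p = (\<Union>k::int. {\<lambda>i. p i + of_int k * shift p,
                         \<lambda>i. half_turn p (p i) + of_int k * shift p})"

text \<open>
  The two boundary lines of the strip: one consists of the sides 3 and 4 of the tiles \<open>P + kv\<close>,
  the other one of those of the tiles \<open>R(P) + kv\<close>.
\<close>

definition line1 :: "hexagon \<Rightarrow> complex set" where
  "line1 p = (\<Union>k::int. (\<lambda>z. z + of_int k * shift p) ` (side p 3 \<union> side p 4))"

definition line2 :: "hexagon \<Rightarrow> complex set" where
  "line2 p = (\<Union>k::int. (\<lambda>z. half_turn p z + of_int k * shift p) ` (side p 3 \<union> side p 4))"

text \<open>
  Reflection in the line through 0 perpendicular to the strip; other perpendicular lines give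
  the same up to a translation.
\<close>

definition mirror :: "hexagon \<Rightarrow> complex \<Rightarrow> complex" where
  "mirror p z = z - (2 * (z \<bullet> shift p) / (shift p \<bullet> shift p)) *\<^sub>R shift p"

definition place :: "hexagon \<Rightarrow> bool \<Rightarrow> complex \<Rightarrow> complex \<Rightarrow> complex" where
  "place p b a z = a + (if b then z else mirror p z)"

text \<open>
  The \<open>n\<close>-th strip is the translate by \<open>a n\<close> of \<open>S\<close> (if \<open>d n\<close>) or of its mirror image (if not).
  Neither placement exchanges the two sides of the strip, so consecutive strips are always glued
  along \<open>line1\<close> of the former and \<open>line2\<close> of the latter.  This is no restriction: the half turn
  \<open>R\<close> maps \<open>S\<close> to itself and exchanges the two lines.
\<close>

definition strip_gluing :: "hexagon \<Rightarrow> (int \<Rightarrow> bool) \<Rightarrow> hexagon set \<Rightarrow> bool" where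
  "strip_gluing p d T \<longleftrightarrow>
     (\<exists>a :: int \<Rightarrow> complex.
        let f = (\<lambda>n. place p (d n) (a n)); S = (\<lambda>n. move (f n) (strip p)) in
          T = (\<Union>n. S n) \<and>
          (\<forall>n. f n ` line1 p = f (n + 1) ` line2 p \<and>
               covered (S n) \<inter> covered (S (n + 1)) = f n ` line1 p) \<and>
          (\<forall>m n. n + 1 < m \<longrightarrow> covered (S n) \<inter> covered (S m) = {}))"

section \<open>Torus tilings\<close>

definition lattice :: "complex set \<Rightarrow> bool" where
  "lattice L \<longleftrightarrow>
     (\<exists>a b. a \<noteq> b \<and> independent {a, b} \<and> L = {of_int m * a + of_int n * b | m n :: int. True})"

text \<open>
  A tiling of the flat torus \<open>\<complex>/L\<close> is represented by the pair of \<open>L\<close> and its preimage in the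
  plane, an \<open>L\<close>-invariant tiling.
\<close>

type_synonym torus_tiling = "complex set \<times> hexagon set"

definition is_torus_tiling :: "hexagon \<Rightarrow> torus_tiling \<Rightarrow> bool" where
  "is_torus_tiling p X \<longleftrightarrow>
     lattice (fst X) \<and> degree3_tiling p (snd X) \<and> (\<forall>l\<in>fst X. move ((+) l) (snd X) = snd X)"

definition torus_covers :: "torus_tiling \<Rightarrow> torus_tiling \<Rightarrow> bool" where
  "torus_covers X Y \<longleftrightarrow> fst X \<subseteq> fst Y \<and> snd X = snd Y"

definition plane_covers :: "hexagon set \<Rightarrow> torus_tiling \<Rightarrow> bool" where
  "plane_covers T X \<longleftrightarrow> snd X = T"

definition minimal_torus_tiling :: "hexagon \<Rightarrow> torus_tiling \<Rightarrow> bool" where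
  "minimal_torus_tiling p X \<longleftrightarrow>
     is_torus_tiling p X \<and> (\<forall>Y. is_torus_tiling p Y \<and> torus_covers X Y \<longrightarrow> X = Y)"

text \<open>
  Torus tilings are counted up to isometries of the tori, which lift to isometries of the plane;
  \<open>\<lambda>l. f l - f 0\<close> is the linear part of \<open>f\<close>.
\<close>

definition torus_isometry :: "(torus_tiling \<times> torus_tiling) set" where
  "torus_isometry =
     {(X, Y). \<exists>f. plane_isometry f \<and> fst Y = (\<lambda>l. f l - f 0) ` fst X \<and> snd Y = move f (snd X)}"

end

theory Submission
  imports Defs "HOL-Library.Groups_Big_Fun"
begin

text \<open>
  The indicator of a simple hexagon is the sum over its sides of the angles they subtend
  (winding number), and also the number of signed crossings of its sides with a ray.  Crossings
  of glued sides cancel.  Summed over the strip, only the two boundary lines survive, which are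
  graphs of triangle waves because the sides 3 and 4 are equal; hence the tiles of the strip
  cover exactly the band between two such graphs, once.  These bands can be stacked in
  either direction.  Near a corner, the same cancellation shows that three tiles sharing sides
  cyclically fill a neighbourhood, so every vertex of a stack has degree 3.

  Conversely, in a tiling with all degrees 3 the unique lengths of the sides 0 and 1 force the
  corners 0, 1, 2 to meet, so each tile generates its strip by half turns; across side 3 only a
  half turn or a glide reflection is possible, which starts the next strip.  The labelled tiles
  of a strip are either all direct or all indirect copies of \<open>P\<close>, so that a translation
  preserves the directions of the strips; this yields non-periodic stacks, and stacks whose
  period lattice has arbitrarily large covolume.
\<close>

section \<open>Simple hexagons\<close>

text \<open>As \<open>P\<close> may be non-convex and may have flat corners, nothing is read off
  from convexity or from the shape of a corner. Covering and overlap become identities between sums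
  of indicators. These hold only off the boundaries, a negligible set; openness of the interiors and
  closedness of the covered sets extend the conclusions to all points. Corners may run clockwise,
  and mirrored tiles reverse the sense anyway, so the sign \<open>ori\<close> accompanies every
  identity. The angle sum at the corners 0, 1, 2 enters through \<open>parallel_sides\<close>: with
  the equality of the sides 2 and 5 it gives \<open>p 3 - p 2 = p 5 - p 0\<close>, from which the
  translation \<open>v\<close> of the strip arises. The directions of the strips are independent
  because the triangle wave is even: mirroring a strip only shifts the phase of its boundary graphs,
  and the offset of the next strip absorbs the shift. Covolume separates the tori because
  \<open>Im (cnj a * b)\<close> is, up to sign, the same for all bases of a lattice and invariant
  under isometries.\<close>

lemma UNIV_6: "(UNIV :: 6 set) = {0,1,2,3,4,5}"
proof -
  have "card {0,1,2,3,4,5::6} = 6" by simp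
  then have "card {0,1,2,3,4,5::6} = card (UNIV :: 6 set)" by simp
  then show ?thesis by (metis card_subset_eq finite subset_UNIV)
qed

lemma all_6: "(\<forall>i::6. P i) \<longleftrightarrow> P 0 \<and> P 1 \<and> P 2 \<and> P 3 \<and> P 4 \<and> P 5"
  by (metis UNIV_6 UNIV_I empty_iff insert_iff)

lemma six_cases:
  obtains "i = (0::6)" | "i = 1" | "i = 2" | "i = 3" | "i = 4" | "i = 5"
  by (metis UNIV_6 UNIV_I empty_iff insert_iff)

lemma sum_6: "(\<Sum>i\<in>(UNIV::6 set). f i) = f 0 + f 1 + f 2 + f 3 + f 4 + (f 5 :: 'a :: comm_monoid_add)"
  unfolding UNIV_6 by (simp add: add.assoc)

lemma six_simps [simp]: "(6::6) = 0" "(-1::6) = 5"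
  by simp_all

lemma path_image_boundary: "path_image (boundary_path p) = (\<Union>i. side p i)"
  unfolding UNIV_6 by (auto simp: boundary_path_def path_image_join side_def)

lemma loop_boundary: "pathfinish (boundary_path p) = pathstart (boundary_path p)"
  by (simp add: boundary_path_def)

text \<open>The criterion for a joined closed path to be simple compares each segment with the union
  of the later ones. The first comparison allows two common points, because the loop closes at
  \<open>a0\<close>; the corner exclusions decide which of them occurs. Abstract sets keep the
  geometry out of the case analysis.\<close>

lemma six_sets:
  assumes "a0 \<in> S0" "a1 \<in> S0" "a1 \<in> S1" "a2 \<in> S1" "a2 \<in> S2" "a3 \<in> S2" "a3 \<in> S3" "a4 \<in> S3"
      "a4 \<in> S4" "a5 \<in> S4" "a5 \<in> S5" "a0 \<in> S5"
    and ne: "a0 \<noteq> a1" "a1 \<noteq> a2" "a2 \<noteq> a3" "a3 \<noteq> a4" "a4 \<noteq> a5" "a5 \<noteq> a0"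
    and 0: "\<And>x. x \<in> S0 \<Longrightarrow> x \<in> S1 \<or> x \<in> S2 \<or> x \<in> S3 \<or> x \<in> S4 \<or> x \<in> S5 \<Longrightarrow> x = a0 \<or> x = a1"
    and 1: "\<And>x. x \<in> S1 \<Longrightarrow> x \<in> S2 \<or> x \<in> S3 \<or> x \<in> S4 \<or> x \<in> S5 \<Longrightarrow> x = a2"
    and 2: "\<And>x. x \<in> S2 \<Longrightarrow> x \<in> S3 \<or> x \<in> S4 \<or> x \<in> S5 \<Longrightarrow> x = a3"
    and 3: "\<And>x. x \<in> S3 \<Longrightarrow> x \<in> S4 \<or> x \<in> S5 \<Longrightarrow> x = a4"
    and 4: "\<And>x. x \<in> S4 \<Longrightarrow> x \<in> S5 \<Longrightarrow> x = a5"
  shows "a1 \<noteq> a3 \<and> a2 \<noteq> a4 \<and> a3 \<noteq> a5 \<and> a4 \<noteq> a0 \<and> a1 \<noteq> a4 \<and> a1 \<noteq> a5 \<and> a2 \<noteq> a5 \<and> a2 \<noteq> a0 \<and> a3 \<noteq> a0" (is ?D)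
    and "S0 \<inter> S1 = {a1}" "S1 \<inter> S2 = {a2}" "S2 \<inter> S3 = {a3}" "S3 \<inter> S4 = {a4}" "S4 \<inter> S5 = {a5}" "S5 \<inter> S0 = {a0}"
    and "S0 \<inter> S2 = {}" "S0 \<inter> S3 = {}" "S0 \<inter> S4 = {}" "S1 \<inter> S3 = {}" "S1 \<inter> S4 = {}" "S1 \<inter> S5 = {}"
      "S2 \<inter> S4 = {}" "S2 \<inter> S5 = {}" "S3 \<inter> S5 = {}"
proof -
  show D: ?D
    by (metis assms(1-12) ne 1 2 3 4)
  have E: "A \<inter> B = {a}" if "a \<in> A" "a \<in> B" "\<And>x. x \<in> A \<Longrightarrow> x \<in> B \<Longrightarrow> x = a" for A B and a :: 'a
    using that by blast
  show "S1 \<inter> S2 = {a2}" using E[OF assms(4,5)] 1 by metis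
  show "S2 \<inter> S3 = {a3}" using E[OF assms(6,7)] 2 by metis
  show "S3 \<inter> S4 = {a4}" using E[OF assms(8,9)] 3 by metis
  show "S4 \<inter> S5 = {a5}" using E[OF assms(10,11)] 4 by metis
  have n1: "a0 \<notin> S1" "a1 \<notin> S5" using 1 assms(1-12) ne D by metis+
  show "S0 \<inter> S1 = {a1}" using E[OF assms(2,3)] 0 n1 by metis
  show "S5 \<inter> S0 = {a0}" using E[OF assms(12,1)] 0 n1 by metis
  have "a0 \<notin> S2" "a0 \<notin> S3" "a0 \<notin> S4" "a1 \<notin> S2" "a1 \<notin> S3" "a1 \<notin> S4"
    using 1 2 3 4 assms(1-12) ne D by metis+
  then show "S0 \<inter> S2 = {}" "S0 \<inter> S3 = {}" "S0 \<inter> S4 = {}" using 0 by (metis disjoint_iff)+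
  have "a2 \<notin> S3" "a2 \<notin> S4" "a2 \<notin> S5" "a3 \<notin> S4" "a3 \<notin> S5" "a4 \<notin> S5"
    using 2 3 4 assms(1-12) ne D by metis+
  then show "S1 \<inter> S3 = {}" "S1 \<inter> S4 = {}" "S1 \<inter> S5 = {}" "S2 \<inter> S4 = {}" "S2 \<inter> S5 = {}" "S3 \<inter> S5 = {}"
    using 1 2 3 by (metis disjoint_iff)+
qed

lemma simple_hexagon_sides:
  assumes "simple_hexagon p"
  shows "inj p" "\<And>i. side p i \<inter> side p (i + 1) = {p (i + 1)}"
    "\<And>i j. i \<noteq> j \<Longrightarrow> j \<noteq> i + 1 \<Longrightarrow> i \<noteq> j + 1 \<Longrightarrow> side p i \<inter> side p j = {}"
proof -
  have s: "simple_path (boundary_path p)" using assms by (simp add: simple_hexagon_def)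
  have arcs: "arc (linepath (p 0) (p 1))" "arc (linepath (p 1) (p 2))" "arc (linepath (p 2) (p 3))"
     "arc (linepath (p 3) (p 4))" "arc (linepath (p 4) (p 5))" "arc (linepath (p 5) (p 0))" and
     ints: "side p 0 \<inter> (side p 1 \<union> (side p 2 \<union> (side p 3 \<union> (side p 4 \<union> side p 5)))) \<subseteq> {p 0, p 1}"
     "side p 1 \<inter> (side p 2 \<union> (side p 3 \<union> (side p 4 \<union> side p 5))) \<subseteq> {p 2}"
     "side p 2 \<inter> (side p 3 \<union> (side p 4 \<union> side p 5)) \<subseteq> {p 3}"
     "side p 3 \<inter> (side p 4 \<union> side p 5) \<subseteq> {p 4}"
     "side p 4 \<inter> side p 5 \<subseteq> {p 5}"
    using s unfolding boundary_path_def
    by (simp_all add: simple_path_join_loop_eq arc_join_eq path_image_join side_def)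
  note six = six_sets[of "p 0" "side p 0" "p 1" "side p 1" "p 2" "side p 2" "p 3" "side p 3" "p 4" "side p 4" "p 5" "side p 5"]
  have ne: "p 0 \<noteq> p 1" "p 1 \<noteq> p 2" "p 2 \<noteq> p 3" "p 3 \<noteq> p 4" "p 4 \<noteq> p 5" "p 5 \<noteq> p 0"
    using arcs[THEN arc_distinct_ends] by simp_all
  have e: "p 0 \<in> side p 0" "p 1 \<in> side p 0" "p 1 \<in> side p 1" "p 2 \<in> side p 1" "p 2 \<in> side p 2" "p 3 \<in> side p 2"
     "p 3 \<in> side p 3" "p 4 \<in> side p 3" "p 4 \<in> side p 4" "p 5 \<in> side p 4" "p 5 \<in> side p 5" "p 0 \<in> side p 5"
    by (auto simp: side_def)
  have i: "x \<in> side p 0 \<Longrightarrow> x \<in> side p 1 \<or> x \<in> side p 2 \<or> x \<in> side p 3 \<or> x \<in> side p 4 \<or> x \<in> side p 5 \<Longrightarrow> x = p 0 \<or> x = p 1"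
    "x \<in> side p 1 \<Longrightarrow> x \<in> side p 2 \<or> x \<in> side p 3 \<or> x \<in> side p 4 \<or> x \<in> side p 5 \<Longrightarrow> x = p 2"
    "x \<in> side p 2 \<Longrightarrow> x \<in> side p 3 \<or> x \<in> side p 4 \<or> x \<in> side p 5 \<Longrightarrow> x = p 3"
    "x \<in> side p 3 \<Longrightarrow> x \<in> side p 4 \<or> x \<in> side p 5 \<Longrightarrow> x = p 4"
    "x \<in> side p 4 \<Longrightarrow> x \<in> side p 5 \<Longrightarrow> x = p 5" for x
    using ints by (auto simp: subset_eq)
  note six = six[OF e ne i, simplified]
  have "\<forall>i j. p i = p j \<longrightarrow> i = j"
    unfolding all_6 using ne six(1) by auto
  then show "inj p" by (simp add: inj_def)
  have "\<forall>i. side p i \<inter> side p (i + 1) = {p (i + 1)}"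
    unfolding all_6 using six(2-7) by simp
  then show "\<And>i. side p i \<inter> side p (i + 1) = {p (i + 1)}" by blast
  have "\<forall>i j. i \<noteq> j \<longrightarrow> j \<noteq> i + 1 \<longrightarrow> i \<noteq> j + 1 \<longrightarrow> side p i \<inter> side p j = {}"
    unfolding all_6 using six(8-) by (simp add: Int_commute)
  then show "\<And>i j. i \<noteq> j \<Longrightarrow> j \<noteq> i + 1 \<Longrightarrow> i \<noteq> j + 1 \<Longrightarrow> side p i \<inter> side p j = {}" by blast
qed

lemma corner_in_side_iff:
  assumes "simple_hexagon p"
  shows "p i \<in> side p j \<longleftrightarrow> j = i \<or> j = i - 1"
proof
  show "j = i \<or> j = i - 1 \<Longrightarrow> p i \<in> side p j" by (auto simp: side_def)
next
  assume a: "p i \<in> side p j"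
  have i: "p i \<in> side p i" "p i \<in> side p (i - 1)" by (auto simp: side_def)
  note S = simple_hexagon_sides[OF assms]
  show "j = i \<or> j = i - 1"
  proof (rule ccontr)
    assume n: "\<not> ?thesis"
    show False
    proof (cases "j = i + 1")
      case True
      then have "p i = p (i + 1)" using S(2)[of i] a i by auto
      with S(1) show False by (metis add_cancel_right_right injD zero_neq_one)
    next
      case False
      then have "side p i \<inter> side p j = {}" using S(3)[of i j] n by fastforce
      then show False using a i by blast
    qed
  qed
qed

lemma corner_ne: "simple_hexagon p \<Longrightarrow> p i \<noteq> p (i + 1)"
  using simple_hexagon_sides(1) by (metis add_cancel_right_right injD zero_neq_one)

lemma side_unique:
  assumes "simple_hexagon p" "x \<in> side p i" "x \<in> side p j" "x \<noteq> p j" "x \<noteq> p (j + 1)"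
  shows "i = j"
proof (rule ccontr)
  assume "i \<noteq> j"
  note S = simple_hexagon_sides[OF assms(1)]
  have "i \<noteq> j + 1" using S(2)[of j] assms by auto
  moreover have "j \<noteq> i + 1" using S(2)[of i] assms by auto
  ultimately show False using S(3)[OF \<open>i \<noteq> j\<close>] assms by blast
qed

text \<open>Midpoints serve as test points for gluing: near a point of a side that is no corner,
  only that side of the hexagon matters.\<close>

lemma midpoint_side:
  assumes "simple_hexagon p"
  shows "midpoint (p i) (p (i + 1)) \<in> side p i" "midpoint (p i) (p (i + 1)) \<notin> range p"
proof -
  let ?x = "midpoint (p i) (p (i + 1))"
  show x: "?x \<in> side p i" by (simp add: side_def)
  show "?x \<notin> range p"
  proof
    assume "?x \<in> range p"
    then obtain k where k: "?x = p k" by blast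
    then have "i = k \<or> i = k - 1" using corner_in_side_iff[OF assms, of k i] x by simp
    then have "?x = p i \<or> ?x = p (i + 1)" using k by auto
    then show False using corner_ne[OF assms, of i] by (auto simp: midpoint_eq_iff)
  qed
qed

section \<open>Interior and boundary of a hexagon\<close>

definition bdry :: "hexagon \<Rightarrow> complex set" where
  "bdry p = (\<Union>i. side p i)"

definition body :: "hexagon \<Rightarrow> complex set" where
  "body p = inside (bdry p)"

lemma region_eq: "region p = bdry p \<union> body p"
  by (simp add: region_def bdry_def body_def path_image_boundary)

lemma side_subset_bdry: "side p i \<subseteq> bdry p"
  by (auto simp: bdry_def)

lemma corner_in_bdry: "p i \<in> bdry p"
  using side_subset_bdry[of p i] by (auto simp: side_def)

text \<open>The Jordan curve theorem. The boundary is also the frontier of the outside, which keeps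
  the interior of the region from exceeding \<open>body\<close> and later puts a second tile at
  every boundary point.\<close>

lemma simple_hexagon_topology:
  assumes "simple_hexagon p"
  shows "open (body p)" "connected (body p)" "body p \<noteq> {}" "bounded (body p)"
    "body p \<inter> bdry p = {}" "frontier (body p) = bdry p" "closure (body p) = region p"
    "compact (region p)" "interior (region p) = body p"
    "\<And>x. x \<in> bdry p \<Longrightarrow> x \<in> closure (- region p)"
proof -
  have J: "path_image (boundary_path p) = bdry p" by (simp add: path_image_boundary bdry_def)
  note T = Jordan_inside_outside[OF assms[unfolded simple_hexagon_def] loop_boundary, unfolded J]
  show o: "open (body p)" "connected (body p)" "body p \<noteq> {}" "bounded (body p)"
    and d: "body p \<inter> bdry p = {}" and f: "frontier (body p) = bdry p"
    using T by (auto simp: body_def)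
  show c: "closure (body p) = region p"
    using closure_Un_frontier[of "body p"] f by (auto simp: region_eq)
  show "compact (region p)" using c o(4) by (metis compact_closure)
  have out: "- region p = outside (bdry p)"
    by (simp add: region_eq body_def outside_inside)
  show out': "x \<in> closure (- region p)" if "x \<in> bdry p" for x
    unfolding out using T that closure_Un_frontier[of "outside (bdry p)"] by auto
  show "interior (region p) = body p"
  proof
    show "body p \<subseteq> interior (region p)"
      by (rule interior_maximal) (auto simp: o region_eq)
    show "interior (region p) \<subseteq> body p"
      using out' interior_closure[of "region p"] interior_subset[of "region p"] by (auto simp: region_eq)
  qed
qed

section \<open>Indicators from subtended angles and ray crossings\<close>

definition ang :: "complex \<Rightarrow> complex \<Rightarrow> complex \<Rightarrow> real" where
  "ang a b z = Re (winding_number (linepath a b) z)"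

definition ori :: "hexagon \<Rightarrow> real" where
  "ori p = (if counterclockwise p then 1 else -1)"

lemma ori_cases: "ori p = 1 \<or> ori p = -1"
  by (simp add: ori_def)

text \<open>The exponential of the winding number of a segment is the quotient of its end vectors. A
  segment winds by less than half a turn around a point off it, so the principal argument is the
  right branch. The real part in \<open>ang\<close> discards the logarithm of the ratio of
  distances.\<close>

lemma ang_Arg:
  assumes "z \<notin> closed_segment a b"
  shows "ang a b z = Arg ((b - z) / (a - z)) / (2 * pi)" "\<bar>ang a b z\<bar> < 1/2"
proof -
  let ?w = "winding_number (linepath a b) z"
  show b: "\<bar>ang a b z\<bar> < 1/2" using winding_number_lt_half_linepath[OF assms] by (simp add: ang_def)
  have "b - z = exp (2 * pi * \<i> * ?w) * (a - z)"
    using winding_number_exp_2pi[of "linepath a b" z] assms by simp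
  moreover have "a \<noteq> z" using assms by auto
  ultimately have "(b - z) / (a - z) = exp (2 * pi * \<i> * ?w)" by (simp add: field_simps)
  also have "\<dots> = exp (of_real (-2 * pi * Im ?w) + \<i> * of_real (2 * pi * Re ?w))"
    by (intro arg_cong[where f = exp]) (simp add: complex_eq_iff)
  also have "\<dots> = of_real (exp (-2 * pi * Im ?w)) * exp (\<i> * of_real (2 * pi * Re ?w))"
    unfolding exp_add exp_of_real by simp
  finally have e: "of_real (exp (-2 * pi * Im ?w)) * exp (\<i> * of_real (2 * pi * Re ?w)) = (b - z) / (a - z)" by simp
  have "2 * pi * \<bar>Re ?w\<bar> < pi"
    using mult_strict_left_mono[OF b, of "2 * pi"] by (simp add: ang_def)
  then have "\<bar>2 * pi * Re ?w\<bar> < pi" by (simp add: abs_mult)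
  then have "Arg ((b - z) / (a - z)) = 2 * pi * Re ?w"
    using Arg_unique[OF e] unfolding abs_less_iff by simp
  then show "ang a b z = Arg ((b - z) / (a - z)) / (2 * pi)" by (simp add: ang_def)
qed

lemma ang_commute: "z \<notin> closed_segment a b \<Longrightarrow> ang b a z = - ang a b z"
  using winding_number_reversepath[of "linepath a b" z] by (simp add: ang_def)

lemma continuous_on_ang: "continuous_on (- closed_segment a b) (ang a b)"
  unfolding ang_def using continuous_on_winding_number[of "linepath a b"]
  by (intro continuous_intros) auto

lemma indicator_body:
  assumes "simple_hexagon p" "z \<notin> bdry p"
  shows "of_bool (z \<in> body p) = ori p * (\<Sum>i\<in>UNIV. ang (p i) (p (i + 1)) z)"
proof -
  let ?g = "boundary_path p"
  have J: "path_image ?g = bdry p" by (simp add: path_image_boundary bdry_def)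
  have s: "simple_path ?g" using assms by (simp add: simple_hexagon_def)
  have z: "z \<notin> side p i" for i using assms side_subset_bdry by blast
  have z': "z \<notin> closed_segment (p 0) (p 1)" "z \<notin> closed_segment (p 1) (p 2)" "z \<notin> closed_segment (p 2) (p 3)"
    "z \<notin> closed_segment (p 3) (p 4)" "z \<notin> closed_segment (p 4) (p 5)" "z \<notin> closed_segment (p 5) (p 0)"
    using z[of 0] z[of 1] z[of 2] z[of 3] z[of 4] z[of 5] by (simp_all add: side_def)
  have sum: "Re (winding_number ?g z) = (\<Sum>i\<in>UNIV. ang (p i) (p (i + 1)) z)"
    unfolding sum_6 boundary_path_def using z'
    by (simp add: winding_number_join path_image_join ang_def)
  show ?thesis
  proof (cases "z \<in> body p")
    case True
    have "winding_number ?g z = 1 \<or> winding_number ?g z = -1"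
      using simple_closed_path_winding_number_inside[OF s] True loop_boundary
      by (metis J body_def)
    \<comment> \<open>The winding number is constant on the inside, so the single point
      \<open>z\<close> decides the quantified statement in \<open>counterclockwise\<close>.\<close>
    moreover have "counterclockwise p \<longleftrightarrow> winding_number ?g z = 1"
      using simple_closed_path_winding_number_inside[OF s] True
      by (metis J body_def counterclockwise_def one_neq_neg_one)
    ultimately have "Re (winding_number ?g z) = ori p" by (auto simp: ori_def)
    then show ?thesis using True sum ori_cases[of p] by auto
  next
    case False
    then have "z \<in> outside (path_image ?g)"
      using assms(2) by (metis J UnE body_def inside_Un_outside ComplI)
    then have "winding_number ?g z = 0"
      using winding_number_zero_in_outside[of ?g z] s loop_boundary simple_path_imp_path by blast
    then show ?thesis using False sum by simp
  qed
qed

text \<open>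
  The signed crossing of the segment from \<open>a\<close> to \<open>b\<close> with the ray from \<open>z\<close> in the direction
  \<open>\<i> * v\<close>.  The asymmetric inequalities count a segment ending on the ray once, not twice.
\<close>

definition crs :: "complex \<Rightarrow> complex \<Rightarrow> complex \<Rightarrow> complex \<Rightarrow> real" where
  "crs v a b z =
     (if Re ((a - z) / v) > 0 \<and> Re ((b - z) / v) \<le> 0 \<and> Im ((b - z) / (a - z)) > 0 then 1
      else if Re ((b - z) / v) > 0 \<and> Re ((a - z) / v) \<le> 0 \<and> Im ((b - z) / (a - z)) < 0 then -1 else 0)"

text \<open>\<open>Arg\<close> of the quotient is the signed angle from \<open>u\<close> to
  \<open>w\<close>, whereas \<open>Arg2pi\<close> jumps by a full turn at the positive real axis.
  The correction records a crossing of that axis; points on it count with the upper half-plane,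
  since \<open>Arg2pi\<close> is 0 there.\<close>

lemma Arg_divide_Arg2pi:
  assumes "u \<noteq> 0" "w \<noteq> 0" "Arg (w / u) \<noteq> pi"
  shows "Arg (w / u) = Arg2pi w - Arg2pi u + 2 * pi *
     (if Im u < 0 \<and> 0 \<le> Im w \<and> Im (w / u) > 0 then 1 else
      if Im w < 0 \<and> 0 \<le> Im u \<and> Im (w / u) < 0 then -1 else 0)"
proof -
  define \<alpha> \<beta> where "\<alpha> = Arg2pi u" and "\<beta> = Arg2pi w"
  have r: "0 \<le> \<alpha>" "\<alpha> < 2 * pi" "0 \<le> \<beta>" "\<beta> < 2 * pi"
    by (simp_all add: \<alpha>_def \<beta>_def Arg2pi_ge_0 Arg2pi_lt_2pi)
  have u: "u = of_real (norm u) * cis \<alpha>" and w: "w = of_real (norm w) * cis \<beta>"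
    using Arg2pi_eq[of u] Arg2pi_eq[of w] by (simp_all add: \<alpha>_def \<beta>_def cis_conv_exp)
  have wu: "w / u = of_real (norm w / norm u) * cis (\<beta> - \<alpha>)"
    by (subst u, subst w) (simp add: cis_divide[symmetric])
  have n: "norm w / norm u > 0" using assms by simp
  have shift1: "cis (x + 2 * pi) = cis x" for x
    by (simp add: complex_eq_iff)
  then have shift: "cis (x + 2 * pi) = cis x" "cis (x - 2 * pi) = cis x" for x
    using shift1[of "x - 2 * pi"] by simp_all
  have iu: "Im u < 0 \<longleftrightarrow> pi < \<alpha>" and iw: "Im w < 0 \<longleftrightarrow> pi < \<beta>"
  proof -
    have "sin x < 0 \<longleftrightarrow> pi < x" if "0 \<le> x" "x < 2 * pi" for x
      using that sin_ge_zero[of x] sin_lt_zero[of x] by (cases "x \<le> pi") auto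
    moreover have "Im u = norm u * sin \<alpha>" "Im w = norm w * sin \<beta>" by (subst u, simp)(subst w, simp)
    ultimately show "Im u < 0 \<longleftrightarrow> pi < \<alpha>" "Im w < 0 \<longleftrightarrow> pi < \<beta>" using assms r by (simp_all add: mult_less_0_iff)
  qed
  have im: "Im (w / u) = norm w / norm u * sin (\<beta> - \<alpha>)" by (simp add: wu)
  have im1: "0 < Im (w / u) \<longleftrightarrow> 0 < sin (\<beta> - \<alpha>)" and im2: "Im (w / u) < 0 \<longleftrightarrow> sin (\<beta> - \<alpha>) < 0"
    unfolding im using n by (simp_all only: zero_less_mult_iff mult_less_0_iff) auto
  have A: "Arg (w / u) = t" if "cis t = cis (\<beta> - \<alpha>)" "-pi < t" "t \<le> pi" for t
    using Arg_unique[of "norm w / norm u" t "w / u"] that n wu by (simp add: cis_conv_exp)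
  consider "\<bar>\<beta> - \<alpha>\<bar> < pi" | "\<beta> - \<alpha> \<le> -pi" | "\<beta> - \<alpha> \<ge> pi" by linarith
  then show ?thesis
  proof cases
    case 1
    then have "Arg (w / u) = \<beta> - \<alpha>" by (intro A) auto
    moreover have "\<not> (pi < \<alpha> \<and> \<not> pi < \<beta> \<and> sin (\<beta> - \<alpha>) > 0)" "\<not> (pi < \<beta> \<and> \<not> pi < \<alpha> \<and> sin (\<beta> - \<alpha>) < 0)"
      using 1 sin_ge_zero[of "\<beta> - \<alpha>"] sin_ge_zero[of "- (\<beta> - \<alpha>)"] unfolding sin_minus by auto
    ultimately show ?thesis using n by (auto simp: iu iw im1 im2 \<alpha>_def[symmetric] \<beta>_def[symmetric] not_less[symmetric] simp del: minus_diff_eq)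
  next
    case 2
    then have a: "Arg (w / u) = \<beta> - \<alpha> + 2 * pi" using r by (intro A) (auto simp: shift)
    then have ne: "\<beta> - \<alpha> \<noteq> -pi" using assms(3) by auto
    have "sin (\<beta> - \<alpha> + 2 * pi) > 0" using 2 ne r by (intro sin_gt_zero) auto
    then have "sin (\<beta> - \<alpha>) > 0" by simp
    moreover have "pi < \<alpha>" "\<beta> \<le> pi" using 2 ne r by auto
    ultimately show ?thesis using n a by (auto simp: iu iw im1 im2 \<alpha>_def[symmetric] \<beta>_def[symmetric] not_less[symmetric])
  next
    case 3
    have ne: "\<beta> - \<alpha> \<noteq> pi" using A[of "\<beta> - \<alpha>"] assms(3) by auto
    have a: "Arg (w / u) = \<beta> - \<alpha> - 2 * pi" using r 3 ne by (intro A) (auto simp: shift)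
    have "sin (\<beta> - \<alpha>) < 0" using 3 ne r by (intro sin_lt_zero) auto
    moreover have "pi < \<beta>" "\<alpha> \<le> pi" using 3 ne r by auto
    ultimately show ?thesis using n a by (auto simp: iu iw im1 im2 \<alpha>_def[symmetric] \<beta>_def[symmetric] not_less[symmetric])
  qed
qed

text \<open>The \<open>Arg2pi\<close> terms are a potential difference that telescopes around a
  closed polygon, so that only the crossings remain. Dividing by \<open>\<i> * v\<close> turns the
  ray into the positive real axis.\<close>

lemma ang_crs:
  assumes "z \<notin> closed_segment a b" "v \<noteq> 0"
  shows "ang a b z = Arg2pi ((b - z) / (\<i> * v)) / (2 * pi) - Arg2pi ((a - z) / (\<i> * v)) / (2 * pi) + crs v a b z"
proof -
  let ?u = "(a - z) / (\<i> * v)" and ?w = "(b - z) / (\<i> * v)"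
  have ne: "a \<noteq> z" "b \<noteq> z" using assms by auto
  have q: "?w / ?u = (b - z) / (a - z)" using assms by simp
  have im: "Im ((x - z) / (\<i> * v)) = - Re ((x - z) / v)" for x
  proof -
    have "(x - z) / (\<i> * v) = - \<i> * ((x - z) / v)" using assms(2) by (simp add: field_simps)
    moreover have "Im (- \<i> * y) = - Re y" for y by simp
    ultimately show ?thesis by metis
  qed
  have "Arg ((b - z) / (a - z)) \<noteq> pi"
    using ang_Arg[OF assms(1)] by auto
  then have "Arg ((b - z) / (a - z)) = Arg2pi ?w - Arg2pi ?u + 2 * pi * crs v a b z"
    using Arg_divide_Arg2pi[of ?u ?w] ne assms(2) unfolding q im crs_def by (auto simp: not_less)
  then show ?thesis unfolding ang_Arg(1)[OF assms(1)] by (simp add: field_simps)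
qed

lemma indicator_body_crs:
  assumes "simple_hexagon p" "z \<notin> bdry p" "v \<noteq> 0"
  shows "of_bool (z \<in> body p) = ori p * (\<Sum>i\<in>UNIV. crs v (p i) (p (i + 1)) z)"
proof -
  have z: "z \<notin> closed_segment (p i) (p (i + 1))" for i
    using assms side_subset_bdry[of p i] by (auto simp: side_def)
  have "(\<Sum>i\<in>UNIV. ang (p i) (p (i + 1)) z) = (\<Sum>i\<in>UNIV. crs v (p i) (p (i + 1)) z)"
    unfolding ang_crs[OF z assms(3)] sum_6 by simp
  then show ?thesis using indicator_body[OF assms(1,2)] by simp
qed

section \<open>Isometries\<close>

text \<open>Normal form of the isometries when \<open>norm \<alpha> = 1\<close>, with
  \<open>s\<close> separating direct from indirect ones.\<close>

definition mv :: "bool \<Rightarrow> complex \<Rightarrow> complex \<Rightarrow> complex \<Rightarrow> complex" where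
  "mv s \<alpha> \<beta> z = \<alpha> * (if s then z else cnj z) + \<beta>"

lemma dist_mv: "norm \<alpha> = 1 \<Longrightarrow> dist (mv s \<alpha> \<beta> x) (mv s \<alpha> \<beta> y) = dist x y"
proof -
  assume "norm \<alpha> = 1"
  have "dist (mv s \<alpha> \<beta> x) (mv s \<alpha> \<beta> y) = norm (\<alpha> * (if s then x - y else cnj (x - y)))"
    by (simp add: dist_norm mv_def algebra_simps)
  also have "\<dots> = dist x y" using \<open>norm \<alpha> = 1\<close>
    by (simp add: norm_mult dist_norm complex_mod_cnj del: complex_cnj_diff)
  finally show ?thesis .
qed

lemma plane_isometry_mv: "norm \<alpha> = 1 \<Longrightarrow> plane_isometry (mv s \<alpha> \<beta>)"
  by (simp add: plane_isometry_def dist_mv)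

lemma norm_eq_Re_Im:
  assumes "norm x = norm z" "norm (x - 1) = norm (z - 1)"
  shows "Re x = Re z" "Im x = Im z \<or> Im x = - Im z"
proof -
  have "(Re x)\<^sup>2 + (Im x)\<^sup>2 = (Re z)\<^sup>2 + (Im z)\<^sup>2" "(Re x - 1)\<^sup>2 + (Im x)\<^sup>2 = (Re z - 1)\<^sup>2 + (Im z)\<^sup>2"
    using assms by (simp_all add: cmod_def)
  moreover from this show "Re x = Re z" by (simp add: power2_eq_square algebra_simps)
  ultimately show "Im x = Im z \<or> Im x = - Im z" by (simp add: power2_eq_iff)
qed

text \<open>After normalising the images of 0 and 1, each point goes to itself or to its conjugate;
  the distance to the image of \<open>\<i>\<close> makes this choice the same for all
  points.\<close>

lemma plane_isometry_cases:
  assumes "plane_isometry f"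
  obtains s \<alpha> \<beta> where "norm \<alpha> = 1" "f = mv s \<alpha> \<beta>"
proof -
  define \<beta> \<alpha> where "\<beta> = f 0" and "\<alpha> = f 1 - f 0"
  have d: "norm (f x - f y) = norm (x - y)" for x y using assms by (simp add: plane_isometry_def dist_norm)
  have a: "norm \<alpha> = 1" using d[of 1 0] by (simp add: \<alpha>_def)
  then have a0: "\<alpha> \<noteq> 0" by auto
  define g where "g z = (f z - \<beta>) / \<alpha>" for z
  have f: "f z = \<alpha> * g z + \<beta>" for z using a0 by (simp add: g_def)
  have dg: "norm (g x - g y) = norm (x - y)" for x y
  proof -
    have "g x - g y = (f x - f y) / \<alpha>" by (simp add: g_def diff_divide_distrib)
    then show ?thesis using d a by (simp add: norm_divide)
  qed
  have g01: "g 0 = 0" "g 1 = 1" using a0 by (simp_all add: g_def \<beta>_def \<alpha>_def)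
  have re: "Re (g z) = Re z" and im: "Im (g z) = Im z \<or> Im (g z) = - Im z" for z
    using norm_eq_Re_Im[of "g z" z] dg[of z 0] dg[of z 1] g01 by simp_all
  have n: "(Im (g z) - Im (g \<i>))\<^sup>2 = (Im z - 1)\<^sup>2" for z
  proof -
    have "(norm (g z - g \<i>))\<^sup>2 = (norm (z - \<i>))\<^sup>2" by (simp add: dg)
    then show ?thesis by (simp add: cmod_power2 re)
  qed
  consider "g \<i> = \<i>" | "g \<i> = - \<i>" using im[of \<i>] re[of \<i>] by (auto simp: complex_eq_iff)
  then obtain s where "\<And>z. g z = (if s then z else cnj z)"
  proof cases
    case 1
    then have "Im (g z) = Im z" for z using n[of z] im[of z] by (auto simp: power2_eq_iff)
    then show ?thesis using that[of True] re by (simp add: complex_eq_iff)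
  next
    case 2
    have "Im (g z) = - Im z" for z using n[of z] im[of z] 2 by (auto simp: power2_eq_square algebra_simps)
    then show ?thesis using that[of False] re by (simp add: complex_eq_iff)
  qed
  then have "f = mv s \<alpha> \<beta>" by (auto simp: fun_eq_iff mv_def f)
  with a that show ?thesis by blast
qed

lemma congruent_copy_mv:
  "congruent_copy p q \<longleftrightarrow> (\<exists>s \<alpha> \<beta>. norm \<alpha> = 1 \<and> q = mv s \<alpha> \<beta> \<circ> p)"
  unfolding congruent_copy_def using plane_isometry_cases plane_isometry_mv by metis

lemma mv_linepath: "mv s \<alpha> \<beta> (linepath a b t) = linepath (mv s \<alpha> \<beta> a) (mv s \<alpha> \<beta> b) t"
  by (cases s) (simp_all add: mv_def linepath_def scaleR_conv_of_real algebra_simps)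

lemma mv_closed_segment: "mv s \<alpha> \<beta> ` closed_segment a b = closed_segment (mv s \<alpha> \<beta> a) (mv s \<alpha> \<beta> b)"
proof -
  have "mv s \<alpha> \<beta> ` closed_segment a b = path_image (mv s \<alpha> \<beta> \<circ> linepath a b)"
    by (simp add: path_image_compose)
  also have "mv s \<alpha> \<beta> \<circ> linepath a b = linepath (mv s \<alpha> \<beta> a) (mv s \<alpha> \<beta> b)"
    by (simp add: fun_eq_iff mv_linepath)
  finally show ?thesis by simp
qed

lemma inj_mv: "\<alpha> \<noteq> 0 \<Longrightarrow> inj (mv s \<alpha> \<beta>)"
  by (auto simp: inj_def mv_def)

lemma surj_mv: "\<alpha> \<noteq> 0 \<Longrightarrow> surj (mv s \<alpha> \<beta>)"
proof -
  assume a: "\<alpha> \<noteq> 0"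
  have "mv s \<alpha> \<beta> (if s then (w - \<beta>) / \<alpha> else cnj ((w - \<beta>) / \<alpha>)) = w" for w
    using a by (auto simp: mv_def)
  then show ?thesis by (metis surj_def)
qed

lemma continuous_on_mv: "continuous_on S (mv s \<alpha> \<beta>)"
  unfolding mv_def by (cases s; simp; intro continuous_intros)

lemma boundary_path_mv: "boundary_path (mv s \<alpha> \<beta> \<circ> p) = mv s \<alpha> \<beta> \<circ> boundary_path p"
  unfolding boundary_path_def
  by (simp add: path_compose_join fun_eq_iff joinpaths_def mv_linepath)

lemma simple_hexagon_mv: "\<alpha> \<noteq> 0 \<Longrightarrow> simple_hexagon p \<Longrightarrow> simple_hexagon (mv s \<alpha> \<beta> \<circ> p)"
  unfolding simple_hexagon_def boundary_path_mv
  by (intro simple_path_continuous_image continuous_on_mv inj_on_subset[OF inj_mv]) auto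

lemma side_mv: "side (mv s \<alpha> \<beta> \<circ> p) i = mv s \<alpha> \<beta> ` side p i"
  by (simp add: side_def mv_closed_segment)

lemma bdry_mv: "bdry (mv s \<alpha> \<beta> \<circ> p) = mv s \<alpha> \<beta> ` bdry p"
  by (simp add: bdry_def side_mv image_UN)

lemma ang_mv:
  assumes "\<alpha> \<noteq> 0" "z \<notin> closed_segment a b"
  shows "ang (mv s \<alpha> \<beta> a) (mv s \<alpha> \<beta> b) (mv s \<alpha> \<beta> z) = (if s then ang a b z else - ang a b z)"
proof -
  have n: "mv s \<alpha> \<beta> z \<notin> closed_segment (mv s \<alpha> \<beta> a) (mv s \<alpha> \<beta> b)"
    unfolding mv_closed_segment[symmetric] using assms inj_image_mem_iff[OF inj_mv] by blast
  let ?w = "(b - z) / (a - z)"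
  have q: "(mv s \<alpha> \<beta> b - mv s \<alpha> \<beta> z) / (mv s \<alpha> \<beta> a - mv s \<alpha> \<beta> z) = (if s then ?w else cnj ?w)"
  proof -
    have "mv s \<alpha> \<beta> x - mv s \<alpha> \<beta> z = \<alpha> * (if s then x - z else cnj (x - z))" for x
      by (simp add: mv_def algebra_simps)
    then show ?thesis using assms(1) by (cases s) (simp_all del: complex_cnj_diff)
  qed
  \<comment> \<open>Conjugation negates \<open>Arg\<close> except on the negative real axis, which
    is excluded because \<open>z\<close> is off the segment.\<close>
  have "Arg ?w \<noteq> pi" using ang_Arg[OF assms(2)] by auto
  then have "Arg (cnj ?w) = - Arg ?w"
    by (metis Arg_cnj Arg_eq_pi complex_is_Real_iff Reals_cnj_iff neg_0_equal_iff_equal Arg_eq_0_pi complex_cnj_zero Arg_zero)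
  then show ?thesis
    unfolding ang_Arg(1)[OF n] ang_Arg(1)[OF assms(2)] q by simp
qed

text \<open>Both claims come from one identity: the indicators of the image and of the original
  agree up to a sign. Both are 0 or 1, and the interior is nonempty, so the sign is 1; this
  determines the orientation of the image.\<close>

lemma body_mv:
  assumes "\<alpha> \<noteq> 0" "simple_hexagon p"
  shows "body (mv s \<alpha> \<beta> \<circ> p) = mv s \<alpha> \<beta> ` body p"
    and "ori (mv s \<alpha> \<beta> \<circ> p) = (if s then ori p else - ori p)"
proof -
  let ?f = "mv s \<alpha> \<beta>"
  note s = simple_hexagon_mv[OF assms, of s \<beta>]
  have b: "?f z \<in> bdry (?f \<circ> p) \<longleftrightarrow> z \<in> bdry p" for z
    unfolding bdry_mv using inj_image_mem_iff[OF inj_mv[OF assms(1)]] by blast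
  have A: "of_bool (?f z \<in> body (?f \<circ> p)) = (if s then 1 else -1) * ori (?f \<circ> p) * ori p * of_bool (z \<in> body p)"
    if "z \<notin> bdry p" for z
  proof -
    have z: "z \<notin> closed_segment (p i) (p (i + 1))" for i
      using that side_subset_bdry[of p i] by (auto simp: side_def)
    have "of_bool (?f z \<in> body (?f \<circ> p)) = ori (?f \<circ> p) * (\<Sum>i\<in>UNIV. ang ((?f \<circ> p) i) ((?f \<circ> p) (i + 1)) (?f z))"
      using indicator_body[OF s] that b by blast
    also have "(\<Sum>i\<in>UNIV. ang ((?f \<circ> p) i) ((?f \<circ> p) (i + 1)) (?f z)) = (if s then 1 else -1) * (\<Sum>i\<in>UNIV. ang (p i) (p (i + 1)) z)"
      using ang_mv[OF assms(1) z] by (simp add: sum_negf)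
    also have "(\<Sum>i\<in>UNIV. ang (p i) (p (i + 1)) z) = ori p * of_bool (z \<in> body p)"
      using indicator_body[OF assms(2) that] ori_cases[of p] by auto
    finally show ?thesis by (simp only: mult_ac)
  qed
  have iff: "?f z \<in> body (?f \<circ> p) \<longleftrightarrow> z \<in> body p" for z
  proof (cases "z \<in> bdry p")
    case True
    then show ?thesis using b[of z] simple_hexagon_topology(5)[OF s] simple_hexagon_topology(5)[OF assms(2)] by blast
  next
    case False
    then show ?thesis using A[OF False] ori_cases[of p] ori_cases[of "?f \<circ> p"] by (auto simp: of_bool_def split: if_splits)
  qed
  then show "body (?f \<circ> p) = ?f ` body p"
    using surj_mv[OF assms(1)] by (auto simp: set_eq_iff image_iff) (metis surjD)
  obtain z where z: "z \<in> body p" using simple_hexagon_topology(3)[OF assms(2)] by blast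
  then have "z \<notin> bdry p" using simple_hexagon_topology(5)[OF assms(2)] by blast
  from A[OF this] z iff[of z] show "ori (?f \<circ> p) = (if s then ori p else - ori p)"
    using ori_cases[of p] ori_cases[of "?f \<circ> p"] by (auto simp: of_bool_def split: if_splits)
qed

lemma region_mv:
  assumes "\<alpha> \<noteq> 0" "simple_hexagon p"
  shows "region (mv s \<alpha> \<beta> \<circ> p) = mv s \<alpha> \<beta> ` region p"
  by (simp add: region_eq bdry_mv body_mv[OF assms] image_Un)

lemma congruent_copy_facts:
  assumes "congruent_copy p q" "simple_hexagon p"
  shows "simple_hexagon q" "side_length q i = side_length p i"
proof -
  from assms(1) obtain s \<alpha> \<beta> where a: "norm \<alpha> = 1" "q = mv s \<alpha> \<beta> \<circ> p" unfolding congruent_copy_mv by blast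
  then have "\<alpha> \<noteq> 0" by auto
  then show "simple_hexagon q" using simple_hexagon_mv assms(2) a by blast
  show "side_length q i = side_length p i" using a by (simp add: side_length_def dist_mv)
qed

text \<open>An isometry of known orientation is affine in \<open>z\<close> or in
  \<open>cnj z\<close>, hence fixed by two values. Later this turns agreement along one side into
  equality of tiles.\<close>

lemma congruent_copy_unique:
  assumes "congruent_copy p q" "congruent_copy p q'" "simple_hexagon p" "ori q = ori q'"
    and "q i = q' i" "q j = q' j" "i \<noteq> j"
  shows "q = q'"
proof -
  from assms(1) obtain s \<alpha> \<beta> where a: "norm \<alpha> = 1" "q = mv s \<alpha> \<beta> \<circ> p" unfolding congruent_copy_mv by blast
  from assms(2) obtain s' \<alpha>' \<beta>' where a': "norm \<alpha>' = 1" "q' = mv s' \<alpha>' \<beta>' \<circ> p" unfolding congruent_copy_mv by blast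
  have ne: "\<alpha> \<noteq> 0" "\<alpha>' \<noteq> 0" using a a' by auto
  have "(if s then ori p else - ori p) = (if s' then ori p else - ori p)"
    using body_mv(2)[OF ne(1) assms(3)] body_mv(2)[OF ne(2) assms(3)] assms(4) a a' by metis
  then have s: "s' = s" using ori_cases[of p] by (auto split: if_splits)
  define w where "w k = (if s then p k else cnj (p k))" for k
  have q: "q k = \<alpha> * w k + \<beta>" "q' k = \<alpha>' * w k + \<beta>'" for k
    using a a' by (simp_all add: mv_def w_def s)
  have "p i \<noteq> p j" using simple_hexagon_sides(1)[OF assms(3)] assms(7) by (auto dest: injD)
  then have w: "w i \<noteq> w j" by (simp add: w_def)
  have "\<alpha> * (w i - w j) = q i - q j" "\<alpha>' * (w i - w j) = q' i - q' j" by (simp_all add: q right_diff_distrib)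
  then have "\<alpha> * (w i - w j) = \<alpha>' * (w i - w j)" using assms(5,6) by metis
  then have "\<alpha> = \<alpha>'" using w by simp
  moreover from this have "\<beta> = \<beta>'" using assms(5) q by simp
  ultimately show ?thesis using a a' s by simp
qed

section \<open>Local cancellation\<close>

lemma negligible_bdry: "negligible (bdry p)"
proof -
  have "negligible (closed_segment a b)" for a b :: complex
    by (simp add: negligible_convex_interior interior_closed_segment_ge2)
  then show ?thesis unfolding bdry_def side_def by (intro negligible_Union) auto
qed

lemma negligible_bdrys: "countable Q \<Longrightarrow> negligible (\<Union>q\<in>Q. bdry q)"
  by (rule negligible_countable_Union) (auto simp: negligible_bdry)

text \<open>Counting identities hold off a negligible set; this finds a point of an open set at
  which they may be used.\<close>

lemma generic_point:
  assumes "open U" "U \<noteq> {}" "negligible N"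
  obtains z :: complex where "z \<in> U" "z \<notin> N"
  using assms open_not_negligible[of U] negligible_subset[of N U] by blast

lemma body_near:
  assumes "simple_hexagon q" "x \<in> region q" "0 < r" "negligible N"
  obtains z where "z \<in> body q" "z \<in> ball x r" "z \<notin> N"
proof -
  have "x \<in> closure (body q)" using assms simple_hexagon_topology by blast
  then have "body q \<inter> ball x r \<noteq> {}" using \<open>0 < r\<close>
    by (metis centre_in_ball closure_iff_nhds_not_empty disjoint_iff open_ball order_refl)
  moreover have "open (body q \<inter> ball x r)" using simple_hexagon_topology(1)[OF assms(1)] by blast
  ultimately show thesis using generic_point[OF _ _ assms(4)] that by blast
qed

text \<open>The set where a continuous function is not an integer is open, so it would contain a
  point outside \<open>N\<close>. An integer-valued continuous function on the connected ball is
  constant.\<close>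

lemma integer_locally_constant:
  assumes "continuous_on (ball x r) E" "negligible N"
    and "\<And>z. z \<in> ball x r \<Longrightarrow> z \<notin> N \<Longrightarrow> E z \<in> (\<int> :: real set)"
  obtains c where "\<And>z. z \<in> ball (x :: complex) r \<Longrightarrow> E z = c"
proof -
  have Z: "E z \<in> \<int>" if "z \<in> ball x r" for z
  proof (rule ccontr)
    assume "E z \<notin> \<int>"
    have "open (ball x r \<inter> E -` (- \<int>))"
      using continuous_open_preimage[OF assms(1), of "- \<int>"] closed_Ints by (simp add: open_Compl)
    moreover have "z \<in> ball x r \<inter> E -` (- \<int>)" using that \<open>E z \<notin> \<int>\<close> by auto
    ultimately obtain y where "y \<in> ball x r \<inter> E -` (- \<int>)" "y \<notin> N"
      using generic_point[OF _ _ assms(2)] by (metis empty_iff)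
    then show False using assms(3) by auto
  qed
  have "E constant_on ball x r"
  proof (rule continuous_discrete_range_constant[OF _ assms(1)])
    fix y assume y: "y \<in> ball x r"
    have "1 \<le> norm (E w - E y)" if w: "w \<in> ball x r" "E w \<noteq> E y" for w
    proof -
      obtain m n :: int where mn: "E w = of_int m" "E y = of_int n"
        using Z[OF w(1)] Z[OF y] by (auto elim!: Ints_cases)
      then have "1 \<le> \<bar>m - n\<bar>" using w(2) by auto
      then have "1 \<le> \<bar>real_of_int (m - n)\<bar>" by linarith
      then show ?thesis by (simp add: mn)
    qed
    then show "\<exists>e>0. \<forall>w. w \<in> ball x r \<and> E w \<noteq> E y \<longrightarrow> e \<le> norm (E w - E y)"
      by (intro exI[of _ 1]) auto
  qed auto
  then show thesis using that unfolding constant_on_def by blast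
qed

section \<open>Counting hexagons near a point\<close>

abbreviation off :: "(hexagon \<times> real) list \<Rightarrow> complex \<Rightarrow> bool" where
  "off Q z \<equiv> \<forall>q\<in>set Q. z \<notin> bdry (fst q)"

abbreviation count :: "(hexagon \<times> real) list \<Rightarrow> complex \<Rightarrow> real" where
  "count Q z \<equiv> \<Sum>q\<leftarrow>Q. snd q * of_bool (z \<in> body (fst q))"

text \<open>
  \<open>local_sum Q x f\<close>: near \<open>x\<close> and off the boundaries, the signed number of hexagons of \<open>Q\<close> that
  contain a point is \<open>f\<close> up to a continuous term; \<open>f\<close> collects the angles subtended by the sides
  through \<open>x\<close>, which are the only ones to jump.
\<close>

definition local_sum :: "(hexagon \<times> real) list \<Rightarrow> complex \<Rightarrow> (complex \<Rightarrow> real) \<Rightarrow> bool" where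
  "local_sum Q x f \<longleftrightarrow> (\<exists>r>0. \<exists>E. continuous_on (ball x r) E \<and>
     (\<forall>z\<in>ball x r. off Q z \<longrightarrow> count Q z = E z + f z))"

abbreviation cancels :: "(hexagon \<times> real) list \<Rightarrow> complex \<Rightarrow> bool" where
  "cancels Q x \<equiv> local_sum Q x (\<lambda>z. 0)"

lemma local_sum_cong:
  assumes "local_sum Q x f" "\<And>z. off Q z \<Longrightarrow> f z = g z"
  shows "local_sum Q x g"
proof -
  obtain r E where "0 < r" "continuous_on (ball x r) E"
    "\<And>z. z \<in> ball x r \<Longrightarrow> off Q z \<Longrightarrow> count Q z = E z + f z"
    using assms(1) unfolding local_sum_def by blast
  then show ?thesis
    unfolding local_sum_def using assms(2) by (intro exI[of _ r] conjI exI[of _ E]) auto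
qed

lemma local_sum_append:
  assumes "local_sum Q x f" "local_sum Q' x g"
  shows "local_sum (Q @ Q') x (\<lambda>z. f z + g z)"
proof -
  obtain r E where 1: "0 < r" "continuous_on (ball x r) E"
    "\<And>z. z \<in> ball x r \<Longrightarrow> off Q z \<Longrightarrow> count Q z = E z + f z"
    using assms(1) unfolding local_sum_def by blast
  obtain r' E' where 2: "0 < r'" "continuous_on (ball x r') E'"
    "\<And>z. z \<in> ball x r' \<Longrightarrow> off Q' z \<Longrightarrow> count Q' z = E' z + g z"
    using assms(2) unfolding local_sum_def by blast
  have "continuous_on (ball x (min r r')) (\<lambda>z. E z + E' z)"
    by (intro continuous_on_add continuous_on_subset[OF 1(2)] continuous_on_subset[OF 2(2)]) auto
  then show ?thesis
    unfolding local_sum_def using 1 2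
    by (intro exI[of _ "min r r'"] conjI exI[of _ "\<lambda>z. E z + E' z"]) auto
qed

text \<open>The sides that miss \<open>x\<close> form a closed set, so on a small ball their angles
  are continuous and go into \<open>E\<close>.\<close>

lemma local_sum_hexagon:
  assumes "simple_hexagon p"
  shows "local_sum [(p, s)] x (\<lambda>z. s * ori p * (\<Sum>i | x \<in> side p i. ang (p i) (p (i + 1)) z))"
proof -
  define F where "F = (\<Union>i\<in>{i. x \<notin> side p i}. side p i)"
  have "closed F" unfolding F_def side_def by (intro closed_UN) auto
  moreover have "x \<notin> F" by (auto simp: F_def)
  ultimately obtain r where r: "0 < r" "ball x r \<subseteq> - F"
    by (metis ComplI open_Compl open_contains_ball_eq)
  define E where "E z = s * ori p * (\<Sum>i | x \<notin> side p i. ang (p i) (p (i + 1)) z)" for z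
  have "continuous_on (ball x r) (ang (p i) (p (i + 1)))" if "x \<notin> side p i" for i
    by (rule continuous_on_subset[OF continuous_on_ang]) (use r that in \<open>auto simp: F_def side_def\<close>)
  then have c: "continuous_on (ball x r) E"
    unfolding E_def by (intro continuous_intros) auto
  have "s * of_bool (z \<in> body p) = E z + s * ori p * (\<Sum>i | x \<in> side p i. ang (p i) (p (i + 1)) z)"
    if "z \<notin> bdry p" for z
  proof -
    have "(\<Sum>i\<in>UNIV. ang (p i) (p (i + 1)) z) = (\<Sum>i\<in>{i. x \<notin> side p i} \<union> {i. x \<in> side p i}. ang (p i) (p (i + 1)) z)"
      by (rule sum.cong) auto
    also have "\<dots> = (\<Sum>i | x \<notin> side p i. ang (p i) (p (i + 1)) z) + (\<Sum>i | x \<in> side p i. ang (p i) (p (i + 1)) z)"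
      by (rule sum.union_disjoint) auto
    finally show ?thesis using indicator_body[OF assms that] by (simp add: E_def distrib_left)
  qed
  with r(1) c show ?thesis
    unfolding local_sum_def by (intro exI[of _ r] conjI exI[of _ E]) simp_all
qed

text \<open>
  The neighbour of corner \<open>i\<close> reached by walking along the boundary counterclockwise (\<open>r = 1\<close>) or
  clockwise (\<open>r = -1\<close>).
\<close>

definition fwd :: "real \<Rightarrow> hexagon \<Rightarrow> 6 \<Rightarrow> complex" where
  "fwd r q i = (if ori q = r then q (i + 1) else q (i - 1))"

text \<open>Both sides at the corner are written as angles seen from the corner outwards. With
  \<open>fwd\<close>, the orientation of the hexagon drops out, and a side shared with a neighbour
  appears in the same form with the opposite sign.\<close>

lemma local_sum_corner:
  assumes "simple_hexagon p" "r = 1 \<or> r = -1"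
  shows "local_sum [(p, 1)] (p i) (\<lambda>z. r * (ang (p i) (fwd r p i) z - ang (p i) (fwd (- r) p i) z))"
proof (rule local_sum_cong[OF local_sum_hexagon[OF assms(1)]])
  fix z assume z: "off [(p, 1)] z"
  have S: "{j. p i \<in> side p j} = {i, i - 1}" using corner_in_side_iff[OF assms(1)] by blast
  have ne: "i \<noteq> i - 1" by (metis add_cancel_right_right diff_add_cancel zero_neq_one)
  have "z \<notin> closed_segment (p (i - 1)) (p i)"
    using z side_subset_bdry[of p "i - 1"] by (auto simp: side_def)
  then have "ang (p (i - 1)) (p i) z = - ang (p i) (p (i - 1)) z"
    using ang_commute[of z "p (i - 1)" "p i"] by simp
  then show "1 * ori p * (\<Sum>j | p i \<in> side p j. ang (p j) (p (j + 1)) z) =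
      r * (ang (p i) (fwd r p i) z - ang (p i) (fwd (- r) p i) z)"
    using ne ori_cases[of p] assms(2) unfolding S by (auto simp: fwd_def)
qed

lemma cancels_constant:
  assumes "cancels Q x" "\<And>q. q \<in> set Q \<Longrightarrow> snd q \<in> \<int>"
  shows "\<exists>r>0. \<exists>c. \<forall>z\<in>ball x r. off Q z \<longrightarrow> count Q z = c"
proof -
  obtain r E where r: "0 < r" "continuous_on (ball x r) E" and
     E: "\<And>z. z \<in> ball x r \<Longrightarrow> off Q z \<Longrightarrow> count Q z = E z"
    using assms(1) unfolding local_sum_def by auto
  define N where "N = (\<Union>q\<in>fst ` set Q. bdry q)"
  have N: "negligible N" unfolding N_def by (rule negligible_bdrys) (auto intro: countable_finite)
  have int: "count Q z \<in> \<int>" for z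
    using assms(2) by (induction Q) auto
  have I: "E z \<in> \<int>" if "z \<in> ball x r" "z \<notin> N" for z
  proof -
    have "off Q z" using that(2) by (auto simp: N_def)
    from E[OF that(1) this] show ?thesis using int[of z] by simp
  qed
  obtain c where "\<And>z. z \<in> ball x r \<Longrightarrow> E z = c"
    using integer_locally_constant[OF r(2) N I] by blast
  with E r(1) show ?thesis by (intro exI[of _ r] exI[of _ c] conjI) auto
qed

text \<open>The constant count is not 0, since some member of \<open>Q\<close> has interior points
  arbitrarily near \<open>x\<close>. Hence the generic points of \<open>D\<close> near
  \<open>x\<close> are covered by members of \<open>Q\<close> as well. In a tiling this makes
  \<open>D\<close> one of them.\<close>

lemma cancels_overlap:
  assumes "cancels Q x" "\<And>q. q \<in> set Q \<Longrightarrow> snd q = 1 \<and> simple_hexagon (fst q)"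
    and "q \<in> set Q" "x \<in> region (fst q)" "simple_hexagon D" "x \<in> region D"
  shows "\<exists>q\<in>set Q. body D \<inter> body (fst q) \<noteq> {}"
proof -
  have "snd q \<in> \<int>" if "q \<in> set Q" for q using assms(2) that by simp
  from cancels_constant[OF assms(1) this] obtain r c where r: "0 < r" and
     c: "\<And>z. z \<in> ball x r \<Longrightarrow> off Q z \<Longrightarrow> count Q z = c" by blast
  define N where "N = (\<Union>q\<in>fst ` set Q. bdry q)"
  have N: "negligible N" unfolding N_def by (rule negligible_bdrys) (auto intro: countable_finite)
  have Q: "count Q z = (\<Sum>q\<leftarrow>Q. of_bool (z \<in> body (fst q)))" for z
    using assms(2) by (intro arg_cong[where f = sum_list] map_cong) auto
  obtain z where z: "z \<in> body (fst q)" "z \<in> ball x r" "z \<notin> N"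
    using body_near[OF _ assms(4) r N] assms(2,3) by blast
  have "c \<noteq> 0"
  proof
    assume "c = 0"
    then have "(\<Sum>q\<leftarrow>Q. of_bool (z \<in> body (fst q))) = (0::real)" using c[OF z(2)] z(3) Q by (auto simp: N_def)
    then have "\<forall>y\<in>set (map (\<lambda>q. of_bool (z \<in> body (fst q)) :: real) Q). y = 0"
      by (subst (asm) sum_list_nonneg_eq_0_iff) auto
    then show False using z(1) assms(3) by auto
  qed
  obtain y where y: "y \<in> body D" "y \<in> ball x r" "y \<notin> N"
    using body_near[OF assms(5,6) r N] by blast
  then have "(\<Sum>q\<leftarrow>Q. of_bool (y \<in> body (fst q))) \<noteq> (0::real)"
    using c[OF y(2)] \<open>c \<noteq> 0\<close> Q by (auto simp: N_def)
  moreover have "(\<Sum>q\<leftarrow>Q. of_bool (y \<in> body (fst q))) = (0::real)" if "\<forall>q\<in>set Q. y \<notin> body (fst q)"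
    using that by (induction Q) auto
  ultimately have "\<exists>q\<in>set Q. y \<in> body (fst q)" by blast
  then show ?thesis using y(1) by blast
qed

text \<open>Around the common corner the outgoing side of each hexagon is the incoming side of the
  next, so the angles cancel cyclically.\<close>

lemma cancels_three:
  assumes "simple_hexagon A" "simple_hexagon B" "simple_hexagon C" "r = 1 \<or> r = -1"
    and "A i = B j" "B j = C k"
    and "fwd r A i = fwd (- r) B j" "fwd r B j = fwd (- r) C k" "fwd r C k = fwd (- r) A i"
  shows "cancels [(A, 1), (B, 1), (C, 1)] (A i)"
proof -
  note c = local_sum_corner[OF _ assms(4)]
  have "local_sum [(A, 1)] (A i) (\<lambda>z. r * (ang (A i) (fwd r A i) z - ang (A i) (fwd (- r) A i) z))"
    "local_sum [(B, 1)] (A i) (\<lambda>z. r * (ang (A i) (fwd r B j) z - ang (A i) (fwd r A i) z))"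
    "local_sum [(C, 1)] (A i) (\<lambda>z. r * (ang (A i) (fwd (- r) A i) z - ang (A i) (fwd r B j) z))"
    using c[OF assms(1), of i] c[OF assms(2), of j] c[OF assms(3), of k] assms(5-) by simp_all
  from local_sum_append[OF this(1) local_sum_append[OF this(2,3)]]
  have "cancels ([(A, 1)] @ [(B, 1)] @ [(C, 1)]) (A i)"
    by (rule local_sum_cong) (simp add: algebra_simps)
  then show ?thesis by simp
qed

text \<open>Serves to exclude that two tiles alone close up around a vertex.\<close>

lemma cancels_two:
  assumes "simple_hexagon A" "simple_hexagon B" "r = 1 \<or> r = -1"
    and "A i = B j" "fwd r A i = fwd (- r) B j" "fwd r B j = fwd (- r) A i"
  shows "cancels [(A, 1), (B, 1)] (A i)"
proof -
  note c = local_sum_corner[OF _ assms(3)]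
  have "local_sum [(A, 1)] (A i) (\<lambda>z. r * (ang (A i) (fwd r A i) z - ang (A i) (fwd (- r) A i) z))"
    "local_sum [(B, 1)] (A i) (\<lambda>z. r * (ang (A i) (fwd (- r) A i) z - ang (A i) (fwd r A i) z))"
    using c[OF assms(1), of i] c[OF assms(2), of j] assms(4-) by simp_all
  from local_sum_append[OF this] have "cancels ([(A, 1)] @ [(B, 1)]) (A i)"
    by (rule local_sum_cong) (simp add: algebra_simps)
  then show ?thesis by simp
qed

lemma side_eq_cases:
  assumes "side q i = side q' j"
  shows "q' j = q i \<and> q' (j + 1) = q (i + 1) \<or> q' j = q (i + 1) \<and> q' (j + 1) = q i"
proof -
  have "{q i, q (i + 1)} = {q' j, q' (j + 1)}"
    using assms unfolding side_def by (metis closed_segment_eq)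
  then show ?thesis by (auto simp: doubleton_eq_iff)
qed

text \<open>Through a point of a side that is no corner passes just one side of each hexagon. The
  weight of \<open>q'\<close> is the sign that makes the two angles cancel for any orientations;
  \<open>common_side_orientation\<close> shows that it is 1 when the interiors are disjoint.\<close>

lemma cancels_side:
  assumes "simple_hexagon q" "simple_hexagon q'" "side q i = side q' j" "x \<in> side q i" "x \<notin> range q"
  shows "cancels [(q, 1), (q', (if q' j = q i then -1 else 1) * ori q * ori q')] x" (is "cancels [_, (_, ?m)] _")
proof -
  note ends = side_eq_cases[OF assms(3)]
  have n: "x \<noteq> q i" "x \<noteq> q (i + 1)" using assms(5) by auto
  then have n': "x \<noteq> q' j" "x \<noteq> q' (j + 1)" using ends by auto
  have S: "{k. x \<in> side q k} = {i}" "{k. x \<in> side q' k} = {j}"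
    using side_unique[OF assms(1) _ assms(4) n] side_unique[OF assms(2) _ _ n'] assms(3,4) by blast+
  have "local_sum [(q, 1)] x (\<lambda>z. ori q * ang (q i) (q (i + 1)) z)"
    using local_sum_hexagon[OF assms(1), of 1 x] unfolding S by simp
  moreover have "local_sum [(q', ?m)] x (\<lambda>z. ?m * ori q' * ang (q' j) (q' (j + 1)) z)"
    using local_sum_hexagon[OF assms(2), of ?m x] unfolding S by simp
  ultimately have "local_sum [(q, 1), (q', ?m)] x (\<lambda>z. ori q * ang (q i) (q (i + 1)) z + ?m * ori q' * ang (q' j) (q' (j + 1)) z)"
    using local_sum_append by fastforce
  then show ?thesis
  proof (rule local_sum_cong)
    fix z assume "off [(q, 1), (q', ?m)] z"
    then have "z \<notin> closed_segment (q i) (q (i + 1))" using side_subset_bdry[of q i] by (auto simp: side_def)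
    then show "ori q * ang (q i) (q (i + 1)) z + ?m * ori q' * ang (q' j) (q' (j + 1)) z = 0"
      using ends corner_ne[OF assms(1), of i] ang_commute[of z "q i" "q (i + 1)"] ori_cases[of q] ori_cases[of q'] by auto
  qed
qed

text \<open>
  If both hexagons traversed the common side in the same direction, the difference of their
  indicators would be constant near that side.
\<close>

lemma common_side_orientation:
  assumes "simple_hexagon q" "simple_hexagon q'" "side q i = side q' j" "body q \<inter> body q' = {}"
  shows "if ori q = ori q' then q' j = q (i + 1) \<and> q' (j + 1) = q i else q' j = q i \<and> q' (j + 1) = q (i + 1)"
    and "x \<in> side q i \<Longrightarrow> x \<notin> range q \<Longrightarrow> cancels [(q, 1), (q', 1)] x"
proof -
  let ?m = "(if q' j = q i then -1 else 1) * ori q * ori q'"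
  have m: "?m = 1 \<or> ?m = -1" using ori_cases[of q] ori_cases[of q'] by auto
  have L: "?m = 1"
  proof (rule ccontr)
    assume "?m \<noteq> 1"
    then have l: "?m = -1" using m by blast
    define x where "x = midpoint (q i) (q (i + 1))"
    note x = midpoint_side(1)[OF assms(1), of i, folded x_def] and xr = midpoint_side(2)[OF assms(1), of i, folded x_def]
    have "cancels [(q, 1), (q', -1)] x" using cancels_side[OF assms(1-3) x xr] unfolding l .
    moreover have "snd y \<in> \<int>" if "y \<in> set [(q, 1::real), (q', -1)]" for y using that by auto
    ultimately have "\<exists>r>0. \<exists>c. \<forall>z\<in>ball x r. off [(q, 1), (q', -1)] z \<longrightarrow> count [(q, 1), (q', -1)] z = c"
      by (rule cancels_constant)
    then obtain r c where r: "0 < r" and c: "\<And>z. z \<in> ball x r \<Longrightarrow> z \<notin> bdry q \<Longrightarrow>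
       z \<notin> bdry q' \<Longrightarrow> of_bool (z \<in> body q) - of_bool (z \<in> body q') = (c::real)" by auto
    have N: "negligible (bdry q \<union> bdry q')" by (simp add: negligible_bdry negligible_Un)
    have "x \<in> region q" "x \<in> region q'" using x assms(3) side_subset_bdry by (auto simp: region_eq)
    then obtain y z where "y \<in> body q" "y \<in> ball x r" "y \<notin> bdry q \<union> bdry q'" "z \<in> body q'" "z \<in> ball x r" "z \<notin> bdry q \<union> bdry q'"
      using body_near[OF assms(1) _ r N] body_near[OF assms(2) _ r N] by metis
    moreover from this have "y \<notin> body q'" "z \<notin> body q" using assms(4) by auto
    ultimately show False using c[of y] c[of z] by auto
  qed
  then show "if ori q = ori q' then q' j = q (i + 1) \<and> q' (j + 1) = q i else q' j = q i \<and> q' (j + 1) = q (i + 1)"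
    using side_eq_cases[OF assms(3)] ori_cases[of q] ori_cases[of q'] by (auto split: if_splits)
  show "cancels [(q, 1), (q', 1)] x" if "x \<in> side q i" "x \<notin> range q"
    using cancels_side[OF assms(1-3) that] unfolding L .
qed

section \<open>The strip\<close>

text \<open>The triangle wave of period 1 with values in \<open>[0, 1]\<close>, vanishing at the integers.\<close>

definition wave :: "real \<Rightarrow> real" where
  "wave x = arccos (cos (2 * pi * x)) / pi"

lemma wave_add_int: "wave (x + of_int k) = wave x"
proof -
  have "cos (2 * pi * (x + of_int k)) = cos (2 * pi * x)"
    by (simp add: distrib_left cos_add cos_int_2pin sin_int_2pin)
  then show ?thesis by (simp add: wave_def)
qed

lemma wave_minus: "wave (- x) = wave x"
  by (simp add: wave_def)

lemma wave_half: "wave (x + 1 / 2) = 1 - wave x"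
proof -
  have "cos (2 * pi * (x + 1 / 2)) = - cos (2 * pi * x)"
    by (simp add: distrib_left)
  then show ?thesis by (simp add: wave_def arccos_minus diff_divide_distrib)
qed

lemma wave_bounds: "0 \<le> wave x" "wave x \<le> 1"
  unfolding wave_def using arccos_lbound[of "cos (2 * pi * x)"] arccos_ubound[of "cos (2 * pi * x)"] by simp_all

lemma wave_left: "0 \<le> x \<Longrightarrow> x \<le> 1 / 2 \<Longrightarrow> wave x = 2 * x"
  unfolding wave_def by (subst arccos_cos) auto

lemma wave_right: "1 / 2 \<le> x \<Longrightarrow> x \<le> 1 \<Longrightarrow> wave x = 2 - 2 * x"
  using wave_left[of "1 - x"] wave_add_int[of "- x" 1] wave_minus[of x] by (simp add: algebra_simps)

lemma continuous_on_wave: "continuous_on S wave"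
  unfolding wave_def by (intro continuous_intros) auto

lemma Sum_any_single:
  assumes "\<And>k. k \<noteq> m \<Longrightarrow> f k = (0::real)"
  shows "Sum_any f = f m"
  using Sum_any.expand_superset[of "{m}" f] assms by fastforce

lemma Sum_any_ge:
  assumes "finite {k. f k \<noteq> (0::real)}" "finite A" "\<And>k. 0 \<le> f k"
  shows "sum f A \<le> Sum_any f"
proof -
  have "Sum_any f = sum f (A \<union> {k. f k \<noteq> 0})"
    using assms by (intro Sum_any.expand_superset) auto
  also have "sum f A \<le> \<dots>" using assms by (intro sum_mono2) auto
  finally show ?thesis .
qed

lemma Sum_any_minus: "Sum_any (\<lambda>k. - f k :: real) = - Sum_any f"
  by (simp add: Sum_any.expand_set sum_negf)

lemma Sum_any_scale: "c \<noteq> 0 \<Longrightarrow> Sum_any (\<lambda>k. c * f k :: real) = c * Sum_any f"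
  by (simp add: Sum_any.expand_set sum_distrib_left)

text \<open>The part of the hypotheses on which the strip and its gluings rest. The unique lengths
  of the sides 0 and 1 serve the converse, in \<open>strip_tiling\<close>.\<close>

locale strip_hexagon =
  fixes p :: hexagon
  assumes simple: "simple_hexagon p"
    and parallel: "p 3 - p 2 = p 5 - p 0"
    and isosceles: "dist (p 3) (p 4) = dist (p 4) (p 5)"
begin

definition v :: complex where "v = shift p"
text \<open>Coordinates along and across the strip, scaled so that \<open>v\<close> is the first
  unit vector and the strip has period 1.\<close>

definition X :: "complex \<Rightarrow> real" where "X z = Re (z / v)"
definition Y :: "complex \<Rightarrow> real" where "Y z = Im (z / v)"

lemma v_eq: "v = p 2 - p 0" "v = p 3 - p 5"
  using parallel by (simp_all add: v_def shift_def algebra_simps)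

lemma corners: "p 2 = p 0 + v" "p 3 = p 5 + v"
  by (subst v_eq(1), simp) (subst v_eq(2), simp)

lemma v_nonzero: "v \<noteq> 0"
proof -
  have "p 2 \<noteq> p 0" using simple_hexagon_sides(1)[OF simple] by (auto dest: injD)
  then show ?thesis by (simp add: v_eq(1))
qed

lemma XY_add [simp]: "X (a + b) = X a + X b" "Y (a + b) = Y a + Y b"
  "X (a - b) = X a - X b" "Y (a - b) = Y a - Y b" "X (- a) = - X a" "Y (- a) = - Y a"
  by (simp_all add: X_def Y_def add_divide_distrib diff_divide_distrib)

lemma XY_v [simp]: "X v = 1" "Y v = 0" "X 0 = 0" "Y 0 = 0" "X (of_int k * v) = of_int k" "Y (of_int k * v) = 0"
  "X (v * of_int k) = of_int k" "Y (v * of_int k) = 0"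
  using v_nonzero by (simp_all add: X_def Y_def)

lemma XY_scaleR [simp]: "X (t *\<^sub>R w) = t * X w" "Y (t *\<^sub>R w) = t * Y w"
  by (simp_all add: X_def Y_def scaleR_conv_of_real flip: times_divide_eq_right)

lemma XY_eqI: "X a = X b \<Longrightarrow> Y a = Y b \<Longrightarrow> a = b"
  unfolding X_def Y_def using v_nonzero by (metis complex_eqI divide_cancel_right)

definition pt :: "real \<Rightarrow> real \<Rightarrow> complex" where "pt x y = v * Complex x y"

lemma XY_pt [simp]: "X (pt x y) = x" "Y (pt x y) = y"
  using v_nonzero by (simp_all add: pt_def X_def Y_def)

lemma pt_XY [simp]: "pt (X z) (Y z) = z"
  by (rule XY_eqI) auto

lemma continuous_on_XY: "continuous_on S X" "continuous_on S Y"
  unfolding X_def Y_def by (intro continuous_intros; simp add: v_nonzero)+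

lemma continuous_on_pt: "continuous_on S (\<lambda>y. pt x y)"
  unfolding pt_def Complex_eq by (intro continuous_intros)

text \<open>Corner 4 is equidistant from corner 5 and from corner 3, the translate of corner 5 by
  \<open>v\<close>, so it lies on their perpendicular bisector.\<close>

lemma apex: "X (p 4) = X (p 5) + 1 / 2"
proof -
  have "dist ((p 3) / v) ((p 4) / v) = dist ((p 4) / v) ((p 5) / v)"
    using isosceles by (simp add: dist_norm norm_divide flip: diff_divide_distrib)
  then have "(X (p 3) - X (p 4))\<^sup>2 + (Y (p 3) - Y (p 4))\<^sup>2 = (X (p 4) - X (p 5))\<^sup>2 + (Y (p 4) - Y (p 5))\<^sup>2"
    by (simp add: dist_norm cmod_def X_def Y_def)
  then show ?thesis by (simp add: corners power2_eq_square algebra_simps)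
qed

text \<open>Twice the signed area of the triangle \<open>z\<close>, \<open>a\<close>,
  \<open>b\<close> in these coordinates: the sign of \<open>Im ((b - z) / (a - z))\<close> without a
  denominator.\<close>

definition turn :: "complex \<Rightarrow> complex \<Rightarrow> complex \<Rightarrow> real" where
  "turn a b z = (X a - X z) * (Y b - Y z) - (X b - X z) * (Y a - Y z)"

lemma crs_eq: "crs v a b z =
   (if X a > X z \<and> X b \<le> X z \<and> turn a b z > 0 then 1
    else if X b > X z \<and> X a \<le> X z \<and> turn a b z < 0 then -1 else 0)"
proof -
  have i: "Im (w / u) = (Re u * Im w - Re w * Im u) / (norm u)\<^sup>2" for u w
    by (simp add: Im_divide cmod_power2 algebra_simps)
  have "(b - z) / (a - z) = ((b - z) / v) / ((a - z) / v)" using v_nonzero by simp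
  then have "Im ((b - z) / (a - z)) = turn a b z / (norm ((a - z) / v))\<^sup>2"
    using i[of "(b - z) / v" "(a - z) / v"] by (simp add: turn_def X_def Y_def diff_divide_distrib)
  moreover have "turn a b z = 0" if "norm ((a - z) / v) = 0"
    using that v_nonzero by (auto simp: turn_def)
  ultimately have "Im ((b - z) / (a - z)) > 0 \<longleftrightarrow> turn a b z > 0" "Im ((b - z) / (a - z)) < 0 \<longleftrightarrow> turn a b z < 0"
    by (cases "norm ((a - z) / v) = 0"; simp add: zero_less_divide_iff divide_less_0_iff)+
  then show ?thesis unfolding crs_def by (simp add: X_def diff_divide_distrib)
qed

lemma crs_commute: "crs v b a z = - crs v a b z"
  unfolding crs_eq by (auto simp: turn_def)

text \<open>Summing over all translates makes sides that differ by a translation along the strip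
  indistinguishable, so that gluing becomes cancellation.\<close>

definition csum :: "complex \<Rightarrow> complex \<Rightarrow> complex \<Rightarrow> real" where
  "csum a b z = Sum_any (\<lambda>k::int. crs v (a + of_int k * v) (b + of_int k * v) z)"

text \<open>\<open>Sum_any\<close> is 0 on an infinite support, so its rearrangements need
  finiteness. Only translates whose X-range reaches \<open>X z\<close> contribute.\<close>

lemma finite_crs: "finite {k::int. crs v (a + of_int k * v) (b + of_int k * v) z \<noteq> 0}"
proof (rule finite_subset)
  show "{k::int. crs v (a + of_int k * v) (b + of_int k * v) z \<noteq> 0} \<subseteq>
    {\<lfloor>min (X z - X a) (X z - X b)\<rfloor>..\<lceil>max (X z - X a) (X z - X b)\<rceil>}"
    unfolding crs_eq by (auto split: if_splits simp: floor_le_iff le_ceiling_iff min_def max_def)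
qed auto

lemma csum_commute: "csum b a z = - csum a b z"
  unfolding csum_def by (subst crs_commute) (rule Sum_any_minus)

lemma csum_shift: "csum (a + v) (b + v) z = csum a b z"
  unfolding csum_def
proof (rule Sum_any.reindex_cong[symmetric])
  show "bij (\<lambda>k::int. k + 1)" by (rule bij_betw_byWitness[of _ "\<lambda>k. k - 1"]) auto
qed (auto simp: fun_eq_iff algebra_simps)

text \<open>The polyline with corners at the translates of \<open>a\<close> and \<open>b\<close>,
  read as a graph, when \<open>b\<close> comes half a period after \<open>a\<close>.\<close>

definition zig :: "complex \<Rightarrow> complex \<Rightarrow> real \<Rightarrow> real" where
  "zig a b x = Y a + (Y b - Y a) * wave (x - X a)"

lemma continuous_on_zig: "continuous_on S (zig a b)"
  unfolding zig_def
  by (intro continuous_intros continuous_on_compose2[OF continuous_on_wave[of UNIV]]) auto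

lemma zig_cases:
  fixes k :: int
  assumes "X b = X a + 1 / 2"
  shows "of_int k \<le> x - X a \<Longrightarrow> x - X a \<le> of_int k + 1 / 2 \<Longrightarrow> zig a b x = Y a + (Y b - Y a) * (2 * (x - X a - of_int k))"
    and "of_int k + 1 / 2 \<le> x - X a \<Longrightarrow> x - X a \<le> of_int k + 1 \<Longrightarrow> zig a b x = Y a + (Y b - Y a) * (2 - 2 * (x - X a - of_int k))"
  using wave_add_int[of "x - X a - of_int k" k] wave_left[of "x - X a - of_int k"] wave_right[of "x - X a - of_int k"]
  unfolding zig_def by simp_all

text \<open>The half-open convention in \<open>crs\<close> selects exactly one segment of the
  polyline over \<open>X z\<close>. Traversed towards decreasing X, it contributes 1 if it passes
  above \<open>z\<close> and 0 otherwise.\<close>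

lemma csum_zig:
  assumes b: "X b = X a + 1 / 2" and c: "c = a + v"
  shows "csum c b z + csum b a z = of_bool (Y z < zig a b (X z))"
proof -
  define k where "k = \<lfloor>X z - X a\<rfloor>"
  have k: "of_int k \<le> X z - X a" "X z - X a < of_int k + 1" unfolding k_def by linarith+
  let ?f = "\<lambda>m::int. crs v (c + of_int m * v) (b + of_int m * v) z + crs v (b + of_int m * v) (a + of_int m * v) z"
  have "csum c b z + csum b a z = Sum_any ?f"
    unfolding csum_def by (rule Sum_any.distrib[symmetric]) (rule finite_crs)+
  also have "\<dots> = ?f k"
  proof (rule Sum_any_single)
    fix m :: int assume "m \<noteq> k"
    then have "m \<le> k - 1 \<or> k + 1 \<le> m" by linarith
    then have "real_of_int m \<le> of_int k - 1 \<or> of_int k + 1 \<le> real_of_int m"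
      by (metis of_int_1 of_int_add of_int_diff of_int_le_iff)
    then have "\<not> (X a + of_int m \<le> X z \<and> X z < X a + of_int m + 1)" using k by linarith
    then show "?f m = 0" unfolding crs_eq c using b by auto
  qed
  also have "\<dots> = of_bool (Y z < zig a b (X z))"
  proof (cases "X z - X a < of_int k + 1 / 2")
    case True
    have z: "zig a b (X z) = Y a + (Y b - Y a) * (2 * (X z - X a - of_int k))"
      using zig_cases(1)[OF b, of k "X z"] k True by simp
    have "turn (b + of_int k * v) (a + of_int k * v) z = (zig a b (X z) - Y z) / 2"
      unfolding z turn_def by (simp add: b field_simps)
    then show ?thesis using k True b unfolding crs_eq c by auto
  next
    case False
    have z: "zig a b (X z) = Y a + (Y b - Y a) * (2 - 2 * (X z - X a - of_int k))"
      using zig_cases(2)[OF b, of k "X z"] k False by simp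
    have "turn (c + of_int k * v) (b + of_int k * v) z = (zig a b (X z) - Y z) / 2"
      unfolding z turn_def c by (simp add: b field_simps)
    then show ?thesis using k False b unfolding crs_eq c by auto
  qed
  finally show ?thesis .
qed

lemma closed_segment_graph:
  assumes "X a < X b"
  shows "z \<in> closed_segment a b \<longleftrightarrow> X a \<le> X z \<and> X z \<le> X b \<and> (Y z - Y a) * (X b - X a) = (X z - X a) * (Y b - Y a)"
proof
  assume "z \<in> closed_segment a b"
  then obtain u where u: "0 \<le> u" "u \<le> 1" "z = (1 - u) *\<^sub>R a + u *\<^sub>R b" by (auto simp: closed_segment_def)
  have z: "X z = X a + u * (X b - X a)" "Y z = Y a + u * (Y b - Y a)"
    unfolding u(3) XY_add XY_scaleR by (simp_all add: algebra_simps)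
  have "0 \<le> u * (X b - X a)" "u * (X b - X a) \<le> X b - X a"
    using u assms by (simp_all add: mult_left_le_one_le)
  then show "X a \<le> X z \<and> X z \<le> X b \<and> (Y z - Y a) * (X b - X a) = (X z - X a) * (Y b - Y a)"
    using z by auto
next
  assume a: "X a \<le> X z \<and> X z \<le> X b \<and> (Y z - Y a) * (X b - X a) = (X z - X a) * (Y b - Y a)"
  define u where "u = (X z - X a) / (X b - X a)"
  have u: "0 \<le> u" "u \<le> 1" using a assms by (simp_all add: u_def divide_le_eq_1)
  have "X z = X a + u * (X b - X a)" "Y z = Y a + u * (Y b - Y a)"
    using a assms by (simp_all add: u_def field_simps)
  then have "z = (1 - u) *\<^sub>R a + u *\<^sub>R b"
    by (intro XY_eqI) (simp_all add: algebra_simps)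
  then show "z \<in> closed_segment a b" using u by (auto simp: closed_segment_def)
qed

lemma zig_graph:
  assumes b: "X b = X a + 1 / 2" and c: "c = a + v"
  shows "(\<Union>k::int. (\<lambda>z. z + of_int k * v) ` (closed_segment c b \<union> closed_segment b a)) = {z. Y z = zig a b (X z)}"
    (is "?L = ?R")
proof -
  have ab: "w \<in> closed_segment b a \<longleftrightarrow> X a \<le> X w \<and> X w \<le> X a + 1 / 2 \<and> (Y w - Y a) / 2 = (X w - X a) * (Y b - Y a)" for w
    using closed_segment_graph[of a b w] b by (simp add: closed_segment_commute)
  have bc: "w \<in> closed_segment c b \<longleftrightarrow> X a + 1 / 2 \<le> X w \<and> X w \<le> X a + 1 \<and> (Y w - Y b) / 2 = (X w - X a - 1 / 2) * (Y a - Y b)" for w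
  proof -
    have e: "X c - X b = 1 / 2" "Y c - Y b = Y a - Y b" "X w - X b = X w - X a - 1 / 2" "X c = X a + 1"
      by (simp_all add: b c)
    have "X b < X c" using e by linarith
    from closed_segment_graph[OF this, of w] show ?thesis
      unfolding e(1-3) e(4) unfolding b by (simp add: closed_segment_commute)
  qed
  have L: "z \<in> ?L \<longleftrightarrow> (\<exists>k::int. z - of_int k * v \<in> closed_segment c b \<union> closed_segment b a)" for z
  proof -
    have "z \<in> (\<lambda>z. z + of_int k * v) ` S \<longleftrightarrow> z - of_int k * v \<in> S" for k :: int and S
      by (metis (no_types, lifting) add_diff_cancel diff_add_cancel image_iff)
    then show ?thesis by blast
  qed
  have zig: "z - of_int k * v \<in> closed_segment c b \<union> closed_segment b a \<longleftrightarrow> Y z = zig a b (X z)"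
    if k: "of_int k \<le> X z - X a" "X z - X a \<le> of_int k + 1" for k :: int and z
  proof -
    define m where "m = X z - X a - of_int k"
    have "z - of_int k * v \<in> closed_segment b a \<longleftrightarrow> 0 \<le> m \<and> m \<le> 1 / 2 \<and> (Y z - Y a) / 2 = m * (Y b - Y a)"
      unfolding ab m_def by (auto simp: algebra_simps)
    also have "(Y z - Y a) / 2 = m * (Y b - Y a) \<longleftrightarrow> Y z = Y a + (Y b - Y a) * (2 * m)"
      by (auto simp: field_simps)
    finally have 1: "z - of_int k * v \<in> closed_segment b a \<longleftrightarrow> 0 \<le> m \<and> m \<le> 1 / 2 \<and> Y z = Y a + (Y b - Y a) * (2 * m)" .
    have "z - of_int k * v \<in> closed_segment c b \<longleftrightarrow> 1 / 2 \<le> m \<and> m \<le> 1 \<and> (Y z - Y b) / 2 = (m - 1 / 2) * (Y a - Y b)"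
      unfolding bc m_def by (auto simp: algebra_simps)
    also have "(Y z - Y b) / 2 = (m - 1 / 2) * (Y a - Y b) \<longleftrightarrow> Y z = Y a + (Y b - Y a) * (2 - 2 * m)"
      by (auto simp: field_simps)
    finally have 2: "z - of_int k * v \<in> closed_segment c b \<longleftrightarrow> 1 / 2 \<le> m \<and> m \<le> 1 \<and> Y z = Y a + (Y b - Y a) * (2 - 2 * m)" .
    have m: "0 \<le> m" "m \<le> 1" using k by (simp_all add: m_def)
    have 3: "m \<le> 1 / 2 \<Longrightarrow> zig a b (X z) = Y a + (Y b - Y a) * (2 * m)"
      "1 / 2 \<le> m \<Longrightarrow> zig a b (X z) = Y a + (Y b - Y a) * (2 - 2 * m)"
      using zig_cases[OF b, of k "X z"] k by (simp_all add: m_def)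
    show ?thesis unfolding Un_iff 1 2 using 3 m by (cases "m \<le> 1 / 2") auto
  qed
  have "z \<in> ?L \<longleftrightarrow> z \<in> ?R" for z
  proof
    assume "z \<in> ?L"
    then obtain k :: int where k: "z - of_int k * v \<in> closed_segment c b \<union> closed_segment b a" using L by blast
    then have "of_int k \<le> X z - X a" "X z - X a \<le> of_int k + 1" unfolding Un_iff ab bc by auto
    then show "z \<in> ?R" using zig k by blast
  next
    assume "z \<in> ?R"
    moreover have "of_int \<lfloor>X z - X a\<rfloor> \<le> X z - X a" "X z - X a \<le> of_int \<lfloor>X z - X a\<rfloor> + 1" by linarith+
    ultimately show "z \<in> ?L" unfolding L using zig by blast
  qed
  then show ?thesis by blast
qed

end

lemma Sum_any_sum:
  assumes "finite I" "\<And>i. i \<in> I \<Longrightarrow> finite {k. F i k \<noteq> (0::real)}"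
  shows "Sum_any (\<lambda>k. \<Sum>i\<in>I. F i k) = (\<Sum>i\<in>I. Sum_any (F i))" "finite {k. (\<Sum>i\<in>I. F i k) \<noteq> 0}"
proof -
  define S where "S = (\<Union>i\<in>I. {k. F i k \<noteq> 0})"
  have S: "finite S" using assms by (auto simp: S_def)
  have sub: "{k. (\<Sum>i\<in>I. F i k) \<noteq> 0} \<subseteq> S"
    by (auto simp: S_def intro: sum.neutral)
  then show "finite {k. (\<Sum>i\<in>I. F i k) \<noteq> 0}" using S finite_subset by blast
  have "Sum_any (\<lambda>k. \<Sum>i\<in>I. F i k) = (\<Sum>k\<in>S. \<Sum>i\<in>I. F i k)"
    using Sum_any.expand_superset[OF S sub] by simp
  also have "\<dots> = (\<Sum>i\<in>I. \<Sum>k\<in>S. F i k)" by (rule sum.swap)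
  also have "\<dots> = (\<Sum>i\<in>I. Sum_any (F i))"
  proof (rule sum.cong)
    fix i assume "i \<in> I"
    then have "{k. F i k \<noteq> 0} \<subseteq> S" by (auto simp: S_def)
    then show "(\<Sum>k\<in>S. F i k) = Sum_any (F i)" using Sum_any.expand_superset[OF S] by metis
  qed simp
  finally show "Sum_any (\<lambda>k. \<Sum>i\<in>I. F i k) = (\<Sum>i\<in>I. Sum_any (F i))" .
qed

context strip_hexagon
begin

lemma isCont_XY: "isCont X z" "isCont Y z"
  using continuous_on_XY[of UNIV] by (simp_all add: continuous_on_eq_continuous_at)

lemma isCont_pt: "isCont (\<lambda>y. pt x y) y"
  using continuous_on_pt[of UNIV] by (simp add: continuous_on_eq_continuous_at)

section \<open>The tiles of the strip and the band they fill\<close>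

definition tile :: "bool \<Rightarrow> int \<Rightarrow> hexagon" where
  "tile s k i = (if s then p i else p 1 + p 2 - p i) + of_int k * v"

lemma half_turn_eq: "half_turn p z = p 1 + p 2 - z"
  by (simp add: half_turn_def midpoint_def scaleR_conv_of_real)

lemma strip_eq: "strip p = (\<Union>k. {tile True k, tile False k})"
proof -
  have "tile True k = (\<lambda>i. p i + of_int k * v)" "tile False k = (\<lambda>i. p 1 + p 2 - p i + of_int k * v)" for k
    by (simp_all add: tile_def fun_eq_iff)
  then show ?thesis by (simp add: strip_def half_turn_eq v_def[symmetric])
qed

lemma tile_in_strip: "tile s k \<in> strip p"
  unfolding strip_eq by (cases s) auto

lemma in_strip: "q \<in> strip p \<longleftrightarrow> (\<exists>s k. q = tile s k)"
  unfolding strip_eq by (auto simp: ex_bool_eq)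

lemma tile_mv: "tile s k = mv True (if s then 1 else -1) ((if s then 0 else p 1 + p 2) + of_int k * v) \<circ> p"
  by (auto simp: tile_def mv_def fun_eq_iff)

lemma tile_p: "tile True 0 = p"
  by (simp add: tile_def fun_eq_iff)

lemma tile_congruent: "congruent_copy p (tile s k)"
  unfolding congruent_copy_mv tile_mv by (intro exI conjI, rule_tac [2] refl) auto

lemma tile_simple: "simple_hexagon (tile s k)"
  using congruent_copy_facts(1)[OF tile_congruent simple] .

lemma tile_ori: "ori (tile s k) = ori p"
  unfolding tile_mv by (subst body_mv(2)) (auto simp: simple)

text \<open>The name fits when \<open>ori p = 1\<close>; for clockwise corners \<open>upper\<close>
  runs below \<open>lower\<close>, which is why \<open>ori p\<close> occurs as a factor in all
  comparisons.\<close>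

definition upper :: "real \<Rightarrow> real" where
  "upper = zig (p 5) (p 4)"

definition lower :: "real \<Rightarrow> real" where
  "lower = zig (p 1 + p 2 - p 3) (p 1 + p 2 - p 4)"

lemma apex': "X (p 1 + p 2 - p 4) = X (p 1 + p 2 - p 3) + 1 / 2"
  using apex by (simp add: corners)

lemma corner' : "p 1 + p 2 - p 5 = p 1 + p 2 - p 3 + v"
  by (simp add: corners)

lemma line1_eq: "line1 p = {z. Y z = upper (X z)}"
  unfolding line1_def upper_def zig_graph[OF apex corners(2), symmetric]
  by (simp add: side_def v_def)

lemma line2_eq: "line2 p = {z. Y z = lower (X z)}"
proof -
  have h: "(\<lambda>z. half_turn p z + of_int k * shift p) ` S = (\<lambda>z. z + of_int k * v) ` half_turn p ` S" for k :: int and S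
    by (simp add: image_image v_def)
  have m: "half_turn p = mv True (-1) (p 1 + p 2)"
    by (simp add: fun_eq_iff half_turn_eq mv_def)
  have s: "half_turn p ` closed_segment a b = closed_segment (p 1 + p 2 - b) (p 1 + p 2 - a)" for a b
    unfolding m mv_closed_segment by (simp add: mv_def closed_segment_commute)
  have "half_turn p ` (side p 3 \<union> side p 4) =
     closed_segment (p 1 + p 2 - p 5) (p 1 + p 2 - p 4) \<union> closed_segment (p 1 + p 2 - p 4) (p 1 + p 2 - p 3)"
    unfolding image_Un side_def by (simp add: s Un_commute)
  then show ?thesis
    unfolding line2_def h lower_def zig_graph[OF apex' corner', symmetric] by simp
qed

definition skeleton :: "complex set" where
  "skeleton = (\<Union>s k. bdry (tile s k))"

lemma negligible_skeleton: "negligible skeleton"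
proof -
  have "skeleton = (\<Union>q\<in>range (\<lambda>(s, k). tile s k). bdry q)"
    unfolding skeleton_def by (auto split: prod.splits) blast
  also have "negligible \<dots>" by (rule negligible_bdrys) auto
  finally show ?thesis .
qed

text \<open>
  The crossings of the sides interior to the strip cancel in pairs, so that only the two boundary
  lines contribute to the number of tiles covering a point.
\<close>

lemma tile_count:
  assumes "z \<notin> skeleton"
  defines "f \<equiv> \<lambda>k. of_bool (z \<in> body (tile True k)) + of_bool (z \<in> body (tile False k))"
  shows "finite {k. f k \<noteq> (0::real)}"
    "Sum_any f = ori p * (of_bool (Y z < upper (X z)) - of_bool (Y z < lower (X z)))"
proof -
  have z: "z \<notin> bdry (tile s k)" for s k using assms(1) by (auto simp: skeleton_def)
  define F where "F = (\<lambda>s i k. crs v (tile s k i) (tile s k (i + 1)) z)"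
  have fin: "finite {k. F s i k \<noteq> 0}" for s i
    unfolding F_def tile_def by (rule finite_crs)
  have "of_bool (z \<in> body (tile s k)) = ori p * (\<Sum>i\<in>UNIV. F s i k)" for s k
    unfolding F_def using indicator_body_crs[OF tile_simple z v_nonzero] by (simp add: tile_ori)
  then have f: "f k = ori p * (\<Sum>i\<in>UNIV. \<Sum>s\<in>UNIV. F s i k)" for k
    by (simp add: f_def UNIV_bool sum.distrib distrib_left add.commute)
  have fin1: "finite {k. (\<Sum>s\<in>UNIV. F s i k) \<noteq> 0}" for i
    by (rule Sum_any_sum(2)) (auto simp: fin)
  have fin2: "finite {k. (\<Sum>i\<in>UNIV. \<Sum>s\<in>UNIV. F s i k) \<noteq> 0}"
    by (rule Sum_any_sum(2)) (auto simp: fin1)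
  have o: "ori p \<noteq> 0" using ori_cases[of p] by auto
  show "finite {k. f k \<noteq> 0}" unfolding f using fin2 o by simp
  have "Sum_any f = ori p * Sum_any (\<lambda>k. \<Sum>i\<in>UNIV. \<Sum>s\<in>UNIV. F s i k)"
    unfolding f using o by (rule Sum_any_scale)
  also have "Sum_any (\<lambda>k. \<Sum>i\<in>UNIV. \<Sum>s\<in>UNIV. F s i k) = (\<Sum>i\<in>UNIV. \<Sum>s\<in>UNIV. Sum_any (F s i))"
    by (subst Sum_any_sum(1)) (auto simp: fin1 fin Sum_any_sum(1))
  finally have S: "Sum_any f = ori p * (\<Sum>i\<in>UNIV. \<Sum>s\<in>UNIV. Sum_any (F s i))" .
  have T: "Sum_any (F True i) = csum (p i) (p (i + 1)) z"
    and F: "Sum_any (F False i) = csum (p 1 + p 2 - p i) (p 1 + p 2 - p (i + 1)) z" for i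
    by (simp_all add: F_def csum_def tile_def)
  \<comment> \<open>The four gluings: side 0 of \<open>R(P)\<close> with side 0 of a translate of
    \<open>P\<close>, side 1 of \<open>P\<close> with side 1 of \<open>R(P)\<close>, and side 5 with
    side 2 of a translate, both for \<open>P\<close> and for \<open>R(P)\<close>.\<close>
  have c0: "csum (p 1 + p 2 - p 0) (p 1 + p 2 - p 1) z = - csum (p 0) (p 1) z"
    using csum_shift[of "p 1" "p 0" z] csum_commute[of "p 1" "p 0" z] by (simp add: corners)
  have c1: "csum (p 1 + p 2 - p 1) (p 1 + p 2 - p 2) z = - csum (p 1) (p 2) z"
    using csum_commute[of "p 1" "p 2" z] by simp
  have c2: "csum (p 5) (p 0) z = - csum (p 2) (p 3) z"
    using csum_shift[of "p 0" "p 5" z] csum_commute[of "p 0" "p 5" z] by (simp add: corners)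
  have c3: "csum (p 1 + p 2 - p 5) (p 1 + p 2 - p 0) z = - csum (p 1 + p 2 - p 2) (p 1 + p 2 - p 3) z"
    using csum_shift[of "p 1 + p 2 - p 2" "p 1 + p 2 - p 3" z] csum_commute[of "p 1 + p 2 - p 5" "p 1 + p 2 - p 0" z]
    by (simp add: corners algebra_simps)
  have "(\<Sum>i\<in>UNIV. \<Sum>s\<in>UNIV. Sum_any (F s i)) = (csum (p 3) (p 4) z + csum (p 4) (p 5) z)
     - (csum (p 1 + p 2 - p 5) (p 1 + p 2 - p 4) z + csum (p 1 + p 2 - p 4) (p 1 + p 2 - p 3) z)"
    unfolding sum_6 UNIV_bool using c0 c1 c2 c3 csum_commute[of "p 1 + p 2 - p 4" "p 1 + p 2 - p 3" z]
      csum_commute[of "p 1 + p 2 - p 5" "p 1 + p 2 - p 4" z]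
    by (simp add: T F)
  also have "csum (p 3) (p 4) z + csum (p 4) (p 5) z = of_bool (Y z < upper (X z))"
    unfolding upper_def by (rule csum_zig[OF apex corners(2)])
  also have "csum (p 1 + p 2 - p 5) (p 1 + p 2 - p 4) z + csum (p 1 + p 2 - p 4) (p 1 + p 2 - p 3) z = of_bool (Y z < lower (X z))"
    unfolding lower_def by (rule csum_zig[OF apex' corner'])
  finally show "Sum_any f = ori p * (of_bool (Y z < upper (X z)) - of_bool (Y z < lower (X z)))"
    using S by simp
qed

text \<open>As a sum of indicators \<open>n\<close> is nonnegative, and as a signed difference of
  two indicators it is at most 1. So a generic point lies in at most one tile.\<close>

lemma tile_count_bounds:
  assumes "z \<notin> skeleton"
  defines "n \<equiv> ori p * (of_bool (Y z < upper (X z)) - of_bool (Y z < lower (X z)))"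
  shows "0 \<le> n" "z \<in> body (tile s k) \<Longrightarrow> n = 1" "n = 1 \<Longrightarrow> \<exists>s k. z \<in> body (tile s k)"
    "z \<in> body (tile s k) \<Longrightarrow> z \<in> body (tile s' k') \<Longrightarrow> s = s' \<and> k = k'"
proof -
  define f :: "int \<Rightarrow> real" where "f = (\<lambda>k. of_bool (z \<in> body (tile True k)) + of_bool (z \<in> body (tile False k)))"
  have fin: "finite {k. f k \<noteq> 0}" and n: "Sum_any f = n"
    using tile_count[OF assms(1)] unfolding f_def n_def by auto
  have f0: "0 \<le> f k" for k by (simp add: f_def)
  have le: "sum f A \<le> n" if "finite A" for A using Sum_any_ge[OF fin that f0] n by simp
  show "0 \<le> n" using le[of "{}"] by simp
  have n1: "n \<le> 1" using ori_cases[of p] by (auto simp: n_def)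
  have f1: "1 \<le> f k" if "z \<in> body (tile s k)" for s k
    using that by (cases s) (auto simp: f_def)
  show "z \<in> body (tile s k) \<Longrightarrow> n = 1" using f1 le[of "{k}"] n1 by fastforce
  show "\<exists>s k. z \<in> body (tile s k)" if "n = 1"
  proof (rule ccontr)
    assume "\<nexists>s k. z \<in> body (tile s k)"
    then have "f = (\<lambda>k. 0)" by (auto simp: f_def)
    then show False using n that by simp
  qed
  show "s = s' \<and> k = k'" if a: "z \<in> body (tile s k)" "z \<in> body (tile s' k')"
  proof (rule ccontr)
    assume ne: "\<not> (s = s' \<and> k = k')"
    show False
    proof (cases "k = k'")
      case True
      then have "f k = 2" using a ne by (cases s; cases s') (auto simp: f_def)
      then show False using le[of "{k}"] n1 by simp
    next
      case False
      then show False using le[of "{k, k'}"] n1 f1[OF a(1)] f1[OF a(2)] by simp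
    qed
  qed
qed

lemma tiles_disjoint:
  assumes "(s, k) \<noteq> (s', k')"
  shows "body (tile s k) \<inter> body (tile s' k') = {}"
proof (rule ccontr)
  assume "body (tile s k) \<inter> body (tile s' k') \<noteq> {}"
  moreover have "open (body (tile s k) \<inter> body (tile s' k'))"
    using simple_hexagon_topology(1) tile_simple by blast
  ultimately obtain z where "z \<in> body (tile s k) \<inter> body (tile s' k')" "z \<notin> skeleton"
    using generic_point[OF _ _ negligible_skeleton] by metis
  then show False using tile_count_bounds(4) assms by blast
qed

lemma continuous_on_lines: "continuous_on S (\<lambda>z. upper (X z))" "continuous_on S (\<lambda>z. lower (X z))"
  unfolding upper_def lower_def
  by (intro continuous_on_compose2[OF continuous_on_zig[of UNIV]] continuous_on_XY; auto)+

lemma zig_periodic: "zig a b (x + of_int k) = zig a b x"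
  using wave_add_int[of "x - X a" k] by (simp add: zig_def algebra_simps)

definition band :: "complex set" where
  "band = {z. ori p * lower (X z) \<le> ori p * Y z \<and> ori p * Y z \<le> ori p * upper (X z)}"

definition open_band :: "complex set" where
  "open_band = {z. ori p * lower (X z) < ori p * Y z \<and> ori p * Y z < ori p * upper (X z)}"

lemma closed_band: "closed band"
  unfolding band_def
  by (intro closed_Collect_conj closed_Collect_le continuous_intros continuous_on_lines continuous_on_XY)

lemma open_open_band: "open open_band"
  unfolding open_band_def
  by (intro open_Collect_conj open_Collect_less continuous_intros continuous_on_lines continuous_on_XY)

text \<open>Were the order reversed somewhere, there would be a nonempty open set between the two
  graphs on which the number of tiles is -1.\<close>

lemma lower_le_upper: "ori p * lower x \<le> ori p * upper x"
proof (rule ccontr)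
  assume n: "\<not> ?thesis"
  define U where "U = {z. ori p * upper (X z) < ori p * Y z \<and> ori p * Y z < ori p * lower (X z)}"
  have "open U" unfolding U_def
    by (intro open_Collect_conj open_Collect_less continuous_intros continuous_on_lines continuous_on_XY)
  moreover have "pt x ((upper x + lower x) / 2) \<in> U"
    using n ori_cases[of p] by (auto simp: U_def)
  ultimately obtain z where z: "z \<in> U" "z \<notin> skeleton"
    using generic_point[OF _ _ negligible_skeleton] by (metis empty_iff)
  then show False using tile_count_bounds(1)[OF z(2)] ori_cases[of p] by (auto simp: U_def)
qed

lemma body_subset_band: "body (tile s k) \<subseteq> band"
proof (rule ccontr)
  assume "\<not> body (tile s k) \<subseteq> band"
  then have "body (tile s k) - band \<noteq> {}" by blast
  moreover have "open (body (tile s k) - band)"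
    using simple_hexagon_topology(1)[OF tile_simple] closed_band by blast
  ultimately obtain z where z: "z \<in> body (tile s k) - band" "z \<notin> skeleton"
    using generic_point[OF _ _ negligible_skeleton] by metis
  then show False using tile_count_bounds(2)[OF z(2), of s k] lower_le_upper[of "X z"] ori_cases[of p]
    by (auto simp: band_def)
qed

lemma region_subset_band: "region (tile s k) \<subseteq> band"
  using closure_minimal[OF body_subset_band closed_band] simple_hexagon_topology(7)[OF tile_simple] by metis

text \<open>
  Were the boundary lines to touch, they would do so periodically and confine the connected
  interior of \<open>P\<close> to a slab of width \<open>|v|\<close>; then the sides 2 and 5 would lie on its two walls,
  where the band consists of a single point.
\<close>

lemma lower_less_upper: "ori p * lower x < ori p * upper x"
proof (rule ccontr)
  assume "\<not> ?thesis"
  then have eq: "lower x = upper x" using lower_le_upper[of x] ori_cases[of p] by auto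
  have pinch: "Y z = upper x" if "z \<in> band" "X z = x + of_int k" for z and k :: int
    using that eq ori_cases[of p] zig_periodic unfolding band_def by (auto simp: lower_def upper_def)
  have avoid: "X z \<noteq> x + of_int k" if z: "z \<in> body p" for z and k :: int
  proof
    assume k: "X z = x + of_int k"
    define V where "V = (\<lambda>y. pt (X z) y) -` body p"
    have "open V" unfolding V_def
      by (rule open_vimage[OF simple_hexagon_topology(1)[OF simple] continuous_on_pt])
    moreover have "Y z \<in> V" using z by (simp add: V_def)
    moreover have "V \<subseteq> {upper x}"
    proof
      fix y assume "y \<in> V"
      then have "pt (X z) y \<in> band" using body_subset_band[of True 0] by (auto simp: V_def tile_p)
      from pinch[OF this, of k] show "y \<in> {upper x}" using k by simp
    qed
    ultimately have "open {upper x}" by (metis empty_iff insert_absorb subset_singleton_iff)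
    then show False using not_open_singleton by blast
  qed
  obtain z0 where z0: "z0 \<in> body p" using simple_hexagon_topology(3)[OF simple] by blast
  define j where "j = \<lfloor>X z0 - x\<rfloor>"
  have j: "x + of_int j \<le> X z0" "X z0 < x + of_int (j + 1)" unfolding j_def by linarith+
  have con: "connected (X ` body p)"
    by (rule connected_continuous_image[OF continuous_on_XY(1) simple_hexagon_topology(2)[OF simple]])
  have n: "x + of_int k \<notin> X ` body p" for k :: int using avoid[of _ k] by (metis imageE)
  have B: "x + of_int j \<le> X z \<and> X z \<le> x + of_int (j + 1)" if "z \<in> body p" for z
  proof (rule ccontr)
    assume "\<not> ?thesis"
    then have "X z < x + of_int j \<or> x + of_int (j + 1) < X z" by auto
    then show False
    proof
      assume "X z < x + of_int j"
      then show False using connectedD_interval[OF con, of "X z" "X z0" "x + of_int j"] that z0 j n by auto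
    next
      assume "x + of_int (j + 1) < X z"
      then show False using connectedD_interval[OF con, of "X z0" "X z" "x + of_int (j + 1)"] that z0 j n[of "j + 1"] by auto
    qed
  qed
  define W where "W = {z. x + of_int j \<le> X z \<and> X z \<le> x + of_int (j + 1)}"
  have "closed W" unfolding W_def
    by (intro closed_Collect_conj closed_Collect_le continuous_intros continuous_on_XY)
  then have W: "region p \<subseteq> W"
    using closure_minimal[of "body p" W] B simple_hexagon_topology(7)[OF simple] by (auto simp: W_def)
  have r: "p i \<in> region p" for i using corner_in_bdry by (auto simp: region_eq)
  have w: "x + of_int j \<le> X (p i) \<and> X (p i) \<le> x + of_int j + 1" for i
    using W r[of i] by (auto simp: W_def)
  have x5: "X (p 5) = x + of_int j" and x0: "X (p 0) = x + of_int j"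
    using w[of 5] w[of 3] w[of 0] w[of 2] by (simp_all add: corners)
  have b: "p i \<in> band" for i using r[of i] region_subset_band[of True 0] by (auto simp: tile_p)
  have "p 5 = p 0"
    using pinch[OF b x5] pinch[OF b x0] x5 x0 by (intro XY_eqI) auto
  then show False using simple_hexagon_sides(1)[OF simple] by (auto dest: injD)
qed

text \<open>The infinite union is closed because, for each of the two kinds of tiles, it is the sum
  of a compact set and the closed set of integer multiples of \<open>v\<close>.\<close>

lemma closed_covered_strip: "closed (covered (strip p))"
proof -
  define L where "L = {z. X z \<in> \<int> \<and> Y z = 0}"
  have L: "z \<in> L \<longleftrightarrow> (\<exists>k::int. z = of_int k * v)" for z
  proof
    assume "z \<in> L"
    then obtain k :: int where "X z = of_int k" "Y z = 0" by (auto simp: L_def elim: Ints_cases)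
    then have "z = of_int k * v" by (intro XY_eqI) auto
    then show "\<exists>k::int. z = of_int k * v" by blast
  qed (auto simp: L_def)
  have "closed (X -` \<int>)"
    by (intro continuous_closed_vimage closed_Ints isCont_XY)
  moreover have "closed {z. Y z = 0}" by (intro closed_Collect_eq continuous_on_XY continuous_intros)
  ultimately have "closed (X -` \<int> \<inter> {z. Y z = 0})" by (rule closed_Int)
  also have "X -` \<int> \<inter> {z. Y z = 0} = L" by (auto simp: L_def)
  finally have "closed L" .
  then have c: "closed (\<Union>x\<in>region (tile s 0). \<Union>y\<in>L. {x + y})" for s
    using compact_closed_sums simple_hexagon_topology(8)[OF tile_simple] by blast
  have t: "region (tile s k) = (\<lambda>z. z + of_int k * v) ` region (tile s 0)" for s k
  proof -
    have "tile s k = mv True 1 (of_int k * v) \<circ> tile s 0" by (auto simp: fun_eq_iff tile_def mv_def)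
    then have "region (tile s k) = mv True 1 (of_int k * v) ` region (tile s 0)"
      using region_mv[of 1 "tile s 0"] tile_simple by simp
    then show ?thesis by (simp add: mv_def)
  qed
  have "covered (strip p) = (\<Union>s. \<Union>k. region (tile s k))"
    unfolding covered_def strip_eq by (auto simp: UNIV_bool)
  also have "\<dots> = (\<Union>s. \<Union>x\<in>region (tile s 0). \<Union>y\<in>L. {x + y})"
  proof -
    have "(\<Union>k. region (tile s k)) = (\<Union>x\<in>region (tile s 0). \<Union>y\<in>L. {x + y})" for s
    proof -
      define B where "B = region (tile s 0)"
      have "region (tile s k) = (\<lambda>z. z + of_int k * v) ` B" for k unfolding B_def by (rule t)
      then show ?thesis unfolding B_def[symmetric] by (auto simp: L) (rule exI, erule imageI)
    qed
    then show ?thesis by simp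
  qed
  also have "closed \<dots>" using c by (intro closed_UN) auto
  finally show ?thesis .
qed

text \<open>An uncovered part of the open band would be open, hence contain a generic point, which
  the count puts into a tile. The boundary of the band is reached along vertical lines; this works
  because the two graphs nowhere touch.\<close>

lemma covered_strip: "covered (strip p) = band"
proof
  show "covered (strip p) \<subseteq> band"
  proof
    fix z assume "z \<in> covered (strip p)"
    then obtain s k where "z \<in> region (tile s k)" by (auto simp: covered_def in_strip)
    then show "z \<in> band" using region_subset_band by blast
  qed
  have o: "open_band \<subseteq> covered (strip p)"
  proof (rule ccontr)
    assume "\<not> ?thesis"
    then have "open_band - covered (strip p) \<noteq> {}" by blast
    moreover have "open (open_band - covered (strip p))" using open_open_band closed_covered_strip by blast
    ultimately obtain z where z: "z \<in> open_band - covered (strip p)" "z \<notin> skeleton"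
      using generic_point[OF _ _ negligible_skeleton] by metis
    then obtain s k where "z \<in> body (tile s k)"
      using tile_count_bounds(3)[OF z(2)] ori_cases[of p] by (auto simp: open_band_def)
    then show False using z(1) tile_in_strip by (auto simp: covered_def region_eq)
  qed
  show "band \<subseteq> covered (strip p)"
  proof
    fix z assume z: "z \<in> band"
    define V where "V = (\<lambda>y. pt (X z) y) -` covered (strip p)"
    have "closed V" unfolding V_def
      by (intro continuous_closed_vimage closed_covered_strip isCont_pt)
    define l u where "l = min (lower (X z)) (upper (X z))" and "u = max (lower (X z)) (upper (X z))"
    have lu: "l < u" using lower_less_upper[of "X z"] ori_cases[of p] by (auto simp: l_def u_def)
    have "{l<..<u} \<subseteq> V"
      using o ori_cases[of p] lower_less_upper[of "X z"] unfolding V_def open_band_def l_def u_def by (auto simp: subset_eq)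
    then have "{l..u} \<subseteq> V" using closure_minimal[OF _ \<open>closed V\<close>] closure_greaterThanLessThan[OF lu] by metis
    moreover have "Y z \<in> {l..u}" using z ori_cases[of p] by (auto simp: band_def l_def u_def)
    ultimately show "z \<in> covered (strip p)" by (auto simp: V_def)
  qed
qed

end

section \<open>Stacks of strips\<close>

lemma int_sequence:
  fixes \<delta> :: "int \<Rightarrow> 'a :: ab_group_add"
  obtains a where "\<And>n. a (n + 1) = a n + \<delta> n" "a 0 = c"
proof -
  define a where "a n = c + (if 0 \<le> n then \<Sum>k\<in>{0..<n}. \<delta> k else - (\<Sum>k\<in>{n..<0}. \<delta> k))" for n :: int
  have "a (n + 1) = a n + \<delta> n" for n
  proof (cases "0 \<le> n")
    case True
    then have "{0..<n + 1} = insert n {0..<n}" by auto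
    then show ?thesis using True by (simp add: a_def)
  next
    case False
    then have "{n..<0} = insert n {n + 1..<0}" by auto
    then show ?thesis using False by (simp add: a_def)
  qed
  moreover have "a 0 = c" by (simp add: a_def)
  ultimately show thesis using that by blast
qed

text \<open>A discrete intermediate value argument: staying within \<open>B\<close> of an increasing
  linear function, \<open>f\<close> takes values on both sides of \<open>y\<close>, and some step
  must cross.\<close>

lemma int_bracket:
  fixes f :: "int \<Rightarrow> real"
  assumes "0 < c" "\<And>n. \<bar>f n - of_int n * c\<bar> \<le> B"
  shows "\<exists>n. f n \<le> y \<and> y < f (n + 1)"
proof -
  have b: "of_int n * c - B \<le> f n" "f n \<le> of_int n * c + B" for n using assms(2)[of n] by linarith+
  define n0 where "n0 = \<lfloor>(y - B) / c\<rfloor>"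
  have "of_int n0 \<le> (y - B) / c" by (simp add: n0_def)
  then have "of_int n0 * c \<le> y - B" using assms(1) by (simp add: pos_le_divide_eq)
  then have n0: "f n0 \<le> y" using b(2)[of n0] by linarith
  define n1 where "n1 = \<lceil>(y + B) / c\<rceil> + 1"
  have "(y + B) / c < of_int n1" by (simp add: n1_def) linarith
  then have "y + B < of_int n1 * c" using assms(1) by (simp add: pos_divide_less_eq)
  then have n1: "y < f n1" using b(1)[of n1] by linarith
  show ?thesis
  proof (rule ccontr)
    assume "\<not> ?thesis"
    then have step: "f (n + 1) \<le> y" if "f n \<le> y" for n using that by (meson not_le)
    have up: "f (n0 + int k) \<le> y" for k
    proof (induction k)
      case (Suc k)
      then show ?case using step[of "n0 + int k"] by (simp add: ac_simps)
    qed (use n0 in simp)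
    have down: "f n \<le> y" if "n < n0" for n
    proof -
      have "of_int n * c \<le> of_int n0 * c" using that assms(1) by simp
      then show ?thesis using b(2)[of n] \<open>of_int n0 * c \<le> y - B\<close> by linarith
    qed
    have "f n1 \<le> y"
    proof (cases "n1 < n0")
      case False
      then show ?thesis using up[of "nat (n1 - n0)"] by simp
    qed (rule down)
    then show False using n1 by simp
  qed
qed

context strip_hexagon
begin

section \<open>Placed strips and the matching of their boundary lines\<close>

definition lin :: "bool \<Rightarrow> complex \<Rightarrow> complex" where
  "lin b z = (if b then z else mirror p z)"

definition sg :: "bool \<Rightarrow> real" where
  "sg b = (if b then 1 else -1)"

lemma place_lin: "place p b a z = a + lin b z"
  by (simp add: place_def lin_def)

lemma sg_sq [simp]: "sg b * sg b = 1" "sg b * (sg b * x) = x"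
  by (auto simp: sg_def)

lemma mirror_eq: "mirror p z = - (v / cnj v) * cnj z"
proof -
  have "(z \<bullet> v) / (v \<bullet> v) = X z"
    unfolding X_def by (simp add: inner_complex_def Re_divide power2_eq_square)
  then have "mirror p z = z - (2 * X z) *\<^sub>R v" by (simp add: mirror_def v_def[symmetric])
  moreover have "of_real (2 * X z) = z / v + cnj z / cnj v"
    unfolding X_def by (simp add: complex_add_cnj[of "z / v", simplified])
  then have "of_real (2 * X z) * v = z + cnj z / cnj v * v" using v_nonzero by (simp add: distrib_right)
  ultimately show ?thesis by (simp add: scaleR_conv_of_real)
qed

lemma XY_lin [simp]: "X (lin b z) = sg b * X z" "Y (lin b z) = Y z"
proof -
  have "X (mirror p z) = - X z" "Y (mirror p z) = Y z"
  proof -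
    have e: "mirror p z / v = - cnj (z / v)" unfolding mirror_eq using v_nonzero by simp
    show "X (mirror p z) = - X z" unfolding X_def e by (simp del: complex_cnj_divide)
    show "Y (mirror p z) = Y z" unfolding Y_def e by (simp del: complex_cnj_divide)
  qed
  then show "X (lin b z) = sg b * X z" "Y (lin b z) = Y z" by (simp_all add: lin_def sg_def)
qed

lemma XY_place [simp]: "X (place p b a z) = X a + sg b * X z" "Y (place p b a z) = Y a + Y z"
  by (simp_all add: place_lin)

lemma place_mv: "place p b a = mv b (if b then 1 else - (v / cnj v)) a"
  by (auto simp: fun_eq_iff place_def mv_def mirror_eq)

lemma place_coeff: "norm (if b then 1 else - (v / cnj v)) = 1" "(if b then 1 else - (v / cnj v)) \<noteq> 0"
  using v_nonzero by (auto simp: norm_divide)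

lemma place_isometry: "plane_isometry (place p b a)"
  unfolding place_mv by (rule plane_isometry_mv) (rule place_coeff)

lemma place_graph: "place p b a ` {z. P (X z) (Y z)} = {z. P (sg b * (X z - X a)) (Y z - Y a)}"
proof -
  have "z \<in> place p b a ` {z. P (X z) (Y z)}" if "P (sg b * (X z - X a)) (Y z - Y a)" for z
  proof (rule image_eqI)
    show "z = place p b a (pt (sg b * (X z - X a)) (Y z - Y a))" by (rule XY_eqI) simp_all
  qed (use that in simp)
  then show ?thesis by auto
qed

lemma inj_place: "inj (place p b a)"
  unfolding place_mv by (rule inj_mv) (rule place_coeff)

lemma region_place: "simple_hexagon q \<Longrightarrow> region (place p b a \<circ> q) = place p b a ` region q"
  unfolding place_mv by (rule region_mv) (rule place_coeff)

lemma body_place: "simple_hexagon q \<Longrightarrow> body (place p b a \<circ> q) = place p b a ` body q"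
  unfolding place_mv by (rule body_mv) (rule place_coeff)

lemma ori_place: "simple_hexagon q \<Longrightarrow> ori (place p b a \<circ> q) = sg b * ori q"
  unfolding place_mv by (subst body_mv(2)[OF place_coeff(2)]) (auto simp: sg_def)

definition Upper :: "bool \<Rightarrow> complex \<Rightarrow> real \<Rightarrow> real" where
  "Upper b a x = Y a + upper (sg b * (x - X a))"

definition Lower :: "bool \<Rightarrow> complex \<Rightarrow> real \<Rightarrow> real" where
  "Lower b a x = Y a + lower (sg b * (x - X a))"

lemma Lower_less_Upper: "ori p * Lower b a x < ori p * Upper b a x"
  using lower_less_upper by (simp add: Lower_def Upper_def distrib_left)

lemma place_line1: "place p b a ` line1 p = {z. Y z = Upper b a (X z)}"
  unfolding line1_eq place_graph[of b a "\<lambda>x y. y = upper x"] by (auto simp: Upper_def)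

lemma place_line2: "place p b a ` line2 p = {z. Y z = Lower b a (X z)}"
  unfolding line2_eq place_graph[of b a "\<lambda>x y. y = lower x"] by (auto simp: Lower_def)

lemma covered_place:
  "covered (move (place p b a) (strip p)) =
     {z. ori p * Lower b a (X z) \<le> ori p * Y z \<and> ori p * Y z \<le> ori p * Upper b a (X z)}"
proof -
  have "covered (move (place p b a) (strip p)) = (\<Union>q\<in>strip p. region (place p b a \<circ> q))"
    by (simp add: covered_def move_def)
  also have "\<dots> = (\<Union>q\<in>strip p. place p b a ` region q)"
    by (intro SUP_cong refl region_place) (auto simp: in_strip tile_simple)
  also have "\<dots> = place p b a ` band" by (simp add: covered_strip[symmetric] covered_def image_UN)
  also have "\<dots> = {z. ori p * lower (sg b * (X z - X a)) \<le> ori p * (Y z - Y a) \<and>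
      ori p * (Y z - Y a) \<le> ori p * upper (sg b * (X z - X a))}"
    unfolding band_def by (rule place_graph)
  also have "\<dots> = {z. ori p * Lower b a (X z) \<le> ori p * Y z \<and> ori p * Y z \<le> ori p * Upper b a (X z)}"
    unfolding Upper_def Lower_def distrib_left right_diff_distrib by (intro Collect_cong) linarith
  finally show ?thesis .
qed

text \<open>
  The offsets put corner 4 of the tile \<open>R(P)\<close> of strip \<open>n + 1\<close> on corner 3 of the tile \<open>P\<close> of
  strip \<open>n\<close>.
\<close>

definition stacked :: "(int \<Rightarrow> bool) \<Rightarrow> (int \<Rightarrow> complex) \<Rightarrow> bool" where
  "stacked d a \<longleftrightarrow> (\<forall>n. a (n + 1) = a n + lin (d n) (p 3) + lin (d (n + 1)) (p 4 - p 1 - p 2))"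

definition stack :: "(int \<Rightarrow> bool) \<Rightarrow> (int \<Rightarrow> complex) \<Rightarrow> hexagon set" where
  "stack d a = (\<Union>n. move (place p (d n) (a n)) (strip p))"

text \<open>The two-sided recursion for the offsets is solvable for every \<open>d\<close>; this is
  the free choice of the directions.\<close>

lemma stacked_exists: "\<exists>a. stacked d a"
proof -
  obtain a where "\<And>n. a (n + 1) = a n + (lin (d n) (p 3) + lin (d (n + 1)) (p 4 - p 1 - p 2))"
    using int_sequence[of "\<lambda>n. lin (d n) (p 3) + lin (d (n + 1)) (p 4 - p 1 - p 2)" 0] by blast
  then show ?thesis unfolding stacked_def by (intro exI[of _ a]) (simp add: add.assoc)
qed

lemma wave_sg: "wave (sg b * t - c) = wave (t - sg b * c)"
  using wave_minus[of "t + c"] by (auto simp: sg_def)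

text \<open>For all four choices of signs the argument moves by an odd multiple of half a
  period.\<close>

lemma wave_sg_half: "wave (t - sg b + sg b' / 2) = 1 - wave t"
  using wave_add_int[of "t + 1 / 2" "-1"] wave_add_int[of "t + 1 / 2" 1] wave_add_int[of "t + 1 / 2" "-2"] wave_half[of t]
  by (cases b; cases b') (simp_all add: sg_def algebra_simps)

lemma Upper_wave: "Upper b a x = Y a + Y (p 5) + (Y (p 4) - Y (p 5)) * wave (x - X a - sg b * X (p 5))"
  by (simp add: Upper_def upper_def zig_def wave_sg)

lemma Lower_wave: "Lower b a x = Y a + Y (p 1 + p 2) - Y (p 5)
     - (Y (p 4) - Y (p 5)) * wave (x - X a - sg b * (X (p 1 + p 2) - X (p 5) - 1))"
proof -
  have e: "X (p 1 + p 2 - p 3) = X (p 1 + p 2) - X (p 5) - 1" "Y (p 1 + p 2 - p 3) = Y (p 1 + p 2) - Y (p 5)"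
    "Y (p 1 + p 2 - p 4) = Y (p 1 + p 2) - Y (p 4)" by (simp_all add: corners)
  show ?thesis unfolding Lower_def lower_def zig_def e wave_sg by (simp only: algebra_simps)
qed

text \<open>Mirroring changes only the phase of the even wave, and the offset leaves half a period
  modulo 1 between the two waves. The half turn has negated the amplitude of the lower line, which
  \<open>1 - wave\<close> compensates.\<close>

lemma Upper_eq_Lower:
  assumes "a' = a + lin b (p 3) + lin b' (p 4 - p 1 - p 2)"
  shows "Upper b a x = Lower b' a' x"
proof -
  have x: "x - X a' - sg b' * (X (p 1 + p 2) - X (p 5) - 1) = (x - X a - sg b * X (p 5)) - sg b + sg b' / 2"
    unfolding assms by (simp add: corners apex algebra_simps)
  have y: "Y a' = Y a + Y (p 5) + Y (p 4) - Y (p 1 + p 2)"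
    unfolding assms by (simp add: corners)
  show ?thesis unfolding Upper_wave Lower_wave x wave_sg_half y by (simp add: algebra_simps)
qed

definition height :: real where "height = Y (p 4) + Y (p 5) - Y (p 1 + p 2)"

text \<open>Adding the values at two points half a period apart removes the wave, so
  \<open>height\<close> is the mean gap between the two lines. It is also the step from one strip to
  the next.\<close>

lemma height_pos: "0 < ori p * height"
proof -
  have w: "wave (x + 1 / 2 - c) = 1 - wave (x - c)" for x c
    using wave_half[of "x - c"] by (simp add: algebra_simps)
  have "upper x + upper (x + 1 / 2) = Y (p 4) + Y (p 5)" for x
    unfolding upper_def zig_def w by (simp add: algebra_simps)
  moreover have "lower x + lower (x + 1 / 2) = 2 * Y (p 1 + p 2) - Y (p 4) - Y (p 5)" for x
    unfolding lower_def zig_def w by (simp add: corners algebra_simps)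
  ultimately have "(upper 0 + upper (0 + 1 / 2)) - (lower 0 + lower (0 + 1 / 2)) = 2 * height"
    by (simp only: height_def) simp
  then have "ori p * (2 * height) = ori p * ((upper 0 + upper (0 + 1 / 2)) - (lower 0 + lower (0 + 1 / 2)))" by (simp only:)
  also have "\<dots> = (ori p * upper 0 + ori p * upper (0 + 1 / 2)) - (ori p * lower 0 + ori p * lower (0 + 1 / 2))"
    by (simp only: right_diff_distrib distrib_left)
  finally have "ori p * (2 * height) = (ori p * upper 0 + ori p * upper (0 + 1 / 2)) - (ori p * lower 0 + ori p * lower (0 + 1 / 2))" .
  then show ?thesis using lower_less_upper[of 0] lower_less_upper[of "0 + 1 / 2"] by simp
qed

end

lemma int_mono_step:
  fixes f :: "int \<Rightarrow> real"
  assumes "\<And>n. f n < f (n + 1)" "m \<le> n"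
  shows "f m \<le> f n"
  using assms(2)
proof (induction n rule: int_ge_induct)
  case (step i)
  then show ?case using assms(1)[of i] by simp
qed simp

context strip_hexagon
begin

lemma open_subset_graph:
  assumes "open U" "\<And>z. z \<in> U \<Longrightarrow> Y z = h (X z)"
  shows "U = {}"
proof (rule ccontr)
  assume "U \<noteq> {}"
  then obtain z where z: "z \<in> U" by blast
  define V where "V = (\<lambda>y. pt (X z) y) -` U"
  have "open V" unfolding V_def by (rule open_vimage[OF assms(1) continuous_on_pt])
  moreover have "Y z \<in> V" using z by (simp add: V_def)
  moreover have "V \<subseteq> {h (X z)}" using assms(2) by (fastforce simp: V_def)
  ultimately have "open {h (X z)}" by (metis empty_iff insert_absorb subset_singleton_iff)
  then show False using not_open_singleton by blast
qed

text \<open>The factor \<open>ori p\<close> makes the levels increase with \<open>n\<close> for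
  either orientation of \<open>P\<close>.\<close>

definition level :: "(int \<Rightarrow> bool) \<Rightarrow> (int \<Rightarrow> complex) \<Rightarrow> int \<Rightarrow> real \<Rightarrow> real" where
  "level d a n x = ori p * Lower (d n) (a n) x"

lemma stacked_Upper: "stacked d a \<Longrightarrow> Upper (d n) (a n) x = Lower (d (n + 1)) (a (n + 1)) x"
  by (rule Upper_eq_Lower) (auto simp: stacked_def)

lemma level_less:
  assumes "stacked d a"
  shows "level d a n x < level d a (n + 1) x"
  using Lower_less_Upper[of "d n" "a n" x] stacked_Upper[OF assms] by (simp add: level_def)

lemma level_mono: "stacked d a \<Longrightarrow> m \<le> n \<Longrightarrow> level d a m x \<le> level d a n x"
  by (rule int_mono_step[of "\<lambda>n. level d a n x"]) (rule level_less)

lemma covered_stack: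
  assumes "stacked d a"
  shows "covered (move (place p (d n) (a n)) (strip p)) =
     {z. level d a n (X z) \<le> ori p * Y z \<and> ori p * Y z \<le> level d a (n + 1) (X z)}"
  unfolding covered_place level_def stacked_Upper[OF assms] ..

lemma stacked_height:
  assumes "stacked d a"
  shows "Y (a n) = Y (a 0) + of_int n * height"
proof -
  have step: "Y (a (n + 1)) = Y (a n) + height" for n
  proof -
    have "a (n + 1) = a n + lin (d n) (p 3) + lin (d (n + 1)) (p 4 - p 1 - p 2)"
      using assms by (simp add: stacked_def)
    then show ?thesis by (simp add: height_def corners)
  qed
  show ?thesis
  proof (induction n rule: int_induct[of _ 0])
    case (step1 i)
    then show ?case using step[of i] by (simp add: algebra_simps)
  next
    case (step2 i)
    then show ?case using step[of "i - 1"] by (simp add: algebra_simps)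
  qed simp
qed

text \<open>Up to a bounded term, the wave, the levels form an arithmetic progression with step
  \<open>ori p * height\<close>.\<close>

lemma stack_levels:
  assumes "stacked d a"
  shows "\<exists>n. level d a n x \<le> y \<and> y < level d a (n + 1) x"
proof (rule int_bracket)
  show "0 < ori p * height" by (rule height_pos)
  fix n
  define B where "B = \<bar>Y (a 0)\<bar> + \<bar>Y (p 1 + p 2) - Y (p 5)\<bar> + \<bar>Y (p 4) - Y (p 5)\<bar>"
  define w where "w = wave (x - X (a n) - sg (d n) * (X (p 1 + p 2) - X (p 5) - 1))"
  have "level d a n x - of_int n * (ori p * height) = ori p * (Y (a 0) + (Y (p 1 + p 2) - Y (p 5)) - (Y (p 4) - Y (p 5)) * w)"
    unfolding level_def Lower_wave w_def[symmetric] stacked_height[OF assms, of n] by (simp only: algebra_simps)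
  also have "\<bar>\<dots>\<bar> = \<bar>Y (a 0) + (Y (p 1 + p 2) - Y (p 5)) - (Y (p 4) - Y (p 5)) * w\<bar>"
    using ori_cases[of p] by (auto simp: abs_mult)
  also have "\<dots> \<le> \<bar>Y (a 0)\<bar> + \<bar>Y (p 1 + p 2) - Y (p 5)\<bar> + \<bar>(Y (p 4) - Y (p 5)) * w\<bar>" by linarith
  also have "\<dots> \<le> B"
    using wave_bounds unfolding B_def w_def by (simp add: abs_mult mult_left_le)
  finally show "\<bar>level d a n x - of_int n * (ori p * height)\<bar> \<le> \<bar>Y (a 0)\<bar> + \<bar>Y (p 1 + p 2) - Y (p 5)\<bar> + \<bar>Y (p 4) - Y (p 5)\<bar>"
    unfolding B_def .
qed

lemma covered_whole_stack: "stacked d a \<Longrightarrow> covered (stack d a) = UNIV"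
proof -
  assume s: "stacked d a"
  have "covered (stack d a) = (\<Union>n. covered (move (place p (d n) (a n)) (strip p)))"
    by (auto simp: covered_def stack_def)
  also have "\<dots> = UNIV"
    unfolding covered_stack[OF s] using stack_levels[OF s] by (auto simp: set_eq_iff) (meson less_imp_le)
  finally show ?thesis .
qed

lemma stack_gluing:
  assumes "stacked d a"
  shows "strip_gluing p d (stack d a)"
  unfolding strip_gluing_def Let_def
proof (intro exI[of _ a] conjI allI impI)
  show "stack d a = (\<Union>n. move (place p (d n) (a n)) (strip p))" by (simp add: stack_def)
  show "place p (d n) (a n) ` line1 p = place p (d (n + 1)) (a (n + 1)) ` line2 p" for n
    unfolding place_line1 place_line2 stacked_Upper[OF assms] ..
  show "covered (move (place p (d n) (a n)) (strip p)) \<inter> covered (move (place p (d (n + 1)) (a (n + 1))) (strip p)) =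
     place p (d n) (a n) ` line1 p" for n
    unfolding covered_stack[OF assms] place_line1 stacked_Upper[OF assms]
    using level_less[OF assms, of n] level_less[OF assms, of "n + 1"] ori_cases[of p]
    by (auto simp: level_def less_imp_le)
  show "covered (move (place p (d n) (a n)) (strip p)) \<inter> covered (move (place p (d m) (a m)) (strip p)) = {}"
    if "n + 1 < m" for m n
  proof -
    have "level d a (n + 1) x < level d a m x" for x
      using level_less[OF assms, of "n + 1" x] level_mono[OF assms, of "n + 1 + 1" m x] that by simp
    then show ?thesis unfolding covered_stack[OF assms] by (auto simp: not_le[symmetric]) (meson le_less_trans less_le_not_le order_trans)
  qed
qed

section \<open>The stack as a tiling\<close>

definition gtile :: "(int \<Rightarrow> bool) \<Rightarrow> (int \<Rightarrow> complex) \<Rightarrow> int \<Rightarrow> bool \<Rightarrow> int \<Rightarrow> hexagon" where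
  "gtile d a n s k = place p (d n) (a n) \<circ> tile s k"

lemma in_stack: "q \<in> stack d a \<longleftrightarrow> (\<exists>n s k. q = gtile d a n s k)"
proof
  show "q \<in> stack d a \<Longrightarrow> \<exists>n s k. q = gtile d a n s k"
    unfolding stack_def move_def gtile_def by (auto simp: in_strip) (intro exI, rule refl)
  show "\<exists>n s k. q = gtile d a n s k \<Longrightarrow> q \<in> stack d a"
    unfolding stack_def move_def gtile_def using tile_in_strip by blast
qed

lemma gtile_congruent: "congruent_copy p (gtile d a n s k)"
proof -
  obtain f where f: "plane_isometry f" "tile s k = f \<circ> p"
    using tile_congruent[of s k] unfolding congruent_copy_def by blast
  have "plane_isometry (place p (d n) (a n) \<circ> f)"
    using f(1) place_isometry[of "d n" "a n"] by (simp add: plane_isometry_def)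
  then show ?thesis unfolding congruent_copy_def gtile_def using f(2) by (metis comp_assoc)
qed

lemma gtile_simple: "simple_hexagon (gtile d a n s k)"
  using congruent_copy_facts(1)[OF gtile_congruent simple] .

lemma gtile_ori: "ori (gtile d a n s k) = sg (d n) * ori p"
  by (simp add: gtile_def ori_place tile_simple tile_ori)

text \<open>Interiors of tiles from different strips can meet only in a boundary graph, and a graph
  has no nonempty open subset.\<close>

lemma gtiles_disjoint:
  assumes s: "stacked d a" and ne: "(n, s, k) \<noteq> (n', s', k')"
  shows "body (gtile d a n s k) \<inter> body (gtile d a n' s' k') = {}"
proof -
  have c: "body (gtile d a n s k) \<subseteq> {z. level d a n (X z) \<le> ori p * Y z \<and> ori p * Y z \<le> level d a (n + 1) (X z)}" for n s k
  proof -
    have "gtile d a n s k \<in> move (place p (d n) (a n)) (strip p)"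
      by (auto simp: gtile_def move_def tile_in_strip)
    then have "body (gtile d a n s k) \<subseteq> covered (move (place p (d n) (a n)) (strip p))"
      by (auto simp: covered_def region_eq)
    then show ?thesis unfolding covered_stack[OF s] .
  qed
  have lt: "body (gtile d a n s k) \<inter> body (gtile d a m s' k') = {}" if "n < m" for n m s k s' k'
  proof (rule open_subset_graph[of _ "\<lambda>x. Lower (d m) (a m) x"])
    show "open (body (gtile d a n s k) \<inter> body (gtile d a m s' k'))"
      using simple_hexagon_topology(1)[OF gtile_simple] by blast
    fix z assume z: "z \<in> body (gtile d a n s k) \<inter> body (gtile d a m s' k')"
    have "level d a (n + 1) (X z) \<le> level d a m (X z)" using level_mono[OF s] that by simp
    then have "ori p * Y z = level d a m (X z)" using z c[of n s k] c[of m s' k'] by force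
    then show "Y z = Lower (d m) (a m) (X z)" using ori_cases[of p] by (auto simp: level_def)
  qed
  consider "n < n'" | "n' < n" | "n = n'" by linarith
  then show ?thesis
  proof cases
    case 3
    then have "body (tile s k) \<inter> body (tile s' k') = {}" using ne by (intro tiles_disjoint) auto
    then show ?thesis unfolding gtile_def 3 body_place[OF tile_simple]
      using image_Int[OF inj_place] by (metis image_empty)
  qed (use lt in blast)+
qed

lemma tiling_stack:
  assumes "stacked d a"
  shows "tiling_by p (stack d a)"
  unfolding tiling_by_def
proof (intro conjI ballI impI)
  show "congruent_copy p q" if "q \<in> stack d a" for q using that gtile_congruent by (auto simp: in_stack)
  show "covered (stack d a) = UNIV" by (rule covered_whole_stack[OF assms])
  fix q q' assume q: "q \<in> stack d a" "q' \<in> stack d a" "q \<noteq> q'"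
  then obtain n s k n' s' k' where e: "q = gtile d a n s k" "q' = gtile d a n' s' k'" unfolding in_stack by blast
  with q(3) have "(n, s, k) \<noteq> (n', s', k')" by auto
  then show "interior (region q) \<inter> interior (region q') = {}"
    unfolding e simple_hexagon_topology(9)[OF gtile_simple] by (rule gtiles_disjoint[OF assms])
qed

end

section \<open>Three tiles around a vertex, and the degree of the stack\<close>

definition star :: "real \<Rightarrow> hexagon \<Rightarrow> 6 \<Rightarrow> hexagon \<Rightarrow> 6 \<Rightarrow> hexagon \<Rightarrow> 6 \<Rightarrow> bool" where
  "star r A i B j C k \<longleftrightarrow> (r = 1 \<or> r = -1) \<and> A i = B j \<and> B j = C k \<and>
     i \<noteq> j \<and> j \<noteq> k \<and> k \<noteq> i \<and>
     fwd r A i = fwd (- r) B j \<and> fwd r B j = fwd (- r) C k \<and> fwd r C k = fwd (- r) A i"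

lemma star_rotate: "star r A i B j C k \<Longrightarrow> star r B j C k A i"
  by (auto simp: star_def)

lemma star_cancels:
  assumes "star r A i B j C k" "simple_hexagon A" "simple_hexagon B" "simple_hexagon C"
  shows "cancels [(A, 1), (B, 1), (C, 1)] (A i)"
  using assms by (intro cancels_three[of A B C r i j k]) (auto simp: star_def)

lemma side_eqI: "{q i, q (i + 1)} = {q' j, q' (j + 1)} \<Longrightarrow> side q i = side q' j"
  by (auto simp: side_def doubleton_eq_iff closed_segment_commute)

lemma fwd_side:
  assumes "A i = B j" "fwd r A i = fwd r' B j" "fwd r A i = A (i + 1)"
  shows "\<exists>l. side A i = side B l"
proof (cases "ori B = r'")
  case True
  then show ?thesis using assms by (intro exI[of _ j] side_eqI) (auto simp: fwd_def)
next
  case False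
  then show ?thesis using assms by (intro exI[of _ "j - 1"] side_eqI) (auto simp: fwd_def)
qed

lemma star_side:
  assumes "star r A i B j C k"
  shows "(\<exists>l. side A i = side B l) \<or> (\<exists>l. side A i = side C l)"
proof -
  have r: "r = 1 \<or> r = -1" and B: "A i = B j" "fwd r A i = fwd (- r) B j"
    and C: "A i = C k" "fwd (- r) A i = fwd r C k"
    using assms unfolding star_def by metis+
  have "ori A = r \<or> ori A = - r" using r ori_cases[of A] by auto
  then show ?thesis
  proof
    assume "ori A = r"
    then have "fwd r A i = A (i + 1)" by (simp add: fwd_def)
    from fwd_side[OF B this] show ?thesis by blast
  next
    assume "ori A = - r"
    then have "fwd (- r) A i = A (i + 1)" by (simp add: fwd_def)
    from fwd_side[OF C this] show ?thesis by blast
  qed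
qed

text \<open>Common ground of the two directions of the proof: the stacks and the given tilings are
  both instances.\<close>

locale disjoint_hexagons =
  fixes T :: "hexagon set"
  assumes simple_T: "\<And>q. q \<in> T \<Longrightarrow> simple_hexagon q"
    and disjoint_T: "\<And>q q'. q \<in> T \<Longrightarrow> q' \<in> T \<Longrightarrow> q \<noteq> q' \<Longrightarrow> body q \<inter> body q' = {}"
begin

lemma inj_T: "q \<in> T \<Longrightarrow> q i = q j \<longleftrightarrow> i = j"
  by (rule inj_eq) (rule simple_hexagon_sides(1)[OF simple_T])

lemma corner_region: "q i \<in> region q"
  using corner_in_bdry by (auto simp: region_eq)

lemma only_tiles:
  assumes "cancels Q x" "\<And>q. q \<in> set Q \<Longrightarrow> snd q = 1 \<and> fst q \<in> T" "q \<in> set Q" "x \<in> region (fst q)"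
    and "D \<in> T" "x \<in> region D"
  shows "D \<in> fst ` set Q"
proof -
  have "\<exists>q\<in>set Q. body D \<inter> body (fst q) \<noteq> {}"
    by (rule cancels_overlap[OF assms(1) _ assms(3,4) _ assms(6)]) (use assms simple_T in auto)
  then show ?thesis using disjoint_T assms(2,5) by (metis image_eqI)
qed

end

locale starred = disjoint_hexagons +
  assumes star_T: "\<And>q i. q \<in> T \<Longrightarrow> \<exists>r B j C k. B \<in> T \<and> C \<in> T \<and> star r q i B j C k"
begin

text \<open>This is why \<open>star\<close> demands different labels: equal tiles would have the
  same point as two different corners.\<close>

lemma distinct_star:
  assumes "star r A i B j C k" "A \<in> T" "B \<in> T" "C \<in> T"
  shows "A \<noteq> B" "B \<noteq> C" "C \<noteq> A"
  using assms(1) inj_T[OF assms(2)] inj_T[OF assms(3)] inj_T[OF assms(4)] unfolding star_def by metis+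

lemma degree_star:
  assumes "q \<in> T"
  shows "degree_at T (q i) = 3"
proof -
  obtain r B j C k where s: "B \<in> T" "C \<in> T" "star r q i B j C k" using star_T[OF assms] by blast
  have c: "cancels [(q, 1), (B, 1), (C, 1)] (q i)"
    using star_cancels[OF s(3)] simple_T assms s by blast
  have "{D \<in> T. q i \<in> region D} = {q, B, C}"
  proof
    show "{q, B, C} \<subseteq> {D \<in> T. q i \<in> region D}"
      using assms s corner_region[of q i] corner_region[of B j] corner_region[of C k] by (auto simp: star_def)
    show "{D \<in> T. q i \<in> region D} \<subseteq> {q, B, C}"
          proof
      fix D assume "D \<in> {D \<in> T. q i \<in> region D}"
      then have "D \<in> fst ` set [(q, 1::real), (B, 1), (C, 1)]"
        using assms s(1,2) corner_region[of q i] by (intro only_tiles[OF c, of "(q, 1)"]) auto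
      then show "D \<in> {q, B, C}" by auto
    qed
  qed
  moreover have "card {q, B, C} = 3" using distinct_star[OF s(3) assms s(1,2)] by auto
  ultimately show ?thesis by (simp add: degree_at_def)
qed

lemma side_neighbour:
  assumes "q \<in> T"
  obtains B j where "B \<in> T" "B \<noteq> q" "side q i = side B j"
proof -
  obtain r B j C k where s: "B \<in> T" "C \<in> T" "star r q i B j C k" using star_T[OF assms] by blast
  show thesis using star_side[OF s(3)] distinct_star[OF s(3) assms s(1,2)] s(1,2) that[of B] that[of C] by auto
qed

text \<open>At a point of a side that is no corner, the tile and its neighbour across that side
  already fill a neighbourhood. Any tile through the point is one of the two, and its side there is
  the common one.\<close>

lemma side_to_side_T: "side_to_side T"
  unfolding side_to_side_def
proof (intro ballI allI)
  fix q q' i j assume T: "q \<in> T" "q' \<in> T"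
  have key: "side q i = side q' j" if T: "q \<in> T" "q' \<in> T" and x: "x \<in> side q i" "x \<in> side q' j" "x \<notin> range q" for q q' i j x
  proof -
    obtain B l where B: "B \<in> T" "B \<noteq> q" "side q i = side B l" using side_neighbour[OF T(1)] by metis
    have c: "cancels [(q, 1), (B, 1)] x"
      by (rule common_side_orientation(2)[OF simple_T simple_T B(3) disjoint_T]) (use T B x in auto)
    have "q' = q \<or> q' = B"
    proof -
      have "x \<in> region q" "x \<in> region q'" using x side_subset_bdry by (auto simp: region_eq)
      then have "q' \<in> fst ` set [(q, 1::real), (B, 1)]"
        using T B(1) by (intro only_tiles[OF c, of "(q, 1)"]) auto
      then show ?thesis by auto
    qed
    moreover have "x \<noteq> q i" "x \<noteq> q (i + 1)" using x(3) by auto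
    moreover from this have "x \<noteq> B l" "x \<noteq> B (l + 1)" using side_eq_cases[OF B(3)] by auto
    ultimately show ?thesis
      using side_unique[OF simple_T, of q x j i] side_unique[OF simple_T, of B x j l] T B x by auto
  qed
  show "side q i = side q' j \<or> side q i \<inter> side q' j \<subseteq> range q \<inter> range q'"
  proof (rule disjCI)
    assume n: "\<not> side q i \<inter> side q' j \<subseteq> range q \<inter> range q'"
    then obtain x where x: "x \<in> side q i" "x \<in> side q' j" "x \<notin> range q \<or> x \<notin> range q'" by blast
    then show "side q i = side q' j" using key[of q q' x i j] key[of q' q x j i] T by metis
  qed
qed

end

context strip_hexagon
begin

lemma XY_gtile:
  "X (gtile d a n s k i) = X (a n) + sg (d n) * ((if s then X (p i) else X (p 1) + X (p 2) - X (p i)) + of_int k)"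
  "Y (gtile d a n s k i) = Y (a n) + (if s then Y (p i) else Y (p 1) + Y (p 2) - Y (p i))"
  by (simp_all add: gtile_def tile_def)

lemma gtile_eqI:
  "X (gtile d a n s k i) = X (gtile d' a' n' s' k' i') \<Longrightarrow> Y (gtile d a n s k i) = Y (gtile d' a' n' s' k' i') \<Longrightarrow>
   gtile d a n s k i = gtile d' a' n' s' k' i'"
  by (rule XY_eqI)

lemma fwd_gtile:
  "fwd (sg (d n) * ori p) (gtile d a n s k) i = gtile d a n s k (i + 1)"
  "fwd (- (sg (d n) * ori p)) (gtile d a n s k) i = gtile d a n s k (i - 1)"
  using ori_cases[of p] by (auto simp: fwd_def gtile_ori sg_def)

text \<open>These stars serve the corners 0, 1, 2 of all tiles. The corners 3, 4, 5 lie on the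
  boundary lines and are served by \<open>star_upper\<close> and \<open>star_lower\<close>.\<close>

lemma star_inner:
  "star (sg (d n) * ori p) (gtile d a n True k) 1 (gtile d a n False k) 2 (gtile d a n False (k - 1)) 0"
  "star (sg (d n) * ori p) (gtile d a n False k) 1 (gtile d a n True k) 2 (gtile d a n True (k + 1)) 0"
  unfolding star_def fwd_gtile
  by (intro conjI gtile_eqI; use ori_cases[of p] in \<open>auto simp: XY_gtile corners sg_def algebra_simps\<close>)+

lemma XY_stacked:
  assumes "stacked d a"
  shows "X (a (n + 1)) = X (a n) + sg (d n) * (X (p 5) + 1) + sg (d (n + 1)) * (X (p 5) + 1 / 2 - X (p 1) - X (p 2))"
    "Y (a (n + 1)) = Y (a n) + Y (p 5) + Y (p 4) - Y (p 1) - Y (p 2)"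
proof -
  have "a (n + 1) = a n + lin (d n) (p 3) + lin (d (n + 1)) (p 4 - p 1 - p 2)"
    using assms by (simp add: stacked_def)
  then show "X (a (n + 1)) = X (a n) + sg (d n) * (X (p 5) + 1) + sg (d (n + 1)) * (X (p 5) + 1 / 2 - X (p 1) - X (p 2))"
    "Y (a (n + 1)) = Y (a n) + Y (p 5) + Y (p 4) - Y (p 1) - Y (p 2)"
    by (simp_all add: corners apex)
qed

lemma fwd_gtile_other:
  assumes "d m = (\<not> d n)"
  shows "fwd (sg (d n) * ori p) (gtile d a m s k) i = gtile d a m s k (i - 1)"
    "fwd (- (sg (d n) * ori p)) (gtile d a m s k) i = gtile d a m s k (i + 1)"
  using assms ori_cases[of p] by (auto simp: fwd_def gtile_ori sg_def)

text \<open>If the directions differ, the indices of the two strips run against each other;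
  \<open>stacked\<close> aligns the tiles of index 0, hence \<open>- k\<close>.\<close>

lemma star_upper:
  assumes "stacked d a"
  shows "star (sg (d n) * ori p) (gtile d a n True k) 3
     (gtile d a (n + 1) False (if d n = d (n + 1) then k else - k)) 4 (gtile d a n True (k + 1)) 5"
proof (cases "d n = d (n + 1)")
  case True
  note f = fwd_gtile[of d "n + 1" a, folded True]
  show ?thesis unfolding star_def fwd_gtile f
    by (intro conjI gtile_eqI)
      (use XY_stacked[OF assms, of n] ori_cases[of p] True in \<open>auto simp: XY_gtile corners apex sg_def algebra_simps\<close>)
next
  case False
  then have e: "d (n + 1) = (\<not> d n)" by auto
  note f = fwd_gtile_other[OF e]
  show ?thesis unfolding star_def fwd_gtile f
    by (intro conjI gtile_eqI)
      (use XY_stacked[OF assms, of n] ori_cases[of p] e in \<open>auto simp: XY_gtile corners apex sg_def algebra_simps\<close>)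
qed

text \<open>Measured along strip \<open>n\<close>, corner 3 of the half-turned tile is half a period
  before its corner 4 if the directions agree and half a period after it if they differ. This
  accounts for the additional 1 in \<open>1 - k\<close>.\<close>

lemma star_lower:
  assumes "stacked d a"
  shows "star (sg (d (n + 1)) * ori p) (gtile d a (n + 1) False k) 3
     (gtile d a n True (if d n = d (n + 1) then k else 1 - k)) 4 (gtile d a (n + 1) False (k - 1)) 5"
proof (cases "d n = d (n + 1)")
  case True
  note f = fwd_gtile[of d "n" a, unfolded True]
  show ?thesis unfolding star_def fwd_gtile f
    by (intro conjI gtile_eqI)
      (use XY_stacked[OF assms, of n] ori_cases[of p] True in \<open>auto simp: XY_gtile corners apex sg_def algebra_simps\<close>)
next
  case False
  then have e: "d n = (\<not> d (n + 1))" by auto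
  note f = fwd_gtile_other[of d "n" "n + 1" a, OF e]
  show ?thesis unfolding star_def fwd_gtile f
    by (intro conjI gtile_eqI)
      (use XY_stacked[OF assms, of n] ori_cases[of p] e in \<open>auto simp: XY_gtile corners apex sg_def algebra_simps\<close>)
qed

lemma gtile_in_stack: "gtile d a n s k \<in> stack d a"
  by (auto simp: in_stack)

lemma starred_stack:
  assumes "stacked d a"
  shows "starred (stack d a)"
proof unfold_locales
  show "simple_hexagon q" if "q \<in> stack d a" for q using that gtile_simple by (auto simp: in_stack)
  show "body q \<inter> body q' = {}" if q: "q \<in> stack d a" "q' \<in> stack d a" "q \<noteq> q'" for q q'
  proof -
    obtain n s k n' s' k' where e: "q = gtile d a n s k" "q' = gtile d a n' s' k'" using q unfolding in_stack by blast
    with q(3) have "(n, s, k) \<noteq> (n', s', k')" by auto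
    then show ?thesis unfolding e by (rule gtiles_disjoint[OF assms])
  qed
  let ?S = "\<lambda>q i. \<exists>r B j C k. B \<in> stack d a \<and> C \<in> stack d a \<and> star r q i B j C k"
  \<comment> \<open>Each star serves all three of its corners; the cases below merely choose the
    index for which a given corner occurs in it.\<close>
  have rot: "?S A i \<and> ?S B j \<and> ?S C k" if "star r A i B j C k" "A \<in> stack d a" "B \<in> stack d a" "C \<in> stack d a" for r A i B j C k
    using star_rotate[OF that(1)] star_rotate[OF star_rotate[OF that(1)]] that by blast
  note I1 = rot[OF star_inner(1) gtile_in_stack gtile_in_stack gtile_in_stack]
  note I2 = rot[OF star_inner(2) gtile_in_stack gtile_in_stack gtile_in_stack]
  note U = rot[OF star_upper[OF assms] gtile_in_stack gtile_in_stack gtile_in_stack]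
  note L = rot[OF star_lower[OF assms] gtile_in_stack gtile_in_stack gtile_in_stack]
  have T: "?S (gtile d a n True k) i" for n k i
  proof (cases i rule: six_cases)
    case 1 then show ?thesis using I2[of n "k - 1"] by simp
  next
    case 2 then show ?thesis using I1[of n k] by simp
  next
    case 3 then show ?thesis using I2[of n k] by simp
  next
    case 4 then show ?thesis using U[of n k] by simp
  next
    case 5 then show ?thesis
      using L[of n "if d n = d (n + 1) then k else 1 - k"] by (cases "d n = d (n + 1)") simp_all
  next
    case 6 then show ?thesis using U[of n "k - 1"] by simp
  qed
  have F: "?S (gtile d a n False k) i" for n k i
  proof (cases i rule: six_cases)
    case 1 then show ?thesis using I1[of n "k + 1"] by simp
  next
    case 2 then show ?thesis using I2[of n k] by simp
  next
    case 3 then show ?thesis using I1[of n k] by simp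
  next
    case 4 then show ?thesis using L[of "n - 1" k] by simp
  next
    case 5 then show ?thesis
      using U[of "n - 1" "if d (n - 1) = d n then k else - k"] by (cases "d (n - 1) = d n") simp_all
  next
    case 6 then show ?thesis using L[of "n - 1" "k + 1"] by simp
  qed
  show "?S q i" if "q \<in> stack d a" for q i
    using that T F unfolding in_stack by (metis (full_types))
qed

lemma degree3_stack:
  assumes "stacked d a"
  shows "degree3_tiling p (stack d a)"
proof -
  interpret starred "stack d a" by (rule starred_stack[OF assms])
  show ?thesis
    unfolding degree3_tiling_def using tiling_stack[OF assms] side_to_side_T degree_star by blast
qed

end

section \<open>Tilings with all degrees 3\<close>

lemma mv_ball: "norm \<alpha> = 1 \<Longrightarrow> mv s \<alpha> \<beta> ` ball c r = ball (mv s \<alpha> \<beta> c) r"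
proof -
  assume a: "norm \<alpha> = 1"
  then have "surj (mv s \<alpha> \<beta>)" by (intro surj_mv) auto
  then have "w \<in> mv s \<alpha> \<beta> ` ball c r" if "w \<in> ball (mv s \<alpha> \<beta> c) r" for w
  proof -
    obtain u where "w = mv s \<alpha> \<beta> u" using surjD[OF \<open>surj (mv s \<alpha> \<beta>)\<close>] by blast
    then show ?thesis using that dist_mv[OF a] by auto
  qed
  then show ?thesis using dist_mv[OF a] by auto
qed

lemma body_region_overlap:
  assumes "simple_hexagon q" "simple_hexagon q'" "x \<in> body q" "x \<in> region q'"
  shows "body q \<inter> body q' \<noteq> {}"
proof -
  have "x \<in> closure (body q')" using assms(4) simple_hexagon_topology(7)[OF assms(2)] by simp
  then show ?thesis
    using assms(3) open_Int_closure_eq_empty[OF simple_hexagon_topology(1)[OF assms(1)], of "body q'"] by blast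
qed

section \<open>Neighbours and vertices in a given tiling\<close>

locale degree3 =
  fixes p :: hexagon and T :: "hexagon set"
  assumes simple_p: "simple_hexagon p" and tiling: "degree3_tiling p T"
begin

lemma congruent_T: "q \<in> T \<Longrightarrow> congruent_copy p q"
  using tiling by (simp add: degree3_tiling_def tiling_by_def)

sublocale disjoint_hexagons T
proof
  show simple: "simple_hexagon q" if "q \<in> T" for q
    using congruent_copy_facts(1)[OF congruent_T[OF that] simple_p] .
  show "body q \<inter> body q' = {}" if "q \<in> T" "q' \<in> T" "q \<noteq> q'" for q q'
    using tiling that simple_hexagon_topology(9)[OF simple] by (simp add: degree3_tiling_def tiling_by_def)
qed

lemma cover_T: obtains q where "q \<in> T" "x \<in> region q"
proof -
  have "x \<in> covered T" using tiling by (simp add: degree3_tiling_def tiling_by_def)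
  then show thesis using that by (auto simp: covered_def)
qed

text \<open>All tiles contain a ball of the same radius and have bounded size. The centres of the
  balls are therefore separated, and those of tiles near \<open>x\<close> stay in a compact
  set.\<close>

lemma locally_finite: "finite {q \<in> T. region q \<inter> ball x 1 \<noteq> {}}"
proof -
  obtain c where "c \<in> body p" using simple_hexagon_topology(3)[OF simple_p] by blast
  then obtain \<rho> where \<rho>: "0 < \<rho>" "ball c \<rho> \<subseteq> body p"
    using simple_hexagon_topology(1)[OF simple_p] by (meson open_contains_ball)
  have "bounded (region p)" using simple_hexagon_topology(8)[OF simple_p] compact_imp_bounded by blast
  then obtain M where M: "region p \<subseteq> ball c M" by (meson bounded_subset_ballD)
  define F where "F = {q \<in> T. region q \<inter> ball x 1 \<noteq> {}}"
  have "\<exists>w. ball w \<rho> \<subseteq> body q \<and> region q \<subseteq> ball w M" if q: "q \<in> T" for q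
  proof -
    obtain s \<alpha> \<beta> where a: "norm \<alpha> = 1" "q = mv s \<alpha> \<beta> \<circ> p"
      using congruent_T[OF q] unfolding congruent_copy_mv by blast
    then have a0: "\<alpha> \<noteq> 0" by auto
    have "mv s \<alpha> \<beta> ` ball c \<rho> \<subseteq> body q" "region q \<subseteq> mv s \<alpha> \<beta> ` ball c M"
      unfolding a(2) body_mv(1)[OF a0 simple_p] region_mv[OF a0 simple_p] using \<rho> M by blast+
    then show ?thesis unfolding mv_ball[OF a(1)] by blast
  qed
  then obtain w where w: "\<And>q. q \<in> T \<Longrightarrow> ball (w q) \<rho> \<subseteq> body q" "\<And>q. q \<in> T \<Longrightarrow> region q \<subseteq> ball (w q) M"
    by metis
  have far: "\<rho> \<le> dist (w q) (w q')" if "q \<in> T" "q' \<in> T" "q \<noteq> q'" for q q'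
  proof (rule ccontr)
    assume "\<not> ?thesis"
    then have "w q' \<in> ball (w q) \<rho>" "w q' \<in> ball (w q') \<rho>" using \<rho> by auto
    then show False using w that disjoint_T by blast
  qed
  have inj: "inj_on w F"
    using far \<rho>(1) by (force simp: inj_on_def F_def)
  have bd: "w ` F \<subseteq> cball x (M + 1)"
  proof
    fix y assume "y \<in> w ` F"
    then obtain q where q: "q \<in> T" "y = w q" "region q \<inter> ball x 1 \<noteq> {}" by (auto simp: F_def)
    then obtain z where z: "z \<in> region q" "dist x z < 1" by auto
    then have "dist y z < M" using subsetD[OF w(2)[OF q(1)] z(1)] q(2) by simp
    then show "y \<in> cball x (M + 1)" using z dist_triangle2[of x y z] by auto
  qed
  have "finite (w ` F)"
  proof (rule ccontr)
    assume "infinite (w ` F)"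
    then obtain l where "l islimpt w ` F"
      using compact_cball[of x "M + 1"] bd unfolding compact_eq_Bolzano_Weierstrass by meson
    define S where "S = ball l (\<rho> / 2) \<inter> w ` F"
    have "infinite S"
      using \<open>l islimpt w ` F\<close> \<rho>(1) unfolding islimpt_eq_acc_point S_def by simp
    then obtain y where "y \<in> S" using infinite_imp_nonempty[of S] by auto
    have "S - {y} \<noteq> {}" using \<open>infinite S\<close> by (intro infinite_imp_nonempty infinite_remove)
    then obtain y' where "y' \<in> S" "y \<noteq> y'" by auto
    with \<open>y \<in> S\<close> have y: "y \<in> ball l (\<rho> / 2)" "y' \<in> ball l (\<rho> / 2)" "y \<in> w ` F" "y' \<in> w ` F" "y \<noteq> y'"
      by (auto simp: S_def)
    then obtain q q' where "q \<in> F" "q' \<in> F" and q: "y = w q" "y' = w q'" "q \<noteq> q'" by blast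
    then have qT: "q \<in> T" "q' \<in> T" by (auto simp: F_def)
    have "dist l y < \<rho> / 2" "dist l y' < \<rho> / 2" using y by auto
    then have "dist y y' < \<rho>" by (rule dist_triangle_half_r)
    then show False using far[OF qT q(3)] q by simp
  qed
  then show ?thesis using finite_imageD inj by (auto simp: F_def)
qed

text \<open>A boundary point is a limit of points outside \<open>q\<close>. By local finiteness the
  other tiles nearby have a closed union, which then contains the point.\<close>

lemma other_tile:
  assumes q: "q \<in> T" and x: "x \<in> bdry q"
  obtains q' where "q' \<in> T" "q' \<noteq> q" "x \<in> bdry q'"
proof -
  define U where "U = (\<Union>q'\<in>{q' \<in> T. region q' \<inter> ball x 1 \<noteq> {}} - {q}. region q')"
  have "closed U" unfolding U_def
    using locally_finite[of x] simple_hexagon_topology(8)[OF simple_T] by (intro closed_UN) (auto intro: compact_imp_closed)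
  have "x \<in> U"
  proof (rule ccontr)
    assume "x \<notin> U"
    then have "x \<in> ball x 1 \<inter> - U" "open (ball x 1 \<inter> - U)" using \<open>closed U\<close> by auto
    then have "(ball x 1 \<inter> - U) \<inter> - region q \<noteq> {}"
      using simple_hexagon_topology(10)[OF simple_T[OF q] x] open_Int_closure_eq_empty[of "ball x 1 \<inter> - U" "- region q"] by blast
    then obtain y where y: "y \<in> ball x 1" "y \<notin> U" "y \<notin> region q" by blast
    obtain q' where "q' \<in> T" "y \<in> region q'" by (rule cover_T)
    moreover from this have "q' \<noteq> q" "region q' \<inter> ball x 1 \<noteq> {}" using y by blast+
    ultimately show False using y(2) unfolding U_def by blast
  qed
  then obtain q' where q': "q' \<in> T" "q' \<noteq> q" "x \<in> region q'" by (auto simp: U_def)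
  have "x \<notin> body q'"
    using body_region_overlap[OF simple_T simple_T, of q' q x] disjoint_T[of q' q] q q' x by (auto simp: region_eq)
  then show thesis using that q' by (auto simp: region_eq)
qed

text \<open>A second tile contains the midpoint of the side. The midpoint is no corner, so
  side-to-side leaves only equality of the two sides.\<close>

lemma neighbour:
  assumes "q \<in> T"
  obtains q' j where "q' \<in> T" "q' \<noteq> q" "side q i = side q' j"
proof -
  define x where "x = midpoint (q i) (q (i + 1))"
  note m = midpoint_side[OF simple_T[OF assms], of i, folded x_def]
  have "x \<in> bdry q" using m side_subset_bdry by blast
  then obtain q' where q': "q' \<in> T" "q' \<noteq> q" "x \<in> bdry q'" using other_tile[OF assms] by metis
  then obtain j where j: "x \<in> side q' j" by (auto simp: bdry_def)
  have "side q i = side q' j \<or> side q i \<inter> side q' j \<subseteq> range q \<inter> range q'"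
    using tiling assms q' by (auto simp: degree3_tiling_def side_to_side_def)
  then show thesis using that q' j m by blast
qed

lemma ori_flip: "r = 1 \<or> r = -1 \<Longrightarrow> ori q \<noteq> r \<longleftrightarrow> ori q = - r"
  using ori_cases[of q] by auto

lemma across:
  assumes "A \<in> T" "r = 1 \<or> r = -1"
  obtains B b where "B \<in> T" "B \<noteq> A" "B b = A a" "fwd (- r) B b = fwd r A a"
proof -
  define i where "i = (if ori A = r then a else a - 1)"
  obtain B j where B: "B \<in> T" "B \<noteq> A" "side A i = side B j" using neighbour[OF assms(1)] by metis
  note o = common_side_orientation(1)[OF simple_T simple_T B(3) disjoint_T, OF assms(1) B(1) assms(1) B(1) B(2)[symmetric]]
  show thesis
    using that[OF B(1,2), of j] that[OF B(1,2), of "j + 1"] o assms(2)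
      ori_flip[OF assms(2), of A] ori_flip[OF assms(2), of B]
    by (auto simp: i_def fwd_def split: if_splits)
qed

text \<open>Two different tiles would traverse the common side in the same sense, contrary to
  \<open>common_side_orientation\<close>.\<close>

lemma across_unique:
  assumes "A \<in> T" "B \<in> T" "r = 1 \<or> r = -1" "A a = B b" "fwd r A a = fwd r B b"
  shows "A = B" "a = b"
proof -
  show "A = B"
  proof (rule ccontr)
    assume "A \<noteq> B"
    define i j where "i = (if ori A = r then a else a - 1)" and "j = (if ori B = r then b else b - 1)"
    have "side A i = side B j"
      using assms(4,5) by (intro side_eqI) (auto simp: i_def j_def fwd_def)
    note o = common_side_orientation(1)[OF simple_T simple_T this disjoint_T, OF assms(1,2,1,2) \<open>A \<noteq> B\<close>]
    note ne = corner_ne[OF simple_T]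
    show False
      using o assms(3,4,5) ne[OF assms(1), of a] ne[OF assms(1), of "a - 1"] ori_flip[OF assms(3), of A] ori_flip[OF assms(3), of B]
      unfolding i_def j_def fwd_def by (auto split: if_splits)
  qed
  then show "a = b" using simple_hexagon_sides(1)[OF simple_T[OF assms(1)]] assms(4) by (metis injD)
qed

text \<open>Crossing sides around the vertex gives \<open>A\<close>, \<open>B\<close>,
  \<open>C\<close>, \<open>D\<close> in turn. If \<open>C\<close> were \<open>A\<close>, two tiles
  would fill a neighbourhood and the degree would be at most 2. So \<open>A\<close>,
  \<open>B\<close>, \<open>C\<close> are all the tiles at the vertex, and the walk closes with
  \<open>D = A\<close>.\<close>

lemma vertex:
  assumes "A \<in> T" "r = 1 \<or> r = -1"
  obtains B b C c where "B \<in> T" "C \<in> T" "A \<noteq> B" "B \<noteq> C" "C \<noteq> A" "A a = B b" "B b = C c"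
    "fwd r A a = fwd (- r) B b" "fwd r B b = fwd (- r) C c" "fwd r C c = fwd (- r) A a"
    "{q \<in> T. A a \<in> region q} = {A, B, C}"
proof -
  have r': "- r = 1 \<or> - r = -1" using assms(2) by auto
  obtain B b where B: "B \<in> T" "B \<noteq> A" "B b = A a" "fwd (- r) B b = fwd r A a" using across[OF assms] by metis
  obtain C c where C: "C \<in> T" "C \<noteq> B" "C c = B b" "fwd (- r) C c = fwd r B b" using across[OF B(1) assms(2)] by metis
  obtain D d where D: "D \<in> T" "D \<noteq> C" "D d = C c" "fwd (- r) D d = fwd r C c" using across[OF C(1) assms(2)] by metis
  define V where "V = {q \<in> T. A a \<in> region q}"
  have card: "card V = 3" using tiling assms(1) by (simp add: V_def degree3_tiling_def degree_at_def)
  have V: "A \<in> V" "B \<in> V" "C \<in> V" "D \<in> V"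
    using assms(1) B C D corner_region[of A a] corner_region[of B b] corner_region[of C c] corner_region[of D d]
    by (auto simp: V_def)
  have "C \<noteq> A"
  proof
    assume CA: "C = A"
    then have "c = a" using simple_hexagon_sides(1)[OF simple_T[OF assms(1)]] C(3) B(3) by (metis injD)
    have "cancels [(A, 1), (B, 1)] (A a)"
      by (rule cancels_two[OF simple_T simple_T assms(2)]) (use B C CA \<open>c = a\<close> assms(1) in auto)
    note only = only_tiles[OF this, of "(A, 1)"]
    have "V \<subseteq> {A, B}"
    proof
      fix q assume "q \<in> V"
      then have "q \<in> fst ` set [(A, 1::real), (B, 1)]"
        using assms(1) B(1) corner_region[of A a] by (intro only) (auto simp: V_def)
      then show "q \<in> {A, B}" by auto
    qed
    then have "card V \<le> card {A, B}" by (intro card_mono) auto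
    also have "\<dots> \<le> 2" by (simp add: card_insert_if)
    finally show False using card by simp
  qed
  then have "card {A, B, C} = 3" using B C by simp
  moreover have "finite V" using card by (metis card.infinite zero_neq_numeral)
  ultimately have VE: "V = {A, B, C}" using V card card_subset_eq[of V "{A, B, C}"] by auto
  have "D \<noteq> B"
  proof
    assume DB: "D = B"
    then have "d = b" using simple_hexagon_sides(1)[OF simple_T[OF B(1)]] C(3) D(3) by (metis injD)
    then have "fwd r C c = fwd r A a" using B D DB by simp
    then have "C = A" using across_unique(1)[OF C(1) assms(1,2)] B C by metis
    then show False using \<open>C \<noteq> A\<close> by blast
  qed
  then have DA: "D = A" using V VE D by blast
  then have "d = a" using simple_hexagon_sides(1)[OF simple_T[OF assms(1)]] C(3) B(3) D(3) by (metis injD)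
  then show thesis using that[OF B(1) C(1), of b c] B C D DA \<open>C \<noteq> A\<close> VE by (auto simp: V_def)
qed

end

section \<open>Reconstruction of the strips\<close>

lemma int_chain:
  assumes "Q x" "\<And>x. Q x \<Longrightarrow> \<exists>y. Q y \<and> R x y" "\<And>x. Q x \<Longrightarrow> \<exists>y. Q y \<and> R y x"
  obtains f :: "int \<Rightarrow> 'a" where "\<And>n. Q (f n)" "\<And>n. R (f n) (f (n + 1))"
proof -
  obtain up where up: "\<And>x. Q x \<Longrightarrow> Q (up x) \<and> R x (up x)" using assms(2) by metis
  obtain dn where dn: "\<And>x. Q x \<Longrightarrow> Q (dn x) \<and> R (dn x) x" using assms(3) by metis
  have u: "Q ((up ^^ k) x)" for k by (induction k) (use assms(1) up in auto)
  have d: "Q ((dn ^^ k) x)" for k by (induction k) (use assms(1) dn in auto)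
  define f where "f n = (if 0 \<le> n then (up ^^ nat n) x else (dn ^^ nat (- n)) x)" for n :: int
  have "Q (f n)" for n using u d by (simp add: f_def)
  moreover have "R (f n) (f (n + 1))" for n
  proof (cases "0 \<le> n")
    case True
    then have "nat (n + 1) = Suc (nat n)" by simp
    then show ?thesis using True up[OF u[of "nat n"]] by (simp add: f_def)
  next
    case False
    then have n: "nat (- n) = Suc (nat (- (n + 1)))" by simp
    have "f (n + 1) = (dn ^^ nat (- (n + 1))) x"
      using False by (cases "n = -1") (auto simp: f_def)
    moreover have "f n = dn ((dn ^^ nat (- (n + 1))) x)" using False by (simp add: f_def n)
    ultimately show ?thesis using dn[OF d] by simp
  qed
  ultimately show thesis using that by blast
qed

text \<open>The half turn of \<open>q\<close> about the midpoint of its side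
  \<open>i\<close>.\<close>

definition rot :: "6 \<Rightarrow> hexagon \<Rightarrow> hexagon" where
  "rot i q k = q i + q (i + 1) - q k"

lemma rot_mv: "rot i q = mv True (-1) (q i + q (i + 1)) \<circ> q"
  by (simp add: rot_def mv_def fun_eq_iff)

lemma congruent_copy_comp: "plane_isometry f \<Longrightarrow> congruent_copy p q \<Longrightarrow> congruent_copy p (f \<circ> q)"
proof -
  assume f: "plane_isometry f" and "congruent_copy p q"
  then obtain g where g: "plane_isometry g" "q = g \<circ> p" by (auto simp: congruent_copy_def)
  have "plane_isometry (f \<circ> g)" using f g by (simp add: plane_isometry_def)
  then show ?thesis unfolding congruent_copy_def using g by (metis comp_assoc)
qed

lemma rot_congruent: "congruent_copy p q \<Longrightarrow> congruent_copy p (rot i q)"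
  unfolding rot_mv by (rule congruent_copy_comp) (auto intro: plane_isometry_mv)

lemma rot_ori: "simple_hexagon q \<Longrightarrow> ori (rot i q) = ori q"
  unfolding rot_mv by (subst body_mv(2)) auto

text \<open>The index of the side joining corner \<open>b\<close> to
  \<open>fwd r q b\<close>.\<close>

definition sidx :: "real \<Rightarrow> hexagon \<Rightarrow> 6 \<Rightarrow> 6" where
  "sidx r q b = (if ori q = r then b else b - 1)"

lemma sidx_length: "side_length q (sidx r q b) = dist (q b) (fwd r q b)"
  by (auto simp: sidx_def fwd_def side_length_def dist_commute)

locale strip_tiling = strip_hexagon p + degree3 p T for p T +
  assumes length0: "\<And>j. j \<noteq> 0 \<Longrightarrow> side_length p j \<noteq> side_length p 0"
    and length1: "\<And>j. j \<noteq> 1 \<Longrightarrow> side_length p j \<noteq> side_length p 1"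
begin

lemma same_length:
  assumes "A \<in> T" "B \<in> T" "A a = B b" "fwd r A a = fwd r' B b"
  shows "side_length p (sidx r A a) = side_length p (sidx r' B b)"
  using congruent_copy_facts(2)[OF congruent_T[OF assms(1)] simple_p]
    congruent_copy_facts(2)[OF congruent_T[OF assms(2)] simple_p] sidx_length[of A r a] sidx_length[of B r' b] assms(3,4)
  by metis

lemma length_iff: "side_length p i = side_length p 0 \<longleftrightarrow> i = 0" "side_length p 0 = side_length p i \<longleftrightarrow> i = 0"
  "side_length p i = side_length p 1 \<longleftrightarrow> i = 1" "side_length p 1 = side_length p i \<longleftrightarrow> i = 1"
  using length0[of i] length1[of i] by metis+

lemma unique_T:
  assumes "q \<in> T" "congruent_copy p q'" "ori q = ori q'" "q i = q' i" "q j = q' j" "i \<noteq> j"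
  shows "q' \<in> T"
  using congruent_copy_unique[OF congruent_T[OF assms(1)] assms(2) simple_p assms(3-6)] assms(1) by simp

text \<open>
  The sides 0 and 1 have unique lengths, so the three corners meeting at a corner 1 are corners
  0, 1 and 2, and the two neighbours arise by half turns about the midpoints of these sides.
\<close>

lemma rot_T:
  assumes q: "q \<in> T"
  shows "rot 0 q \<in> T" "rot 1 q \<in> T"
proof -
  define r where "r = ori q"
  have r: "r = 1 \<or> r = -1" using ori_cases by (simp add: r_def)
  then have rr: "r \<noteq> - r" by auto
  obtain B b C c where T: "B \<in> T" "C \<in> T" and at: "q 1 = B b" "B b = C c" and
    e: "fwd r q 1 = fwd (- r) B b" "fwd r B b = fwd (- r) C c" "fwd r C c = fwd (- r) q 1"
    by (rule vertex[OF q r, of 1])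
  have ac: "C c = q 1" using at by simp
  have "side_length p (sidx r q 1) = side_length p (sidx (- r) B b)" by (rule same_length[OF q T(1) at(1) e(1)])
  moreover have "sidx r q 1 = 1" by (simp add: sidx_def r_def)
  ultimately have 1: "sidx (- r) B b = 1" by (simp add: length_iff)
  have "side_length p (sidx r C c) = side_length p (sidx (- r) q 1)" using same_length[OF T(2) q ac e(3)] .
  moreover have "sidx (- r) q 1 = 0" using rr by (simp add: sidx_def r_def)
  ultimately have 2: "sidx r C c = 0" by (simp add: length_iff)
  have 3: "side_length p (sidx r B b) = side_length p (sidx (- r) C c)" using same_length[OF T at(2) e(2)] .
  \<comment> \<open>If \<open>B\<close> were reversed, its corner here would be 1 and it would share
    its side 0 with \<open>C\<close>. But \<open>C\<close> already uses its side 0 on the other side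
    of the vertex.\<close>
  have B: "ori B = r"
  proof (rule ccontr)
    assume n: "ori B \<noteq> r"
    then have "ori B = - r" using ori_flip[OF r, of B] by blast
    then have "b = 1" using 1 by (simp add: sidx_def)
    then have "sidx r B b = 0" using n by (simp add: sidx_def)
    then have "sidx (- r) C c = 0" using 3 by (simp add: length_iff)
    moreover have "ori C = r \<or> ori C = - r" using ori_flip[OF r, of C] by blast
    ultimately show False using 2 rr by (auto simp: sidx_def split: if_splits)
  qed
  then have "b - 1 = 1" using 1 rr by (simp add: sidx_def)
  then have b: "b = 2" by (simp add: diff_eq_eq)
  have C: "ori C = r"
  proof (rule ccontr)
    assume n: "ori C \<noteq> r"
    then have "c - 1 = 0" using 2 by (simp add: sidx_def)
    then have "c = 1" by (simp add: diff_eq_eq)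
    moreover have "ori C = - r" using n ori_flip[OF r, of C] by blast
    ultimately have "sidx (- r) C c = 1" by (simp add: sidx_def)
    then have "sidx r B b = 1" using 3 by (simp add: length_iff)
    then show False using B b by (simp add: sidx_def)
  qed
  then have c: "c = 0" using 2 by (simp add: sidx_def)
  have "B 2 = q 1" "B 1 = q 2" using at e(1) B b rr by (simp_all add: fwd_def r_def[symmetric])
  then have "B 1 = rot 1 q 1" "B 2 = rot 1 q 2" by (simp_all add: rot_def)
  moreover have "ori B = ori (rot 1 q)" using B by (simp add: rot_ori[OF simple_T[OF q]] r_def)
  ultimately show "rot 1 q \<in> T"
    using unique_T[OF T(1) rot_congruent[OF congruent_T[OF q]], of 1 1 2] by simp
  have "C 0 = q 1" "C 1 = q 0" using at e(3) C c rr by (simp_all add: fwd_def r_def[symmetric])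
  then have "C 0 = rot 0 q 0" "C 1 = rot 0 q 1" by (simp_all add: rot_def)
  moreover have "ori C = ori (rot 0 q)" using C by (simp add: rot_ori[OF simple_T[OF q]] r_def)
  ultimately show "rot 0 q \<in> T"
    using unique_T[OF T(2) rot_congruent[OF congruent_T[OF q]], of 0 0 1] by simp
qed

text \<open>Two half turns compose to the translation by twice the difference of their centres, here
  the midpoints of the sides 0 and 1.\<close>

lemma shift_T:
  assumes q: "q \<in> T"
  shows "(\<lambda>k. q k + (q 2 - q 0)) \<in> T" "(\<lambda>k. q k - (q 2 - q 0)) \<in> T"
proof -
  have "rot 0 (rot 1 q) = (\<lambda>k. q k + (q 2 - q 0))" "rot 1 (rot 0 q) = (\<lambda>k. q k - (q 2 - q 0))"
    by (simp_all add: rot_def fun_eq_iff)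
  then show "(\<lambda>k. q k + (q 2 - q 0)) \<in> T" "(\<lambda>k. q k - (q 2 - q 0)) \<in> T"
    using rot_T(1)[OF rot_T(2)[OF q]] rot_T(2)[OF rot_T(1)[OF q]] by simp_all
qed

lemma parallel_T:
  assumes q: "q \<in> T"
  shows "q 3 = q 5 + (q 2 - q 0)"
proof -
  obtain s \<alpha> \<beta> where a: "q = mv s \<alpha> \<beta> \<circ> p"
    using congruent_T[OF q] unfolding congruent_copy_mv by blast
  show ?thesis unfolding a by (cases s) (simp_all add: mv_def corners algebra_simps)
qed

text \<open>
  At a corner 3, a side 2 is glued to a side 5 and the third tile contributes a corner 4; it is
  either a half turn or a glide reflection of the first tile.
\<close>

lemma upper_neighbour:
  assumes q: "q \<in> T"
  obtains D where "D \<in> T" "D 4 = q 3" "if ori D = ori q then D 3 = q 4 else D 5 = q 4"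
proof -
  define r where "r = ori q"
  have r: "r = 1 \<or> r = -1" using ori_cases by (simp add: r_def)
  then have rr: "r \<noteq> - r" "- r \<noteq> r" by auto
  have r': "- r = 1 \<or> - r = -1" using r by auto
  obtain B b C' c where T: "B \<in> T" "C' \<in> T" and ne: "q \<noteq> B" "B \<noteq> C'" "C' \<noteq> q" and at: "q 3 = B b" "B b = C' c" and
    e: "fwd r q 3 = fwd (- r) B b" "fwd r B b = fwd (- r) C' c" "fwd r C' c = fwd (- r) q 3" and
    V: "{h \<in> T. q 3 \<in> region h} = {q, B, C'}"
    by (rule vertex[OF q r, of 3])
  \<comment> \<open>This translate has its corner 5 at the vertex and shares side 2 of
    \<open>q\<close>, so it must be the third tile \<open>C'\<close>.\<close>
  define C where "C = (\<lambda>k. q k + (q 2 - q 0))"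
  have C: "C \<in> T" unfolding C_def by (rule shift_T(1)[OF q])
  have oC: "ori C = r"
  proof -
    have "C = mv True 1 (q 2 - q 0) \<circ> q" by (simp add: C_def mv_def fun_eq_iff)
    then show ?thesis using body_mv(2)[OF _ simple_T[OF q], of 1 True "q 2 - q 0"] by (simp add: r_def)
  qed
  have C5: "C 5 = q 3" "C 0 = q 2" using parallel_T[OF q] by (simp_all add: C_def)
  have C'5: "C' c = C 5" using at C5(1) by simp
  have "fwd (- r) q 3 = q 2" using rr by (simp add: fwd_def r_def[symmetric])
  moreover have "fwd r C 5 = C 0" by (simp add: fwd_def oC)
  ultimately have f: "fwd r C' c = fwd r C 5" using e(3) C5(2) by simp
  have CC: "C' = C" "c = 5"
    by (rule across_unique(1)[OF T(2) C r C'5 f]) (rule across_unique(2)[OF T(2) C r C'5 f])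
  note T = T[unfolded CC] and ne = ne[unfolded CC] and at = at[unfolded CC] and e = e[unfolded CC] and V = V[unfolded CC]
  have q4: "fwd (- r) B b = q 4" using e(1) by (simp add: fwd_def r_def)
  have C4: "fwd r B b = C 4" using e(2) oC rr by (simp add: fwd_def)
  have "side_length p (sidx r q 3) = side_length p (sidx (- r) B b)" by (rule same_length[OF q T(1) at(1) e(1)])
  moreover have "sidx r q 3 = 3" by (simp add: sidx_def r_def)
  ultimately have 1: "sidx (- r) B b \<noteq> 0" "sidx (- r) B b \<noteq> 1" by (auto simp: length_iff)
  have "side_length p (sidx r B b) = side_length p (sidx (- r) C 5)" using same_length[OF T at(2) e(2)] .
  moreover have "sidx (- r) C 5 = 4" using oC rr by (simp add: sidx_def)
  ultimately have 2: "sidx r B b \<noteq> 0" "sidx r B b \<noteq> 1" by (auto simp: length_iff)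
  \<comment> \<open>\<open>B\<close> shares its two sides at the vertex with a side 3 and a side 4,
    so neither is its side 0 or 1.\<close>
  have b: "b = 3 \<or> b = 4 \<or> b = 5"
    using 1 2 ori_flip[OF r, of B] by (cases b rule: six_cases) (auto simp: sidx_def split: if_splits)
  have fB: "{fwd r B b, fwd (- r) B b} = {B (b + 1), B (b - 1)}"
    using ori_flip[OF r, of B] rr by (auto simp: fwd_def)
  have no: "q 2 \<noteq> B (b + 1) \<and> q 2 \<noteq> B (b - 1)"
  proof -
    have "q 2 \<noteq> q 4" "q 2 \<noteq> C 4" using inj_T[OF q, of 2 4] inj_T[OF C, of 0 4] C5 by auto
    then show ?thesis using fB q4 C4 by (metis insert_iff singletonD)
  qed
  \<comment> \<open>Otherwise a translate of \<open>B\<close> by its own strip vector also has a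
    corner at the vertex. It can only be \<open>C\<close> or \<open>q\<close>, which makes
    \<open>q 2\<close> a neighbour of the corner of \<open>B\<close>; but those neighbours are
    \<open>q 4\<close> and \<open>C 4\<close>.\<close>
  have b4: "b = 4"
  proof (rule ccontr)
    assume "b \<noteq> 4"
    with b consider "b = 3" | "b = 5" by blast
    then show False
    proof cases
      case 1
      define E where "E = (\<lambda>k. B k + (B 2 - B 0))"
      have E: "E \<in> T" unfolding E_def by (rule shift_T(1)[OF T(1)])
      have E5: "E 5 = q 3" using parallel_T[OF T(1)] at 1 by (simp add: E_def)
      then have "E \<in> {q, B, C}" using V E corner_region[of E 5] by auto
      moreover have "E \<noteq> q" using E5 inj_T[OF q, of 5 3] by auto
      moreover have "E \<noteq> B" using E5 at 1 inj_T[OF T(1), of 5 3] by auto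
      ultimately have "E 0 = q 2" using C5 by auto
      then have "B 2 = q 2" by (simp add: E_def)
      then show False using no 1 by simp
    next
      case 2
      define E where "E = (\<lambda>k. B k - (B 2 - B 0))"
      have E: "E \<in> T" unfolding E_def by (rule shift_T(2)[OF T(1)])
      have E3: "E 3 = q 3" using parallel_T[OF T(1)] at 2 by (simp add: E_def)
      then have "E \<in> {q, B, C}" using V E corner_region[of E 3] by auto
      moreover have "E \<noteq> C" using E3 C5 inj_T[OF C, of 5 3] by auto
      moreover have "E \<noteq> B" using E3 at 2 inj_T[OF T(1), of 5 3] by auto
      ultimately have "E 2 = q 2" by auto
      then have "B 0 = q 2" by (simp add: E_def)
      then show False using no 2 by simp
    qed
  qed
  show thesis
  proof (rule that[OF T(1)])
    show "B 4 = q 3" using at b4 by simp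
    show "if ori B = ori q then B 3 = q 4 else B 5 = q 4"
      using q4 b4 ori_flip[OF r, of B] rr by (auto simp: fwd_def r_def[symmetric])
  qed
qed

text \<open>A single placed strip, as a constant family, so that the facts about
  \<open>gtile\<close> apply.\<close>

abbreviation gt :: "bool \<Rightarrow> complex \<Rightarrow> bool \<Rightarrow> int \<Rightarrow> hexagon" where
  "gt b a \<equiv> gtile (\<lambda>_. b) (\<lambda>_. a) 0"

lemma rot_gt: "rot 1 (gt b a s k) = gt b a (\<not> s) k" "rot 0 (gt b a s k) = gt b a (\<not> s) (if s then k - 1 else k + 1)"
  by (auto simp: fun_eq_iff rot_def XY_gtile corners algebra_simps intro!: XY_eqI)

lemma strip_T:
  assumes "gt b a s k \<in> T"
  shows "gt b a s' k' \<in> T"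
proof -
  have flip: "gt b a (\<not> s) k \<in> T" if "gt b a s k \<in> T" for s k using rot_T(2)[OF that] rot_gt by simp
  then have T: "gt b a True k \<in> T" using assms by (cases s) fastforce+
  have "gt b a True j \<in> T" for j
  proof (induction j rule: int_induct[of _ k])
    case (step1 i)
    then have "rot 0 (rot 1 (gt b a True i)) \<in> T" by (intro rot_T)
    then show ?case by (simp add: rot_gt)
  next
    case (step2 i)
    then have "rot 1 (rot 0 (gt b a True i)) \<in> T" by (intro rot_T)
    then show ?case by (simp add: rot_gt)
  qed (rule T)
  then show ?thesis using flip[of True k'] by (cases s') simp_all
qed

lemma other_ori:
  assumes "D \<in> T"
  obtains b' where "ori D = sg b' * ori p" "ori D = ori (gt b a s k) \<longleftrightarrow> b' = b"
proof -
  have "ori D = sg True * ori p \<or> ori D = sg False * ori p"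
    using ori_cases[of D] ori_cases[of p] by (auto simp: sg_def)
  then obtain b' where "ori D = sg b' * ori p" by blast
  then show thesis using that[of b'] ori_cases[of p] unfolding gtile_ori by (auto simp: sg_def split: if_splits)
qed

text \<open>The tile found at corner 3 becomes the half-turned tile of index 0 in the next strip;
  the two outcomes of \<open>upper_neighbour\<close> are the two directions
  \<open>b'\<close>.\<close>

lemma next_strip:
  assumes "gt b a True 0 \<in> T"
  shows "\<exists>b' a'. gt b' a' True 0 \<in> T \<and> a' = a + lin b (p 3) + lin b' (p 4 - p 1 - p 2)"
proof -
  obtain D where D: "D \<in> T" "D 4 = gt b a True 0 3"
    "if ori D = ori (gt b a True 0) then D 3 = gt b a True 0 4 else D 5 = gt b a True 0 4"
    using upper_neighbour[OF assms] by metis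
  obtain b' where b': "ori D = sg b' * ori p" "ori D = ori (gt b a True 0) \<longleftrightarrow> b' = b"
    using other_ori[OF D(1)] by metis
  define a' where "a' = a + lin b (p 3) + lin b' (p 4 - p 1 - p 2)"
  have 4: "D 4 = gt b' a' False 0 4"
    unfolding D(2) by (rule XY_eqI) (simp_all add: XY_gtile a'_def corners apex algebra_simps)
  have "gt b' a' False 0 \<in> T"
  proof (cases "b' = b")
    case True
    then have "D 3 = gt b a True 0 4" using D(3) b' by simp
    also have "\<dots> = gt b' a' False 0 3"
      by (rule XY_eqI) (simp_all add: XY_gtile a'_def corners apex True algebra_simps)
    finally show ?thesis using 4 b' by (intro unique_T[OF D(1), of _ 4 3] gtile_congruent) (simp_all add: gtile_ori)
  next
    case False
    then have n: "b' = (\<not> b)" by auto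
    then have "D 5 = gt b a True 0 4" using D(3) b' by simp
    also have "\<dots> = gt b' a' False 0 5"
      by (rule XY_eqI) (auto simp: XY_gtile a'_def corners apex n sg_def algebra_simps)
    finally show ?thesis using 4 b' by (intro unique_T[OF D(1), of _ 4 5] gtile_congruent) (simp_all add: gtile_ori)
  qed
  then show ?thesis using strip_T unfolding a'_def by blast
qed

text \<open>The half turn exchanges the two boundary lines, so \<open>upper_neighbour\<close>
  applied to a half-turned tile looks into the preceding strip.\<close>

lemma previous_strip:
  assumes "gt b a True 0 \<in> T"
  shows "\<exists>b' a'. gt b' a' True 0 \<in> T \<and> a = a' + lin b' (p 3) + lin b (p 4 - p 1 - p 2)"
proof -
  have F: "gt b a False 0 \<in> T" using strip_T[OF assms] .
  obtain D where D: "D \<in> T" "D 4 = gt b a False 0 3"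
    "if ori D = ori (gt b a False 0) then D 3 = gt b a False 0 4 else D 5 = gt b a False 0 4"
    using upper_neighbour[OF F] by metis
  obtain b' where b': "ori D = sg b' * ori p" "ori D = ori (gt b a False 0) \<longleftrightarrow> b' = b"
    using other_ori[OF D(1)] by metis
  define a' where "a' = a - lin b' (p 3) - lin b (p 4 - p 1 - p 2)"
  \<comment> \<open>The index that \<open>star_lower\<close> gives for \<open>k = 0\<close>.\<close>
  define j :: int where "j = (if b' = b then 0 else 1)"
  have 4: "D 4 = gt b' a' True j 4"
    unfolding D(2) by (rule XY_eqI) (auto simp: XY_gtile a'_def corners apex j_def sg_def algebra_simps)
  have "gt b' a' True j \<in> T"
  proof (cases "b' = b")
    case True
    then have "D 3 = gt b a False 0 4" using D(3) b' by simp
    also have "\<dots> = gt b' a' True j 3"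
      by (rule XY_eqI) (simp_all add: XY_gtile a'_def corners apex True j_def algebra_simps)
    finally show ?thesis using 4 b' by (intro unique_T[OF D(1), of _ 4 3] gtile_congruent) (simp_all add: gtile_ori)
  next
    case False
    then have n: "b' = (\<not> b)" by auto
    then have "D 5 = gt b a False 0 4" using D(3) b' by simp
    also have "\<dots> = gt b' a' True j 5"
      by (rule XY_eqI) (auto simp: XY_gtile a'_def corners apex n j_def sg_def algebra_simps)
    finally show ?thesis using 4 b' by (intro unique_T[OF D(1), of _ 4 5] gtile_congruent) (simp_all add: gtile_ori)
  qed
  then have "gt b' a' True 0 \<in> T" using strip_T by blast
  moreover have "a = a' + lin b' (p 3) + lin b (p 4 - p 1 - p 2)" by (simp add: a'_def)
  ultimately show ?thesis by blast
qed

lemma tiling_is_stack: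
  assumes "p \<in> T"
  obtains d a where "stacked d a" "T = stack d a"
proof -
  let ?Q = "\<lambda>(b, a). gt b a True 0 \<in> T"
  let ?R = "\<lambda>(b, a) (b', a'). a' = a + lin b (p 3) + lin b' (p 4 - p 1 - p 2)"
  have "gt True 0 True 0 = p" by (rule ext, rule XY_eqI) (simp_all add: XY_gtile sg_def)
  then have 0: "?Q (True, 0)" using assms by simp
  have 1: "\<exists>y. ?Q y \<and> ?R x y" if "?Q x" for x using that next_strip by fastforce
  have 2: "\<exists>y. ?Q y \<and> ?R y x" if "?Q x" for x using that previous_strip by fastforce
  obtain f :: "int \<Rightarrow> bool \<times> complex" where f: "\<And>n. ?Q (f n)" "\<And>n. ?R (f n) (f (n + 1))"
    using int_chain[of ?Q "(True, 0)" ?R, OF 0 1 2] by blast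
  define d a where "d n = fst (f n)" and "a n = snd (f n)" for n :: int
  have s: "stacked d a" using f(2) by (simp add: stacked_def d_def a_def case_prod_beta)
  have "gt (d n) (a n) True 0 \<in> T" for n using f(1) by (simp add: d_def a_def case_prod_beta)
  then have g: "gt (d n) (a n) s k \<in> T" for n s k using strip_T by blast
  have sub: "stack d a \<subseteq> T"
  proof
    fix q assume "q \<in> stack d a"
    then obtain n s k where "q = gt (d n) (a n) s k" by (auto simp: in_stack gtile_def)
    then show "q \<in> T" using g by simp
  qed
  \<comment> \<open>The stack alone covers the plane, so disjointness leaves no room for another
    tile.\<close>
  have "T \<subseteq> stack d a"
  proof
    fix q assume q: "q \<in> T"
    obtain z where z: "z \<in> body q" using simple_hexagon_topology(3)[OF simple_T[OF q]] by blast
    have "z \<in> covered (stack d a)" using covered_whole_stack[OF s] by simp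
    then obtain q' where q': "q' \<in> stack d a" "z \<in> region q'" by (auto simp: covered_def)
    then have "q' \<in> T" using sub by blast
    then have "q = q'"
      using body_region_overlap[OF simple_T[OF q] simple_T z q'(2)] disjoint_T[OF q] by blast
    then show "q \<in> stack d a" using q' by simp
  qed
  with sub s that show thesis by blast
qed

end

section \<open>Periods\<close>

text \<open>The three quotients whose arguments are the angles multiply to a quotient of the vectors
  along the sides 5 and 2. An angle sum of \<open>2 * pi\<close> makes it a positive real, and equal
  lengths make it 1.\<close>

lemma parallel_sides:
  assumes "simple_hexagon p" "angle_at p 0 + angle_at p 1 + angle_at p 2 = 2 * pi"
    and "side_length p 2 = side_length p 5"
  shows "p 3 - p 2 = p 5 - p 0"
proof -
  have i: "p i = p j \<longleftrightarrow> i = j" for i j by (rule inj_eq) (rule simple_hexagon_sides(1)[OF assms(1)])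
  have ne: "p 5 - p 0 \<noteq> 0" "p 1 - p 0 \<noteq> 0" "p 2 - p 1 \<noteq> 0" "p 3 - p 2 \<noteq> 0" "p 0 - p 1 \<noteq> 0" "p 1 - p 2 \<noteq> 0"
    by (simp_all add: i)
  have key: "\<exists>c>0. x * y * z = of_real c" if "Arg2pi x + Arg2pi y + Arg2pi z = 2 * pi" "x \<noteq> 0" "y \<noteq> 0" "z \<noteq> 0" for x y z
  proof -
    have "x * y * z = of_real (norm x) * cis (Arg2pi x) * (of_real (norm y) * cis (Arg2pi y)) * (of_real (norm z) * cis (Arg2pi z))"
      using Arg2pi_eq[of x] Arg2pi_eq[of y] Arg2pi_eq[of z] by (simp add: cis_conv_exp)
    also have "\<dots> = of_real (norm x * norm y * norm z) * cis (Arg2pi x + Arg2pi y + Arg2pi z)"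
      by (simp add: cis_mult[symmetric])
    finally show ?thesis using that by (intro exI[of _ "norm x * norm y * norm z"]) simp
  qed
  have "\<exists>c>0. p 5 - p 0 = of_real c * (p 3 - p 2)"
  proof (cases "counterclockwise p")
    case True
    have "\<exists>c>0. (p 5 - p 0) / (p 1 - p 0) * ((p 0 - p 1) / (p 2 - p 1)) * ((p 1 - p 2) / (p 3 - p 2)) = of_real c"
      by (rule key) (use assms(2) True ne in \<open>simp_all add: angle_at_def\<close>)
    moreover have "(p 5 - p 0) / (p 1 - p 0) * ((p 0 - p 1) / (p 2 - p 1)) * ((p 1 - p 2) / (p 3 - p 2)) = (p 5 - p 0) / (p 3 - p 2)"
      using ne by (simp add: divide_simps) (simp add: algebra_simps)
    ultimately obtain c where "c > 0" "(p 5 - p 0) / (p 3 - p 2) = of_real c" by metis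
    then show ?thesis using ne by (intro exI[of _ c]) (simp add: divide_simps)
  next
    case False
    have "\<exists>c>0. (p 1 - p 0) / (p 5 - p 0) * ((p 2 - p 1) / (p 0 - p 1)) * ((p 3 - p 2) / (p 1 - p 2)) = of_real c"
      by (rule key) (use assms(2) False ne in \<open>simp_all add: angle_at_def\<close>)
    moreover have "(p 1 - p 0) / (p 5 - p 0) * ((p 2 - p 1) / (p 0 - p 1)) * ((p 3 - p 2) / (p 1 - p 2)) = (p 3 - p 2) / (p 5 - p 0)"
      using ne by (simp add: divide_simps) (simp add: algebra_simps)
    ultimately obtain c where "c > 0" "(p 3 - p 2) / (p 5 - p 0) = of_real c" by metis
    then show ?thesis using ne by (intro exI[of _ "1 / c"]) (simp add: divide_simps mult.commute)
  qed
  then obtain c where c: "c > 0" "p 5 - p 0 = of_real c * (p 3 - p 2)" by blast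
  have "norm (p 5 - p 0) = norm (p 3 - p 2)"
    using assms(3) by (simp add: side_length_def dist_norm norm_minus_commute)
  then have "c * norm (p 3 - p 2) = norm (p 3 - p 2)" using c by (simp add: norm_mult)
  then have "c = 1" using ne by simp
  then show ?thesis using c by simp
qed

lemma move_id: "move (\<lambda>z. z) T = T"
  by (auto simp: move_def comp_def)

lemma degree3_move:
  assumes p: "simple_hexagon p" and f: "plane_isometry f" and T: "degree3_tiling p T"
  shows "degree3_tiling p (move f T)"
proof -
  obtain s \<alpha> \<beta> where a: "norm \<alpha> = 1" and fm: "f = mv s \<alpha> \<beta>" using plane_isometry_cases[OF f] .
  then have a0: "\<alpha> \<noteq> 0" by auto
  have inj: "inj f" unfolding fm by (rule inj_mv[OF a0])
  interpret degree3 p T using p T by unfold_locales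
  have reg: "region (f \<circ> q) = f ` region q" and bod: "body (f \<circ> q) = f ` body q" if "q \<in> T" for q
    unfolding fm using region_mv[OF a0 simple_T[OF that]] body_mv(1)[OF a0 simple_T[OF that]] by blast+
  have sid: "side (f \<circ> q) i = f ` side q i" for q i unfolding fm by (rule side_mv)
  have "tiling_by p (move f T)"
    unfolding tiling_by_def
  proof (intro conjI ballI impI)
    show "congruent_copy p q" if "q \<in> move f T" for q
      using that congruent_copy_comp[OF f congruent_T] by (auto simp: move_def)
    have "covered (move f T) = (\<Union>q\<in>T. region (f \<circ> q))" by (simp add: covered_def move_def)
    also have "\<dots> = (\<Union>q\<in>T. f ` region q)" by (intro SUP_cong refl reg)
    also have "\<dots> = f ` covered T" by (simp add: covered_def image_UN)
    also have "covered T = UNIV" using T by (simp add: degree3_tiling_def tiling_by_def)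
    finally show "covered (move f T) = UNIV" using surj_mv[OF a0] by (simp add: fm)
    fix q q' assume "q \<in> move f T" "q' \<in> move f T" "q \<noteq> q'"
    then obtain h h' where h: "h \<in> T" "h' \<in> T" "h \<noteq> h'" "q = f \<circ> h" "q' = f \<circ> h'" by (auto simp: move_def)
    have s: "simple_hexagon q" "simple_hexagon q'"
      unfolding h fm by (rule simple_hexagon_mv[OF a0 simple_T], rule h)+
    have "body q \<inter> body q' = f ` (body h \<inter> body h')" using h bod by (simp add: image_Int[OF inj])
    then show "interior (region q) \<inter> interior (region q') = {}"
      using disjoint_T[OF h(1-3)] simple_hexagon_topology(9)[OF s(1)] simple_hexagon_topology(9)[OF s(2)] by simp
  qed
  moreover have "side_to_side (move f T)"
    unfolding side_to_side_def
  proof (intro ballI allI)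
    fix q q' i j assume "q \<in> move f T" "q' \<in> move f T"
    then obtain h h' where h: "h \<in> T" "h' \<in> T" "q = f \<circ> h" "q' = f \<circ> h'" by (auto simp: move_def)
    have "side h i = side h' j \<or> side h i \<inter> side h' j \<subseteq> range h \<inter> range h'"
      using T h by (simp add: degree3_tiling_def side_to_side_def)
    then have "f ` side h i = f ` side h' j \<or> f ` (side h i \<inter> side h' j) \<subseteq> f ` (range h \<inter> range h')" by blast
    then show "side q i = side q' j \<or> side q i \<inter> side q' j \<subseteq> range q \<inter> range q'"
      unfolding h sid image_Int[OF inj] by (simp add: image_comp)
  qed
  moreover have "degree_at (move f T) (q i) = 3" if "q \<in> move f T" for q i
  proof -
    obtain h where h: "h \<in> T" "q = f \<circ> h" using \<open>q \<in> move f T\<close> by (auto simp: move_def)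
    have "{q' \<in> move f T. q i \<in> region q'} = (\<lambda>k. f \<circ> k) ` {k \<in> T. h i \<in> region k}"
      using reg inj_image_mem_iff[OF inj] by (auto simp: move_def h(2))
    moreover have "inj_on (\<lambda>k. f \<circ> k) {k \<in> T. h i \<in> region k}"
      using inj by (auto simp: inj_on_def fun_eq_iff)
    ultimately have "degree_at (move f T) (q i) = card {k \<in> T. h i \<in> region k}"
      by (simp add: degree_at_def card_image)
    then show ?thesis using T h(1) by (simp add: degree3_tiling_def degree_at_def)
  qed
  ultimately show ?thesis by (simp add: degree3_tiling_def)
qed

lemma plane_isometry_inverse:
  assumes "plane_isometry f"
  obtains g where "plane_isometry g" "g \<circ> f = id"
proof -
  obtain s \<alpha> \<beta> where a: "norm \<alpha> = 1" and f: "f = mv s \<alpha> \<beta>" using plane_isometry_cases[OF assms] .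
  then have a0: "\<alpha> \<noteq> 0" by auto
  define g where "g = inv f"
  have "surj f" "inj f" unfolding f by (rule surj_mv[OF a0], rule inj_mv[OF a0])
  then have "plane_isometry g" using assms unfolding plane_isometry_def g_def by (metis surj_f_inv_f)
  then show thesis using that \<open>inj f\<close> by (simp add: g_def)
qed

lemma move_translation_eqI:
  assumes "\<And>q. q \<in> T \<Longrightarrow> (\<lambda>i. q i + c) \<in> T" "\<And>q. q \<in> T \<Longrightarrow> (\<lambda>i. q i - c) \<in> T"
  shows "move ((+) c) T = T"
proof
  show "move ((+) c) T \<subseteq> T" using assms(1) by (auto simp: move_def comp_def add.commute)
  show "T \<subseteq> move ((+) c) T"
  proof
    fix q assume "q \<in> T"
    then have "(\<lambda>i. q i - c) \<in> T" by (rule assms(2))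
    then have "(+) c \<circ> (\<lambda>i. q i - c) \<in> move ((+) c) T" unfolding move_def by (rule imageI)
    then show "q \<in> move ((+) c) T" by (simp add: comp_def)
  qed
qed

text \<open>\<open>Im (cnj a * b)\<close> is the signed area of the fundamental parallelogram. Each
  basis is an integer combination of the other, so the two determinants are integers with product
  1.\<close>

lemma lattice_basis_det:
  assumes "{of_int m * a + of_int n * b | m n :: int. True} = {of_int m * a' + of_int n * b' | m n :: int. True}"
    and "Im (cnj a * b) \<noteq> 0"
  shows "\<bar>Im (cnj a * b)\<bar> = \<bar>Im (cnj a' * b')\<bar>"
proof -
  have mul: "\<exists>k::int. Im (cnj c' * d') = of_int k * Im (cnj c * d)"
    if "{of_int m * c' + of_int n * d' | m n :: int. True} \<subseteq> {of_int m * c + of_int n * d | m n :: int. True}" for c d c' d' :: complex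
  proof -
    have "c' \<in> {of_int m * c' + of_int n * d' | m n :: int. True}"
      by (rule CollectI, rule exI[of _ 1], rule exI[of _ 0]) simp
    from subsetD[OF that this] obtain m n :: int where e1: "c' = of_int m * c + of_int n * d" by blast
    have "d' \<in> {of_int m * c' + of_int n * d' | m n :: int. True}"
      by (rule CollectI, rule exI[of _ 0], rule exI[of _ 1]) simp
    from subsetD[OF that this] obtain r s :: int where e2: "d' = of_int r * c + of_int s * d" by blast
    have "Im (cnj c' * d') = of_int (m * s - n * r) * Im (cnj c * d)"
      unfolding e1 e2 by (simp add: algebra_simps)
    then show ?thesis by blast
  qed
  obtain k :: int where k: "Im (cnj a' * b') = of_int k * Im (cnj a * b)"
    using mul[OF eq_refl[OF assms(1)[symmetric]]] by blast
  obtain l :: int where l: "Im (cnj a * b) = of_int l * Im (cnj a' * b')"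
    using mul[OF eq_refl[OF assms(1)]] by blast
  have "of_int (l * k) * Im (cnj a * b) = Im (cnj a * b)" using k l by simp
  then have "real_of_int (l * k) = 1" using assms(2) by (metis mult_cancel_right1)
  then have "l * k = 1" by linarith
  then have "\<bar>k\<bar> = 1" using zmult_eq_1_iff[of l k] by auto
  then have "\<bar>real_of_int k\<bar> = 1" by linarith
  then show ?thesis unfolding k by (simp add: abs_mult)
qed

section \<open>Translations that preserve a stack\<close>

context strip_hexagon
begin

lemma independent_v:
  assumes "Y w \<noteq> 0"
  shows "v \<noteq> w" "independent {v, w}"
proof -
  show "v \<noteq> w" using assms by auto
  have "w \<notin> span {v}" using assms by (auto simp: span_singleton)
  then show "independent {v, w}"
    using v_nonzero by (simp add: independent_insert insert_commute)
qed

lemma dependent_multiples_v: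
  assumes "of_real x * v \<noteq> of_real y * v"
  shows "\<not> independent {of_real x * v, of_real y * v}"
proof
  assume i: "independent {of_real x * v, of_real y * v}"
  have y: "y \<noteq> 0" using i dependent_zero[of "{of_real x * v, of_real y * v}"] by auto
  have "of_real x * v \<in> span {of_real y * v}"
    unfolding span_singleton using y by (intro range_eqI[of _ _ "x / y"]) (simp add: scaleR_conv_of_real)
  then show False using i assms by (simp add: independent_insert)
qed

lemma gtile_add_v: "(\<lambda>i. gtile d a n s k i + of_int m * v) = gtile d a n s (if d n then k + m else k - m)"
  by (rule ext, rule XY_eqI) (auto simp: XY_gtile sg_def algebra_simps)

lemma gtile_translate: "d n' = d n \<Longrightarrow> a n' = a n + w \<Longrightarrow> (\<lambda>i. gtile d a n s k i + w) = gtile d a n' s k"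
  by (rule ext, rule XY_eqI) (auto simp: XY_gtile sg_def algebra_simps)

text \<open>A translation preserves the orientation, which rules out the mirrored strips, and the
  vectors along the sides, which rules out the half-turned tiles.\<close>

lemma gtile_eq_translate:
  assumes "\<And>i. gtile d a n s k i = gtile d a m True 0 i + c" "d m"
  shows "d n" "c = a n - a m + of_int k * v"
proof -
  have g: "gtile d a n s k = mv True 1 c \<circ> gtile d a m True 0"
    using assms(1) by (simp add: fun_eq_iff mv_def)
  have "ori (gtile d a n s k) = ori (gtile d a m True 0)"
    unfolding g using body_mv(2)[OF _ gtile_simple, of 1] by simp
  then show d: "d n" using assms(2) ori_cases[of p] by (auto simp: gtile_ori sg_def split: if_splits)
  have e: "gtile d a n s k i - gtile d a n s k j = p i - p j" for i j
    unfolding assms(1) by (rule XY_eqI) (use assms(2) in \<open>simp_all add: XY_gtile sg_def\<close>)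
  have "s"
  proof (rule ccontr)
    assume "\<not> s"
    then have "gtile d a n s k 0 - gtile d a n s k 1 = - (p 0 - p 1)"
      by (intro XY_eqI) (use d in \<open>simp_all add: XY_gtile sg_def\<close>)
    then have "p 0 - p 1 = - (p 0 - p 1)" using e[of 0 1] by (simp only:)
    then have "p 0 = p 1" by (auto simp: complex_eq_iff)
    then show False using simple_hexagon_sides(1)[OF simple] by (auto dest: injD)
  qed
  moreover have "X (gtile d a n s k 0) = X (gtile d a m True 0 0 + c)" "Y (gtile d a n s k 0) = Y (gtile d a m True 0 0 + c)"
    by (simp_all only: assms(1))
  ultimately show "c = a n - a m + of_int k * v"
    using d assms(2) by (intro XY_eqI) (simp_all add: XY_gtile sg_def)
qed

lemma stack_translation:
  assumes "move ((+) c) (stack d a) = stack d a" "d m"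
  obtains n k where "d n" "c = a n - a m + of_int k * v"
proof -
  have "(+) c \<circ> gtile d a m True 0 \<in> move ((+) c) (stack d a)"
    unfolding move_def using gtile_in_stack by blast
  then have "(+) c \<circ> gtile d a m True 0 \<in> stack d a" using assms(1) by simp
  then obtain n s k where "(+) c \<circ> gtile d a m True 0 = gtile d a n s k" unfolding in_stack by blast
  then have "gtile d a n s k i = gtile d a m True 0 i + c" for i by (metis add.commute comp_apply)
  from gtile_eq_translate[OF this assms(2)] that show thesis by blast
qed

text \<open>A gluing need not satisfy \<open>stacked\<close>, since moving an offset by a multiple
  of \<open>v\<close> leaves its strip unchanged. Claims about all gluings therefore have to work
  for arbitrary offsets.\<close>

lemma gluing_stack:
  assumes "strip_gluing p d T"
  obtains a where "T = stack d a"
  using assms unfolding strip_gluing_def Let_def stack_def by blast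

text \<open>The only unmirrored strip must be mapped to itself, which leaves just the multiples of
  \<open>v\<close>.\<close>

lemma not_periodic_stack: "\<not> periodic (stack (\<lambda>n. n = 0) a)"
proof
  let ?d = "\<lambda>n::int. n = 0"
  assume "periodic (stack ?d a)"
  then obtain b c where bc: "b \<noteq> c" "independent {b, c}"
    "move ((+) b) (stack ?d a) = stack ?d a" "move ((+) c) (stack ?d a) = stack ?d a"
    unfolding periodic_def by blast
  obtain k where k: "b = of_int k * v" using stack_translation[OF bc(3), of 0] by auto
  obtain l where l: "c = of_int l * v" using stack_translation[OF bc(4), of 0] by auto
  show False using dependent_multiples_v[of "of_int k" "of_int l"] bc(1,2) k l by simp
qed

end

context strip_tiling
begin

text \<open>When all tiles have the same orientation, the glide reflection is excluded at corner 3
  and the half turn remains.\<close>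

lemma rot3_T:
  assumes "\<And>q. q \<in> T \<Longrightarrow> ori q = ori p" "q \<in> T"
  shows "rot 3 q \<in> T"
proof -
  obtain D where D: "D \<in> T" "D 4 = q 3" "if ori D = ori q then D 3 = q 4 else D 5 = q 4"
    by (rule upper_neighbour[OF assms(2)])
  have "D 3 = q 4" using D(1,3) assms by simp
  then have "D 3 = rot 3 q 3" "D 4 = rot 3 q 4" using D(2) by (simp_all add: rot_def)
  moreover have "ori D = ori (rot 3 q)" using assms D(1) rot_ori[OF simple_T[OF assms(2)]] by simp
  ultimately show ?thesis
    using unique_T[OF D(1) rot_congruent[OF congruent_T[OF assms(2)]], of 3 3 4] by simp
qed

text \<open>The offsets of the gluing are arbitrary here, so the second period is taken from the
  half turns of the tiles instead of the recursion for \<open>a\<close>.\<close>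

lemma periodic_same_direction:
  assumes "T = stack (\<lambda>_. True) a"
  shows "periodic T"
proof -
  let ?d = "\<lambda>_::int. True"
  \<comment> \<open>The translation composed of the half turns about the midpoints of the sides 1
    and 3 of \<open>P\<close>.\<close>
  define w where "w = p 1 + p 2 - p 3 - p 4"
  have o: "ori q = ori p" if "q \<in> T" for q
    using that by (auto simp: assms in_stack gtile_ori sg_def)
  have two: "(\<lambda>i. q i + (q 1 + q 2 - q 3 - q 4)) \<in> T" "(\<lambda>i. q i - (q 1 + q 2 - q 3 - q 4)) \<in> T" if q: "q \<in> T" for q
  proof -
    have "rot 3 (rot 1 q) = (\<lambda>i. q i + (q 1 + q 2 - q 3 - q 4))" "rot 1 (rot 3 q) = (\<lambda>i. q i - (q 1 + q 2 - q 3 - q 4))"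
      by (simp_all add: rot_def fun_eq_iff)
    then show "(\<lambda>i. q i + (q 1 + q 2 - q 3 - q 4)) \<in> T" "(\<lambda>i. q i - (q 1 + q 2 - q 3 - q 4)) \<in> T"
      using rot3_T[OF o rot_T(2)[OF q]] rot_T(2)[OF rot3_T[OF o q]] by simp_all
  qed
  have dir: "q 1 + q 2 - q 3 - q 4 = w \<and> q 2 - q 0 = v \<or> q 1 + q 2 - q 3 - q 4 = - w \<and> q 2 - q 0 = - v" if q: "q \<in> T" for q
  proof -
    obtain n s k where e: "q = gtile ?d a n s k" using q unfolding assms in_stack by blast
    have "q 1 + q 2 - q 3 - q 4 = (if s then w else - w)" "q 2 - q 0 = (if s then v else - v)"
      unfolding e by (rule XY_eqI; simp add: XY_gtile sg_def w_def corners)+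
    then show ?thesis by (cases s) simp_all
  qed
  have "move ((+) w) T = T"
  proof (rule move_translation_eqI)
    fix q assume "q \<in> T"
    then show "(\<lambda>i. q i + w) \<in> T" "(\<lambda>i. q i - w) \<in> T" using two[of q] dir[of q] by auto
  qed
  moreover have "move ((+) v) T = T"
  proof (rule move_translation_eqI)
    fix q assume "q \<in> T"
    then show "(\<lambda>i. q i + v) \<in> T" "(\<lambda>i. q i - v) \<in> T" using shift_T[of q] dir[of q] by auto
  qed
  moreover have "Y w = - height" by (simp add: w_def height_def corners)
  then have "Y w \<noteq> 0" using height_pos by auto
  ultimately show ?thesis unfolding periodic_def using independent_v by blast
qed

end

section \<open>Periodic stacks and their minimal tori\<close>

context strip_hexagon
begin

definition period_lattice :: "complex \<Rightarrow> complex set" where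
  "period_lattice w = {of_int m * v + of_int n * w | m n :: int. True}"

text \<open>The increments of the offsets depend on the directions alone, so
  \<open>a (n + N) - a n\<close> is the same for all \<open>n\<close>.\<close>

lemma stacked_period:
  assumes "stacked d a" "\<And>n. d (n + N) = d n"
  shows "a (n + j * N) = a n + of_int j * (a N - a 0)"
proof -
  define b where "b n = a (n + N) - a n" for n
  have step: "a (n + 1) = a n + lin (d n) (p 3) + lin (d (n + 1)) (p 4 - p 1 - p 2)" for n
    using assms(1) by (simp add: stacked_def)
  have b: "b (n + 1) = b n" for n
  proof -
    have e: "n + 1 + N = n + N + 1" by simp
    have "d (n + N + 1) = d (n + 1)" using assms(2)[of "n + 1"] unfolding e .
    then show ?thesis using step[of n] step[of "n + N"] assms(2)[of n] unfolding b_def e by simp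
  qed
  have b0: "b n = b 0" for n
  proof (induction n rule: int_induct[of _ 0])
    case (step1 i) then show ?case using b[of i] by simp
  next
    case (step2 i) then show ?case using b[of "i - 1"] by simp
  qed simp
  define c where "c = a N - a 0"
  have one: "a (n + N) = a n + c" for n
    using b0[of n] by (simp add: b_def c_def algebra_simps)
  have "a (n + j * N) = a n + of_int j * c"
  proof (induction j rule: int_induct[of _ 0])
    case (step1 i)
    have "n + (i + 1) * N = (n + i * N) + N" by (simp add: algebra_simps)
    then have "a (n + (i + 1) * N) = a (n + i * N) + c" using one by metis
    then show ?case using step1 by (simp add: distrib_right)
  next
    case (step2 i)
    have "n + i * N = (n + (i - 1) * N) + N" by (simp add: algebra_simps)
    then have "a (n + i * N) = a (n + (i - 1) * N) + c" using one by metis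
    then have "a (n + (i - 1) * N) = a n + of_int i * c - c" using step2 by (simp add: eq_diff_eq)
    also have "\<dots> = a n + of_int (i - 1) * c" by (simp add: left_diff_distrib)
    finally show ?case .
  qed simp
  then show ?thesis by (simp add: c_def)
qed

lemma lattice_period:
  assumes "Y w \<noteq> 0"
  shows "lattice (period_lattice w)"
  unfolding lattice_def period_lattice_def using independent_v[OF assms] by blast

text \<open>The signed covolume of the lattice spanned by \<open>v\<close> and
  \<open>w\<close>.\<close>

lemma cross_v: "Im (cnj v * w) = (norm v)\<^sup>2 * Y w"
proof -
  have "cnj v * w = of_real ((norm v)\<^sup>2) * (w / v)"
    unfolding complex_norm_square using v_nonzero by simp
  moreover have "Im (of_real r * u) = r * Im u" for r u by simp
  ultimately show ?thesis by (metis Y_def)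
qed

text \<open>
  Only every \<open>N\<close>-th strip contains tiles with the orientation of \<open>P\<close>, which rules out all further
  translations.
\<close>

lemma periodic_stack:
  fixes N :: int
  assumes N: "0 < N" and s: "stacked (\<lambda>n. N dvd n) a"
  defines "T \<equiv> stack (\<lambda>n. N dvd n) a" and "w \<equiv> a N - a 0"
  shows "periodic T" "minimal_torus_tiling p (period_lattice w, T)" "Y w = of_int N * height"
proof -
  let ?d = "\<lambda>n. N dvd n"
  have per: "a (n + j * N) = a n + of_int j * w" for n j
    unfolding w_def by (rule stacked_period[OF s]) simp
  show Yw: "Y w = of_int N * height" using stacked_height[OF s, of N] by (simp add: w_def)
  then have Y0: "Y w \<noteq> 0" using N height_pos by auto
  have tr: "(\<lambda>i. q i + (of_int m * v + of_int n * w)) \<in> T" if q: "q \<in> T" for q and m n :: int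
  proof -
    obtain k t j where e: "q = gtile ?d a k t j" using q unfolding T_def in_stack by blast
    have "(\<lambda>i. q i + (of_int m * v + of_int n * w)) = (\<lambda>i. gtile ?d a k t (if ?d k then j + m else j - m) i + of_int n * w)"
      unfolding e gtile_add_v[symmetric] by (simp add: add.assoc)
    also have "\<dots> = gtile ?d a (k + n * N) t (if ?d k then j + m else j - m)"
      by (rule gtile_translate) (simp_all add: per)
    finally show ?thesis unfolding T_def using gtile_in_stack by simp
  qed
  have inv: "move ((+) l) T = T" if l: "l \<in> period_lattice w" for l
  proof -
    obtain m n :: int where e: "l = of_int m * v + of_int n * w" using l by (auto simp: period_lattice_def)
    show ?thesis
    proof (rule move_translation_eqI)
      fix q assume q: "q \<in> T"
      show "(\<lambda>i. q i + l) \<in> T" unfolding e by (rule tr[OF q])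
      have "(\<lambda>i. q i - l) = (\<lambda>i. q i + (of_int (- m) * v + of_int (- n) * w))"
        by (simp add: e fun_eq_iff)
      then show "(\<lambda>i. q i - l) \<in> T" using tr[OF q, of "- m" "- n"] by simp
    qed
  qed
  have "of_int 1 * v + of_int 0 * w \<in> period_lattice w" "of_int 0 * v + of_int 1 * w \<in> period_lattice w"
    unfolding period_lattice_def by blast+
  then have "v \<in> period_lattice w" "w \<in> period_lattice w" by simp_all
  then show "periodic T" unfolding periodic_def using independent_v[OF Y0] inv by blast
  have max: "l \<in> period_lattice w" if l: "move ((+) l) T = T" for l
  proof -
    obtain n k where n: "N dvd n" "l = a n - a 0 + of_int k * v"
      using stack_translation[OF l[unfolded T_def], of 0] by auto
    then obtain j where "n = j * N" by (metis dvd_def mult.commute)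
    then have "l = of_int k * v + of_int j * w" using per[of 0 j] n by simp
    then show ?thesis unfolding period_lattice_def by blast
  qed
  have deg: "degree3_tiling p T" unfolding T_def by (rule degree3_stack[OF s])
  show "minimal_torus_tiling p (period_lattice w, T)"
    unfolding minimal_torus_tiling_def
  proof (intro conjI allI impI)
    show "is_torus_tiling p (period_lattice w, T)"
      unfolding is_torus_tiling_def using lattice_period[OF Y0] deg inv by simp
    fix Z assume Z: "is_torus_tiling p Z \<and> torus_covers (period_lattice w, T) Z"
    then have "snd Z = T" "period_lattice w \<subseteq> fst Z" by (simp_all add: torus_covers_def)
    moreover have "fst Z \<subseteq> period_lattice w"
      using Z max \<open>snd Z = T\<close> by (auto simp: is_torus_tiling_def)
    ultimately show "(period_lattice w, T) = Z" by (metis prod.collapse subset_antisym)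
  qed
qed

text \<open>The linear part of an isometry keeps or negates \<open>Im (cnj a * b)\<close>. All the
  lattices contain \<open>v\<close> as a basis vector, so equal covolumes mean equal
  heights.\<close>

lemma period_lattice_isometry:
  assumes "((period_lattice w, T), (period_lattice w', T')) \<in> torus_isometry" "Y w' \<noteq> 0"
  shows "\<bar>Y w\<bar> = \<bar>Y w'\<bar>"
proof -
  obtain f where f: "plane_isometry f" "period_lattice w' = (\<lambda>l. f l - f 0) ` period_lattice w"
    using assms(1) by (auto simp: torus_isometry_def)
  obtain s \<alpha> \<beta> where a: "norm \<alpha> = 1" "f = mv s \<alpha> \<beta>" using plane_isometry_cases[OF f(1)] .
  define g where "g = (\<lambda>l. \<alpha> * (if s then l else cnj l))"
  have g: "(\<lambda>l. f l - f 0) = g" by (simp add: a g_def mv_def fun_eq_iff)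
  have "g (of_int m * v + of_int n * w) = of_int m * g v + of_int n * g w" for m n :: int
    by (simp add: g_def algebra_simps)
  then have "g ` period_lattice w = {of_int m * g v + of_int n * g w | m n :: int. True}"
    unfolding period_lattice_def by (auto simp: image_iff) metis+
  then have "{of_int m * v + of_int n * w' | m n :: int. True} = {of_int m * g v + of_int n * g w | m n :: int. True}"
    using f(2) unfolding g period_lattice_def by simp
  then have "\<bar>Im (cnj v * w')\<bar> = \<bar>Im (cnj (g v) * g w)\<bar>"
    by (rule lattice_basis_det) (use assms(2) v_nonzero in \<open>simp only: cross_v, simp\<close>)
  also have "cnj (g v) * g w = (cnj \<alpha> * \<alpha>) * (if s then cnj v * w else cnj (cnj v * w))"
    by (simp add: g_def)
  also have "cnj \<alpha> * \<alpha> = 1" using a(1) by (metis complex_norm_square mult.commute of_real_1 one_power2)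
  also have "\<bar>Im (1 * (if s then cnj v * w else cnj (cnj v * w)))\<bar> = \<bar>Im (cnj v * w)\<bar>"
    by (cases s) (simp_all del: complex_cnj_mult complex_cnj_cnj)
  finally show ?thesis
    unfolding cross_v using v_nonzero by (simp add: abs_mult)
qed

lemma infinite_minimal_tori:
  "infinite ({Z. minimal_torus_tiling p Z \<and>
                 (\<exists>d T. degree3_tiling p T \<and> strip_gluing p d T \<and> periodic T \<and>
                        plane_covers T Z)} // torus_isometry)" (is "infinite (?M // _)")
proof -
  \<comment> \<open>The modulus is a successor in order to be positive; \<open>N = 0\<close> is the
    stack with all directions equal.\<close>
  have "\<exists>a. stacked (\<lambda>n. int (Suc N) dvd n) a" for N by (rule stacked_exists)
  then obtain a where a: "\<And>N. stacked (\<lambda>n. int (Suc N) dvd n) (a N)" by metis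
  define w where "w N = a N (int (Suc N)) - a N 0" for N
  define Z where "Z N = (period_lattice (w N), stack (\<lambda>n. int (Suc N) dvd n) (a N))" for N
  have P: "periodic (stack (\<lambda>n. int (Suc N) dvd n) (a N))"
    "minimal_torus_tiling p (period_lattice (w N), stack (\<lambda>n. int (Suc N) dvd n) (a N))"
    "Y (w N) = of_int (int (Suc N)) * height" for N
  proof -
    have N: "0 < int (Suc N)" by simp
    show "periodic (stack (\<lambda>n. int (Suc N) dvd n) (a N))"
      by (rule periodic_stack(1)[OF N a])
    show "minimal_torus_tiling p (period_lattice (w N), stack (\<lambda>n. int (Suc N) dvd n) (a N))"
      unfolding w_def by (rule periodic_stack(2)[OF N a])
    show "Y (w N) = of_int (int (Suc N)) * height"
      unfolding w_def by (rule periodic_stack(3)[OF N a])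
  qed
  have M: "Z N \<in> ?M" for N
    unfolding Z_def plane_covers_def mem_Collect_eq snd_conv
    using P(1,2)[of N] degree3_stack[OF a[of N]] stack_gluing[OF a[of N]] by blast
  have Y: "Y (w N) = of_int (int (Suc N)) * height" for N by (rule P(3))
  have Y0: "Y (w N) \<noteq> 0" for N unfolding Y using height_pos by auto
  have "inj (\<lambda>N. torus_isometry `` {Z N})"
  proof (rule injI)
    fix N K assume eq: "torus_isometry `` {Z N} = torus_isometry `` {Z K}"
    \<comment> \<open>Reflexivity at \<open>Z K\<close> suffices to turn the equality of the two
      images into a pair of isometric tori.\<close>
    have "plane_isometry (\<lambda>z. z)" by (simp add: plane_isometry_def)
    then have "(Z K, Z K) \<in> torus_isometry"
      unfolding torus_isometry_def by (intro CollectI case_prodI exI[of _ "\<lambda>z. z"]) (simp add: move_id)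
    then have "(Z N, Z K) \<in> torus_isometry" using eq by blast
    then have "\<bar>Y (w N)\<bar> = \<bar>Y (w K)\<bar>" unfolding Z_def by (rule period_lattice_isometry) (rule Y0)
    then have "of_int (int (Suc N)) * \<bar>height\<bar> = of_int (int (Suc K)) * \<bar>height\<bar>" unfolding Y by (simp add: abs_mult)
    moreover have "height \<noteq> 0" using height_pos by auto
    ultimately show "N = K" by simp
  qed
  then have "infinite (range (\<lambda>N. torus_isometry `` {Z N}))" by (rule range_inj_infinite)
  moreover have "range (\<lambda>N. torus_isometry `` {Z N}) \<subseteq> ?M // torus_isometry"
    by (rule image_subsetI) (rule quotientI[OF M])
  ultimately show ?thesis by (rule infinite_super[rotated])
qed

end

theorem theorem3p2:
  fixes p :: hexagon
  assumes "simple_hexagon p"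
    and "angle_at p 0 + angle_at p 1 + angle_at p 2 = 2 * pi"
    and "angle_at p 3 + angle_at p 4 + angle_at p 5 = 2 * pi"
    and "side_length p 2 = side_length p 5"
    and "\<forall>j. j \<noteq> 0 \<longrightarrow> side_length p j \<noteq> side_length p 0"
    and "\<forall>j. j \<noteq> 1 \<longrightarrow> side_length p j \<noteq> side_length p 1"
    and "side_length p 3 = side_length p 4"
  shows "(\<forall>T. degree3_tiling p T \<longrightarrow>
              (\<exists>f d. plane_isometry f \<and> strip_gluing p d (move f T))) \<and>
         (\<forall>d. \<exists>T. degree3_tiling p T \<and> strip_gluing p d T) \<and>
         (\<exists>d. \<forall>T. degree3_tiling p T \<and> strip_gluing p d T \<longrightarrow> periodic T) \<and>
         (\<exists>d. \<forall>T. degree3_tiling p T \<and> strip_gluing p d T \<longrightarrow> \<not> periodic T) \<and>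
         infinite ({X. minimal_torus_tiling p X \<and>
                       (\<exists>d T. degree3_tiling p T \<and> strip_gluing p d T \<and> periodic T \<and>
                              plane_covers T X)} // torus_isometry)"
proof -
  interpret strip_hexagon p
    using assms(1,7) parallel_sides[OF assms(1,2,4)] by unfold_locales (simp_all add: side_length_def)
  have st: "strip_tiling p T" if "degree3_tiling p T" for T
    using assms(1,5,6) that by unfold_locales auto
  have "\<exists>f d. plane_isometry f \<and> strip_gluing p d (move f T)" if T: "degree3_tiling p T" for T
  proof -
    interpret T: strip_tiling p T by (rule st[OF T])
    obtain q where q: "q \<in> T" using T.cover_T by metis
    then obtain g where g: "plane_isometry g" "q = g \<circ> p" using T.congruent_T by (auto simp: congruent_copy_def)
    \<comment> \<open>Undoing the placement of one tile makes \<open>P\<close> itself a tile, from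
      which the sequence of strips starts with offset 0 in the positive direction.\<close>
    obtain f where f: "plane_isometry f" "f \<circ> g = id" by (rule plane_isometry_inverse[OF g(1)])
    interpret fT: strip_tiling p "move f T" by (rule st[OF degree3_move[OF assms(1) f(1) T]])
    have "f \<circ> q = p" using f(2) g(2) by (metis comp_assoc comp_id id_comp)
    then have "p \<in> move f T" using q by (auto simp: move_def)
    from fT.tiling_is_stack[OF this] obtain d a where "stacked d a" "move f T = stack d a" .
    then show ?thesis using stack_gluing f(1) by metis
  qed
  moreover have "\<exists>T. degree3_tiling p T \<and> strip_gluing p d T" for d
    using stacked_exists[of d] degree3_stack stack_gluing by blast
  moreover have "periodic T" if T: "degree3_tiling p T" "strip_gluing p (\<lambda>_. True) T" for T
  proof -
    interpret T: strip_tiling p T by (rule st[OF T(1)])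
    obtain a where "T = stack (\<lambda>_. True) a" by (rule gluing_stack[OF T(2)])
    then show ?thesis by (rule T.periodic_same_direction)
  qed
  moreover have "\<not> periodic T" if "strip_gluing p (\<lambda>n. n = 0) T" for T
    using gluing_stack[OF that] not_periodic_stack by metis
  ultimately show ?thesis using infinite_minimal_tori by blast
qed

end
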